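(* Let $M$ be a manifold of dimension $2n+1$ and let $f\colon M\rightarrow\mathbb{R}^{2n+2}$ be a flat $\widetilde{J}$-tangent affine hypersphere. Then the distribution $\mathcal{D}$ is involutive and $f$ is affine equivalent to either $$(x_1^2\pm x_2^2)(x_3^2\pm x_4^2)\cdots(x_{2n+1}^2\pm x_{2n+2}^2)=1,$$ if $n$ is odd, or $$(x_1^2\pm x_2^2)(x_3^2\pm x_4^2)\cdots(x_{2n-1}^2\pm x_{2n}^2)x_{2n+1}x_{2n+2}=1,$$ if $n$ is even (for some choice of the signs $\pm$, chosen independently in each factor).
   Context: Let $n\ge1$. $\widetilde{J}$ is the standard para-complex structure on $\mathbb{R}^{2n+2}$: $\widetilde{J}(x_1,\ldots,x_{n+1},y_1,\ldots,y_{n+1})=(y_1,\ldots,y_{n+1},x_1,\ldots,x_{n+1})$. Affine equivalence to a hypersurface given by an equation is understood locally: every point of $M$ has a neighbourhood whose image under $f$ is mapped by some affine transformation of $\mathbb{R}^{2n+2}$ onto an open part of that hypersurface. For an immersion $f\colon M^{N}\to\mathbb{R}^{N+1}$ ($M$ connected, orientable) with transversal field $C$, the objects $\nabla,h,S,\tau$ are defined by $\mathrm{D}_Xf_*Y=f_*(\nabla_XY)+h(X,Y)C$, $\mathrm{D}_XC=-f_*(SX)+\tau(X)C$, with $\mathrm{D}$ the flat connection. $f$ is nondegenerate if $h$ is. For nondegenerate $f$ the affine normal (Blaschke) field is the transversal field $C$, unique up to sign, such that the metric volume form $\omega_h(X_1,\ldots,X_N)=|\det[h(X_i,X_j)]|^{1/2}$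 (bases positively oriented with respect to $\Theta$) is $\nabla$-parallel and equals $\Theta(X_1,\ldots,X_N)=\det[f_*X_1,\ldots,f_*X_N,C]$; then $h$ is the affine (Blaschke) metric. With this $C$, $f$ is an affine hypersphere if $S=\lambda I$, $\lambda$ constant; it is flat if the affine metric $h$ is flat (zero sectional curvature). A $\widetilde{J}$-tangent affine hypersphere is an affine hypersphere whose Blaschke field satisfies $\widetilde{J}C_x\in f_*(T_xM)$ for all $x$. The distribution $\mathcal{D}$ is $\mathcal{D}_x=f_*^{-1}(f_*(T_xM)\cap\widetilde{J}(f_*(T_xM)))$ (of constant dimension $2n$). *)

theory Defs
  imports "HOL-Analysis.Analysis"
begin

fun Ck_on :: "nat \<Rightarrow> 'a::real_normed_vector set \<Rightarrow> ('a \<Rightarrow> 'b::real_normed_vector) \<Rightarrow> bool" where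
  "Ck_on 0 W f \<longleftrightarrow> continuous_on W f"
| "Ck_on (Suc k) W f \<longleftrightarrow> (\<forall>x\<in>W. f differentiable (at x)) \<and>
     (\<forall>v. Ck_on k W (\<lambda>x. frechet_derivative f (at x) v))"

text \<open>Only used for open sets \<open>W\<close> of finite-dimensional spaces.\<close>
definition smooth_on :: "'a::real_normed_vector set \<Rightarrow> ('a \<Rightarrow> 'b::real_normed_vector) \<Rightarrow> bool" where
  "smooth_on W f \<longleftrightarrow> (\<forall>k. Ck_on k W f)"

text \<open>A chart is a pair \<open>(U, \<phi>)\<close>; the values of \<open>\<phi>\<close> outside its domain \<open>U\<close> are irrelevant.
  The manifold \<open>M\<close> is the whole type \<open>'m\<close>.\<close>
type_synonym ('m, 'd) chart = "'m set \<times> ('m \<Rightarrow> real^'d)"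

definition smooth_atlas :: "('m::topological_space, 'd::finite) chart set \<Rightarrow> bool" where
  "smooth_atlas A \<longleftrightarrow>
     (\<Union>(U, \<phi>)\<in>A. U) = UNIV \<and>
     (\<forall>(U, \<phi>)\<in>A. open U \<and> open (\<phi> ` U) \<and> homeomorphism U (\<phi> ` U) \<phi> (inv_into U \<phi>)) \<and>
     (\<forall>(U, \<phi>)\<in>A. \<forall>(V, \<psi>)\<in>A. smooth_on (\<phi> ` (U \<inter> V)) (\<psi> \<circ> inv_into U \<phi>))"

definition orientable_atlas :: "('m::topological_space, 'd::finite) chart set \<Rightarrow> bool" where
  "orientable_atlas A \<longleftrightarrow>
     (\<exists>B. smooth_atlas B \<and> smooth_atlas (A \<union> B) \<and>
        (\<forall>(U, \<phi>)\<in>B. \<forall>(V, \<psi>)\<in>B. \<forall>y\<in>\<phi> ` (U \<inter> V).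
           0 < det (matrix (frechet_derivative (\<psi> \<circ> inv_into U \<phi>) (at y)))))"

definition in_chart :: "('m, 'd::finite) chart \<Rightarrow> ('m \<Rightarrow> 'b) \<Rightarrow> real^'d \<Rightarrow> 'b" where
  "in_chart \<kappa> F = F \<circ> inv_into (fst \<kappa>) (snd \<kappa>)"

definition chart_image :: "('m, 'd::finite) chart \<Rightarrow> (real^'d) set" where
  "chart_image \<kappa> = snd \<kappa> ` fst \<kappa>"

definition smooth_map ::
  "('m, 'd::finite) chart set \<Rightarrow> ('m \<Rightarrow> 'b::real_normed_vector) \<Rightarrow> bool" where
  "smooth_map A F \<longleftrightarrow> (\<forall>\<kappa>\<in>A. smooth_on (chart_image \<kappa>) (in_chart \<kappa> F))"

definition immersion ::
  "('m, 'd::finite) chart set \<Rightarrow> ('m \<Rightarrow> 'b::real_normed_vector) \<Rightarrow> bool" where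
  "immersion A f \<longleftrightarrow> smooth_map A f \<and>
     (\<forall>\<kappa>\<in>A. \<forall>y\<in>chart_image \<kappa>. inj (frechet_derivative (in_chart \<kappa> f) (at y)))"

text \<open>With \<open>CARD('k) = n + 1\<close>, the space \<open>\<real>\<^sup>2\<^sup>n\<^sup>+\<^sup>2\<close> is \<open>real^('k + 'k)\<close>; the components
  with index \<open>Inl a\<close> are the \<open>x\<close>-coordinates and those with index \<open>Inr a\<close> the
  \<open>y\<close>-coordinates. The numbering of \<open>'k\<close> by \<open>1, ..., n + 1\<close> is arbitrary; it induces the
  numbering \<open>(x\<^sub>1, ..., x\<^sub>n\<^sub>+\<^sub>1, y\<^sub>1, ..., y\<^sub>n\<^sub>+\<^sub>1)\<close> of the coordinates by \<open>1, ..., 2n + 2\<close>.\<close>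

definition position :: "'k::finite \<Rightarrow> nat" where
  "position = (SOME p. bij_betw p UNIV {1..CARD('k)})"

definition coord_position :: "'k::finite + 'k \<Rightarrow> nat" where
  "coord_position a = (case a of Inl b \<Rightarrow> position b | Inr b \<Rightarrow> CARD('k) + position b)"

definition coord :: "nat \<Rightarrow> real^('k::finite + 'k) \<Rightarrow> real" where
  "coord i v = v $ (inv coord_position i)"

definition J_tilde :: "real^('k::finite + 'k) \<Rightarrow> real^('k + 'k)" where
  "J_tilde v = (\<chi> a. case a of Inl b \<Rightarrow> v $ Inr b | Inr b \<Rightarrow> v $ Inl b)"

text \<open>In a chart, \<open>g\<close> and \<open>c\<close> are the local representatives of the immersion \<open>f\<close> and of the
  transversal field \<open>C\<close>, and \<open>X\<close>, \<open>Y\<close>, \<open>Z\<close> are vector fields on the chart image. The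
  operator \<open>D\<close> is both the flat connection and the derivative of functions along \<open>X\<close>.\<close>

type_synonym 'd vfield = "real^'d \<Rightarrow> real^'d"

definition D :: "'d::finite vfield \<Rightarrow> (real^'d \<Rightarrow> 'b::real_normed_vector) \<Rightarrow> real^'d \<Rightarrow> 'b" where
  "D X F y = frechet_derivative F (at y) (X y)"

definition lie_bracket :: "'d::finite vfield \<Rightarrow> 'd vfield \<Rightarrow> 'd vfield" where
  "lie_bracket X Y y = D X Y y - D Y X y"

definition push ::
  "(real^'d::finite \<Rightarrow> 'b::real_normed_vector) \<Rightarrow> 'd vfield \<Rightarrow> real^'d \<Rightarrow> 'b" where
  "push g Y y = frechet_derivative g (at y) (Y y)"

definition tangent_image ::
  "(real^'d::finite \<Rightarrow> 'b::real_normed_vector) \<Rightarrow> real^'d \<Rightarrow> 'b set" where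
  "tangent_image g y = range (frechet_derivative g (at y))"

text \<open>The components of the decomposition \<open>v = g\<^sub>*w + s c\<close>.\<close>

definition tangential ::
  "(real^'d::finite \<Rightarrow> 'b::real_normed_vector) \<Rightarrow> (real^'d \<Rightarrow> 'b) \<Rightarrow> real^'d \<Rightarrow> 'b \<Rightarrow> real^'d" where
  "tangential g c y v = (THE w. \<exists>s. v = frechet_derivative g (at y) w + s *\<^sub>R c y)"

definition transversal ::
  "(real^'d::finite \<Rightarrow> 'b::real_normed_vector) \<Rightarrow> (real^'d \<Rightarrow> 'b) \<Rightarrow> real^'d \<Rightarrow> 'b \<Rightarrow> real" where
  "transversal g c y v = (THE s. \<exists>w. v = frechet_derivative g (at y) w + s *\<^sub>R c y)"

definition nabla ::
  "(real^'d::finite \<Rightarrow> 'b::real_normed_vector) \<Rightarrow> (real^'d \<Rightarrow> 'b) \<Rightarrow> 'd vfield \<Rightarrow> 'd vfield \<Rightarrow> 'd vfield"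
  where "nabla g c X Y y = tangential g c y (D X (push g Y) y)"

text \<open>Since \<open>h\<close> and \<open>S\<close> are tensorial, they are evaluated at tangent vectors \<open>u\<close>, \<open>v\<close> at \<open>y\<close>
  by means of constant fields.\<close>

definition h_form ::
  "(real^'d::finite \<Rightarrow> 'b::real_normed_vector) \<Rightarrow> (real^'d \<Rightarrow> 'b) \<Rightarrow> real^'d \<Rightarrow> real^'d \<Rightarrow> real^'d \<Rightarrow> real"
  where "h_form g c y u v = transversal g c y (D (\<lambda>_. u) (push g (\<lambda>_. v)) y)"

definition shape_op ::
  "(real^'d::finite \<Rightarrow> 'b::real_normed_vector) \<Rightarrow> (real^'d \<Rightarrow> 'b) \<Rightarrow> real^'d \<Rightarrow> real^'d \<Rightarrow> real^'d"
  where "shape_op g c y u = - tangential g c y (D (\<lambda>_. u) c y)"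

text \<open>Frames \<open>X\<^sub>1, ..., X\<^sub>N\<close> with \<open>N = CARD('d) = 2n + 1\<close> are functions on \<open>nat\<close> of which
  only the values at \<open>1, ..., N\<close> matter; the column numbered \<open>N + 1 = 2n + 2\<close> is \<open>c\<close>.\<close>

definition Theta ::
  "(real^'d::finite \<Rightarrow> real^('k::finite + 'k)) \<Rightarrow> (real^'d \<Rightarrow> real^('k + 'k)) \<Rightarrow>
   real^'d \<Rightarrow> (nat \<Rightarrow> real^'d) \<Rightarrow> real" where
  "Theta g c y X = det (\<chi> i j.
     (if coord_position j \<le> CARD('d) then frechet_derivative g (at y) (X (coord_position j))
      else c y) $ i)"

text \<open>The value of the metric volume form on an arbitrary tuple of vectors, from its value on
  positively oriented bases; the orientation is the one given by \<open>Theta\<close>.\<close>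
definition omega_h ::
  "(real^'d::finite \<Rightarrow> real^('k::finite + 'k)) \<Rightarrow> (real^'d \<Rightarrow> real^('k + 'k)) \<Rightarrow>
   real^'d \<Rightarrow> (nat \<Rightarrow> real^'d) \<Rightarrow> real" where
  "omega_h g c y X = sgn (Theta g c y X) *
     sqrt \<bar>det (\<chi> i j::'d. h_form g c y (X (position i)) (X (position j)))\<bar>"

definition transversal_field ::
  "('m, 'd::finite) chart set \<Rightarrow> ('m \<Rightarrow> 'b::real_normed_vector) \<Rightarrow> ('m \<Rightarrow> 'b) \<Rightarrow> bool" where
  "transversal_field A f C \<longleftrightarrow> smooth_map A C \<and>
     (\<forall>\<kappa>\<in>A. \<forall>y\<in>chart_image \<kappa>. in_chart \<kappa> C y \<notin> tangent_image (in_chart \<kappa> f) y)"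

definition nondegenerate ::
  "('m, 'd::finite) chart set \<Rightarrow> ('m \<Rightarrow> 'b::real_normed_vector) \<Rightarrow> ('m \<Rightarrow> 'b) \<Rightarrow> bool" where
  "nondegenerate A f C \<longleftrightarrow>
     (\<forall>\<kappa>\<in>A. \<forall>y\<in>chart_image \<kappa>. \<forall>u. u \<noteq> 0 \<longrightarrow>
        (\<exists>v. h_form (in_chart \<kappa> f) (in_chart \<kappa> C) y u v \<noteq> 0))"

definition omega_h_eq_Theta ::
  "('m, 'd::finite) chart set \<Rightarrow> ('m \<Rightarrow> real^('k::finite + 'k)) \<Rightarrow> ('m \<Rightarrow> real^('k + 'k)) \<Rightarrow> bool"
  where
  "omega_h_eq_Theta A f C \<longleftrightarrow>
     (\<forall>\<kappa>\<in>A. \<forall>y\<in>chart_image \<kappa>. \<forall>X.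
        omega_h (in_chart \<kappa> f) (in_chart \<kappa> C) y X = Theta (in_chart \<kappa> f) (in_chart \<kappa> C) y X)"

text \<open>\<open>\<nabla>\<omega>\<^sub>h = 0\<close>, that is,
  \<open>Z(\<omega>\<^sub>h(X\<^sub>1, ..., X\<^sub>N)) = \<Sum>\<^sub>i \<omega>\<^sub>h(X\<^sub>1, ..., \<nabla>\<^sub>ZX\<^sub>i, ..., X\<^sub>N)\<close>.\<close>
definition omega_h_parallel ::
  "('m, 'd::finite) chart set \<Rightarrow> ('m \<Rightarrow> real^('k::finite + 'k)) \<Rightarrow> ('m \<Rightarrow> real^('k + 'k)) \<Rightarrow> bool"
  where
  "omega_h_parallel A f C \<longleftrightarrow>
     (\<forall>\<kappa>\<in>A. \<forall>Z :: 'd vfield. \<forall>X :: nat \<Rightarrow> 'd vfield.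
        smooth_on (chart_image \<kappa>) Z \<and> (\<forall>i. smooth_on (chart_image \<kappa>) (X i)) \<longrightarrow>
        (let g = in_chart \<kappa> f; c = in_chart \<kappa> C in
         \<forall>y\<in>chart_image \<kappa>.
           D Z (\<lambda>p. omega_h g c p (\<lambda>j. X j p)) y =
           (\<Sum>i\<in>{1..CARD('d)}. omega_h g c y ((\<lambda>j. X j y)(i := nabla g c Z (X i) y)))))"

definition blaschke_field ::
  "('m, 'd::finite) chart set \<Rightarrow> ('m \<Rightarrow> real^('k::finite + 'k)) \<Rightarrow> ('m \<Rightarrow> real^('k + 'k)) \<Rightarrow> bool"
  where
  "blaschke_field A f C \<longleftrightarrow>
     transversal_field A f C \<and> nondegenerate A f C \<and>
     omega_h_eq_Theta A f C \<and> omega_h_parallel A f C"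

definition affine_hypersphere ::
  "('m, 'd::finite) chart set \<Rightarrow> ('m \<Rightarrow> real^('k::finite + 'k)) \<Rightarrow> ('m \<Rightarrow> real^('k + 'k)) \<Rightarrow> bool"
  where
  "affine_hypersphere A f C \<longleftrightarrow>
     immersion A f \<and> blaschke_field A f C \<and>
     (\<exists>l::real. \<forall>\<kappa>\<in>A. \<forall>y\<in>chart_image \<kappa>. \<forall>u.
        shape_op (in_chart \<kappa> f) (in_chart \<kappa> C) y u = l *\<^sub>R u)"

definition J_tangent_affine_hypersphere ::
  "('m, 'd::finite) chart set \<Rightarrow> ('m \<Rightarrow> real^('k::finite + 'k)) \<Rightarrow> ('m \<Rightarrow> real^('k + 'k)) \<Rightarrow> bool"
  where
  "J_tangent_affine_hypersphere A f C \<longleftrightarrow>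
     affine_hypersphere A f C \<and>
     (\<forall>\<kappa>\<in>A. \<forall>y\<in>chart_image \<kappa>. J_tilde (in_chart \<kappa> C y) \<in> tangent_image (in_chart \<kappa> f) y)"

type_synonym 'd metric = "real^'d \<Rightarrow> real^'d \<Rightarrow> real^'d \<Rightarrow> real"

text \<open>Koszul formula for constant fields.\<close>
definition christoffel :: "'d::finite metric \<Rightarrow> real^'d \<Rightarrow> real^'d \<Rightarrow> real^'d \<Rightarrow> real^'d" where
  "christoffel m y u v = (THE w. \<forall>z. 2 * m y w z =
     D (\<lambda>_. u) (\<lambda>p. m p v z) y + D (\<lambda>_. v) (\<lambda>p. m p u z) y - D (\<lambda>_. z) (\<lambda>p. m p u v) y)"

definition levi_civita :: "'d::finite metric \<Rightarrow> 'd vfield \<Rightarrow> 'd vfield \<Rightarrow> 'd vfield" where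
  "levi_civita m X Y y = D X Y y + christoffel m y (X y) (Y y)"

definition riemann_curvature ::
  "'d::finite metric \<Rightarrow> 'd vfield \<Rightarrow> 'd vfield \<Rightarrow> 'd vfield \<Rightarrow> 'd vfield" where
  "riemann_curvature m X Y Z y =
     levi_civita m X (levi_civita m Y Z) y - levi_civita m Y (levi_civita m X Z) y
     - levi_civita m (lie_bracket X Y) Z y"

definition plane_discriminant :: "'d::finite metric \<Rightarrow> real^'d \<Rightarrow> real^'d \<Rightarrow> real^'d \<Rightarrow> real" where
  "plane_discriminant m y u v = m y u u * m y v v - (m y u v)\<^sup>2"

definition sectional_curvature :: "'d::finite metric \<Rightarrow> real^'d \<Rightarrow> real^'d \<Rightarrow> real^'d \<Rightarrow> real" where
  "sectional_curvature m y u v =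
     m y (riemann_curvature m (\<lambda>_. u) (\<lambda>_. v) (\<lambda>_. v) y) u / plane_discriminant m y u v"

text \<open>For an indefinite metric the sectional curvature is defined on nondegenerate planes.\<close>
definition flat_affine_metric ::
  "('m, 'd::finite) chart set \<Rightarrow> ('m \<Rightarrow> real^('k::finite + 'k)) \<Rightarrow> ('m \<Rightarrow> real^('k + 'k)) \<Rightarrow> bool"
  where
  "flat_affine_metric A f C \<longleftrightarrow>
     (\<forall>\<kappa>\<in>A. \<forall>y\<in>chart_image \<kappa>. \<forall>u v.
        let h = h_form (in_chart \<kappa> f) (in_chart \<kappa> C) in
        plane_discriminant h y u v \<noteq> 0 \<longrightarrow> sectional_curvature h y u v = 0)"

definition distr_D :: "(real^'d::finite \<Rightarrow> real^('k::finite + 'k)) \<Rightarrow> real^'d \<Rightarrow> (real^'d) set" where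
  "distr_D g y = frechet_derivative g (at y) -` (tangent_image g y \<inter> J_tilde ` tangent_image g y)"

definition distr_D_involutive ::
  "('m, 'd::finite) chart set \<Rightarrow> ('m \<Rightarrow> real^('k::finite + 'k)) \<Rightarrow> bool" where
  "distr_D_involutive A f \<longleftrightarrow>
     (\<forall>\<kappa>\<in>A. \<forall>W (X :: 'd vfield) Y.
        open W \<and> W \<subseteq> chart_image \<kappa> \<and> smooth_on W X \<and> smooth_on W Y \<and>
        (\<forall>y\<in>W. X y \<in> distr_D (in_chart \<kappa> f) y \<and> Y y \<in> distr_D (in_chart \<kappa> f) y) \<longrightarrow>
        (\<forall>y\<in>W. lie_bracket X Y y \<in> distr_D (in_chart \<kappa> f) y))"

definition affine_equivalent ::
  "('m::topological_space \<Rightarrow> 'b::euclidean_space) \<Rightarrow> 'b set \<Rightarrow> bool" where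
  "affine_equivalent f \<Sigma> \<longleftrightarrow>
     (\<forall>p. \<exists>U L b. open U \<and> p \<in> U \<and> linear L \<and> bij L \<and>
        openin (top_of_set \<Sigma>) ((\<lambda>v. L v + b) ` f ` U))"

end

theory Submission
  imports Defs "HOL-Computational_Algebra.Fundamental_Theorem_Algebra"
begin

text \<open>
  After a translation the position vector \<open>G\<close> of the hypersphere is a multiple of the Blaschke
  field; the hypersphere is proper because a constant field \<open>C\<close> with \<open>J C\<close> tangent would make \<open>h\<close>
  degenerate. At every point the Hessian of \<open>G\<close> with respect to the Levi-Civita connection of the
  affine metric extends to a commutative product on the ambient space with identity \<open>G\<close>. Flatness
  of the affine metric is the associativity of this product, and apolarity (equality of the volume
  forms) makes its trace form nondegenerate. Such algebras are rigid, and the Codazzi equation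
  then forces the product to vary by the structure equation
  \<open>D\<^sub>w (a b) = - (D\<^sub>w G) a b\<close>, that is, \<open>a b = G\<inverse> * a * b\<close> for a fixed product \<open>*\<close>.
  Hence \<open>G\<close> stays in a level set of the norm form of a product of copies of the real and the complex
  numbers. The vector \<open>j = J G\<close> satisfies \<open>j j = G\<close> and has trace \<open>0\<close>, which is impossible in a
  product of an odd number of complex fields. Multiplication by \<open>j\<close> is \<open>J\<close>, so the form whose
  kernel is \<open>\<D>\<close> is closed on \<open>\<D>\<close> by associativity.
\<close>

section \<open>Directional derivatives and smooth maps\<close>

text \<open>The guiding model is the set of \<open>exp x\<close>, with \<open>x\<close> of trace
  zero, in a product of real and complex fields. The coordinates \<open>x\<close> flatten the affine
  metric, and a tangent vector is the position times a trace-free element. Dividing ordinary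
  products by the position gives a product with the position as identity; this is the one that the
  Hessian supplies at each point in general.

  Three obstacles shape the rest. Flatness is given on nondegenerate planes only, so the curvature
  tensor is recovered by perturbing degenerate ones. The algebra is classified separately at each
  point, with signs and coordinates chosen without continuity; a single equation for all of
  \<open>M\<close> needs the fact that a small open piece of a unit level determines the norm form.
  Finally, the normal form consists of quadratic factors: real fields occur in even number because
  the ambient dimension is even, and two of them combine to \<open>x^2 - y^2\<close>. When
  \<open>n\<close> is even such a pair must be shown to exist, since the last factor has to split
  into \<open>x y\<close>.\<close>

abbreviation dd :: "'a::real_normed_vector \<Rightarrow> ('a \<Rightarrow> 'b::real_normed_vector) \<Rightarrow> 'a \<Rightarrow> 'b" where
  "dd w F y \<equiv> frechet_derivative F (at y) w"

lemma dd_eqI: "(F has_derivative F') (at y) \<Longrightarrow> dd w F y = F' w"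
  using frechet_derivative_at by metis

lemma dd_cong:
  assumes "open W" "y \<in> W" "\<And>x. x \<in> W \<Longrightarrow> F x = H x"
  shows "dd w F y = dd w H y"
proof -
  have "(F has_derivative L) (at y) \<longleftrightarrow> (H has_derivative L) (at y)" for L
    using has_derivative_transform_within_open[OF _ assms(1,2), of F L UNIV H]
      has_derivative_transform_within_open[OF _ assms(1,2), of H L UNIV F] assms(3) by auto
  then show ?thesis unfolding frechet_derivative_def by simp
qed

lemma differentiable_cong_open:
  assumes "open W" "y \<in> W" "\<And>x. x \<in> W \<Longrightarrow> F x = H x"
  shows "F differentiable (at y) \<longleftrightarrow> H differentiable (at y)"
  using has_derivative_transform_within_open[OF _ assms(1,2), of F _ UNIV H]
      has_derivative_transform_within_open[OF _ assms(1,2), of H _ UNIV F] assms(3)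
  unfolding differentiable_def by metis

lemma linear_dd: "F differentiable (at y) \<Longrightarrow> linear (\<lambda>w. dd w F y)"
  by (rule linear_frechet_derivative)

lemma
  assumes "F differentiable (at y)" "H differentiable (at y)"
  shows dd_add: "dd w (\<lambda>x. F x + H x) y = dd w F y + dd w H y"
    and dd_diff: "dd w (\<lambda>x. F x - H x) y = dd w F y - dd w H y"
proof -
  show "dd w (\<lambda>x. F x + H x) y = dd w F y + dd w H y"
    by (rule dd_eqI) (auto intro!: derivative_eq_intros assms[unfolded frechet_derivative_works])
  show "dd w (\<lambda>x. F x - H x) y = dd w F y - dd w H y"
    by (rule dd_eqI) (auto intro!: derivative_eq_intros assms[unfolded frechet_derivative_works])
qed

lemma dd_bounded_linear:
  assumes "bounded_linear L" "F differentiable (at y)"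
  shows "dd w (\<lambda>x. L (F x)) y = L (dd w F y)"
  by (rule dd_eqI) (use bounded_linear.has_derivative[OF assms(1) assms(2)[unfolded frechet_derivative_works]] in auto)

lemma dd_linear:
  fixes L :: "'a::euclidean_space \<Rightarrow> 'b::real_normed_vector"
  assumes "linear L" "F differentiable (at y)"
  shows "dd w (\<lambda>x. L (F x)) y = L (dd w F y)"
  using dd_bounded_linear assms linear_conv_bounded_linear by blast

lemma dd_bounded_bilinear:
  assumes "bounded_bilinear B" "F differentiable (at y)" "H differentiable (at y)"
  shows "dd w (\<lambda>x. B (F x) (H x)) y = B (F y) (dd w H y) + B (dd w F y) (H y)"
  by (rule dd_eqI) (use bounded_bilinear.FDERIV[OF assms(1) assms(2,3)[unfolded frechet_derivative_works]] in auto)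

lemma dd_sum:
  assumes "\<And>i. i \<in> I \<Longrightarrow> F i differentiable (at y)"
  shows "dd w (\<lambda>x. \<Sum>i\<in>I. F i x) y = (\<Sum>i\<in>I. dd w (F i) y)"
  by (rule dd_eqI) (use has_derivative_sum[of I F, OF assms[unfolded frechet_derivative_works]] in auto)

section \<open>Closure properties of smooth maps\<close>

lemma Ck_on_cong:
  assumes "open W" "\<And>x. x \<in> W \<Longrightarrow> F x = H x"
  shows "Ck_on k W F \<longleftrightarrow> Ck_on k W H"
  using assms(2)
proof (induction k arbitrary: F H)
  case 0
  then show ?case by (simp cong: continuous_on_cong)
next
  case (Suc k)
  have "Ck_on k W (\<lambda>x. dd v F x) \<longleftrightarrow> Ck_on k W (\<lambda>x. dd v H x)" for v
    by (rule Suc.IH) (rule dd_cong[OF assms(1) _ Suc.prems])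
  moreover have "(\<forall>x\<in>W. F differentiable (at x)) \<longleftrightarrow> (\<forall>x\<in>W. H differentiable (at x))"
    using differentiable_cong_open[OF assms(1), of _ F H] Suc.prems by blast
  ultimately show ?case by (simp only: Ck_on.simps)
qed

lemma Ck_on_eqI:
  assumes "open W" "Ck_on k W H" "\<And>x. x \<in> W \<Longrightarrow> F x = H x"
  shows "Ck_on k W F"
  using Ck_on_cong[OF assms(1), of F H k] assms(2,3) by simp

lemma Ck_on_continuous:
  assumes "Ck_on k W F" shows "continuous_on W F"
proof (cases k)
  case 0
  then show ?thesis using assms by simp
next
  case (Suc k)
  then show ?thesis using assms
    by (auto intro!: continuous_at_imp_continuous_on differentiable_imp_continuous_within)
qed

lemma Ck_on_Suc_imp: "Ck_on (Suc k) W F \<Longrightarrow> Ck_on k W F"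
proof (induction k arbitrary: F)
  case 0
  then show ?case using Ck_on_continuous by (metis Ck_on.simps(1))
next
  case (Suc k)
  then show ?case by (metis Ck_on.simps(2))
qed

lemma Ck_on_bounded_linear:
  assumes "open W" "bounded_linear L" "Ck_on k W F"
  shows "Ck_on k W (\<lambda>x. L (F x))"
  using assms(3)
proof (induction k arbitrary: F)
  case 0
  then show ?case using assms(2) by (simp add: bounded_linear.continuous_on)
next
  case (Suc k)
  have d: "F differentiable (at x)" if "x \<in> W" for x using Suc.prems that by simp
  have "Ck_on k W (\<lambda>x. dd v (\<lambda>x. L (F x)) x)" for v
  proof -
    have "Ck_on k W (\<lambda>x. L (dd v F x))" using Suc by simp
    then show ?thesis
      by (rule Ck_on_eqI[OF assms(1)]) (rule dd_bounded_linear[OF assms(2) d])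
  qed
  moreover have "(\<lambda>x. L (F x)) differentiable (at x)" if "x \<in> W" for x
    using bounded_linear.has_derivative[OF assms(2)] d[OF that] unfolding differentiable_def by blast
  ultimately show ?case by simp
qed

lemma Ck_on_add:
  assumes "open W" "Ck_on k W F" "Ck_on k W H"
  shows "Ck_on k W (\<lambda>x. F x + H x)"
  using assms(2,3)
proof (induction k arbitrary: F H)
  case 0
  then show ?case by (simp add: continuous_on_add)
next
  case (Suc k)
  have d: "F differentiable (at x)" "H differentiable (at x)" if "x \<in> W" for x
    using Suc.prems that by auto
  have "Ck_on k W (\<lambda>x. dd v (\<lambda>x. F x + H x) x)" for v
  proof -
    have "Ck_on k W (\<lambda>x. dd v F x + dd v H x)" using Suc by simp
    then show ?thesis
      by (rule Ck_on_eqI[OF assms(1)]) (rule dd_add[OF d])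
  qed
  then show ?case using d by simp
qed

lemma Ck_on_bounded_bilinear:
  assumes "open W" "bounded_bilinear B" "Ck_on k W F" "Ck_on k W H"
  shows "Ck_on k W (\<lambda>x. B (F x) (H x))"
  using assms(3,4)
proof (induction k arbitrary: F H)
  case 0
  then show ?case using bounded_bilinear.continuous_on[OF assms(2)] by simp
next
  case (Suc k)
  have d: "F differentiable (at x)" "H differentiable (at x)" if "x \<in> W" for x
    using Suc.prems that by auto
  have "Ck_on k W (\<lambda>x. dd v (\<lambda>x. B (F x) (H x)) x)" for v
  proof -
    have "Ck_on k W (\<lambda>x. B (F x) (dd v H x))" "Ck_on k W (\<lambda>x. B (dd v F x) (H x))"
      using Suc.IH Suc.prems(1)[THEN Ck_on_Suc_imp] Suc.prems(2)[THEN Ck_on_Suc_imp] Suc.prems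
      by simp_all
    then have "Ck_on k W (\<lambda>x. B (F x) (dd v H x) + B (dd v F x) (H x))"
      using Ck_on_add[OF assms(1)] by blast
    then show ?thesis
      by (rule Ck_on_eqI[OF assms(1)]) (rule dd_bounded_bilinear[OF assms(2) d])
  qed
  moreover have "(\<lambda>x. B (F x) (H x)) differentiable (at x)" if "x \<in> W" for x
    using bounded_bilinear.FDERIV[OF assms(2)] d[OF that] unfolding differentiable_def by blast
  ultimately show ?case by simp
qed

text \<open>The derivative of \<open>1 / F\<close> is a product of \<open>dd v F\<close> with two
  copies of \<open>1 / F\<close>, so the induction hypothesis for \<open>1 / F\<close> itself, one
  order lower, closes the step.\<close>

lemma Ck_on_inverse:
  fixes F :: "'a::real_normed_vector \<Rightarrow> real"
  assumes "open W" "Ck_on k W F" "\<And>x. x \<in> W \<Longrightarrow> F x \<noteq> 0"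
  shows "Ck_on k W (\<lambda>x. inverse (F x))"
  using assms(2)
proof (induction k)
  case 0
  then show ?case using assms(3) by (simp add: continuous_on_inverse)
next
  case (Suc k)
  have d: "(F has_derivative (\<lambda>v. dd v F x)) (at x)" if "x \<in> W" for x
    using Suc.prems that frechet_derivative_works by fastforce
  have d': "((\<lambda>x. inverse (F x)) has_derivative (\<lambda>v. - (inverse (F x) * dd v F x * inverse (F x)))) (at x)"
    if "x \<in> W" for x
    using Deriv.has_derivative_inverse[OF assms(3)[OF that] d[OF that]] .
  have IH: "Ck_on k W (\<lambda>x. inverse (F x))" using Suc Ck_on_Suc_imp by blast
  have "Ck_on k W (\<lambda>x. dd v (\<lambda>x. inverse (F x)) x)" for v
  proof -
    have "Ck_on k W (\<lambda>x. - (inverse (F x) * dd v F x * inverse (F x)))"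
      using IH Suc.prems
      by (intro Ck_on_bounded_linear[OF assms(1) bounded_linear_minus[OF bounded_linear_ident]]
          Ck_on_bounded_bilinear[OF assms(1) bounded_bilinear_mult]) auto
    then show ?thesis
      by (rule Ck_on_eqI[OF assms(1)]) (rule dd_eqI[OF d'])
  qed
  moreover have "(\<lambda>x. inverse (F x)) differentiable (at x)" if "x \<in> W" for x
    using d'[OF that] unfolding differentiable_def by blast
  ultimately show ?case by simp
qed

lemma Ck_on_const: "Ck_on k W (\<lambda>x. c)"
  by (induction k arbitrary: c) auto

lemma smooth_on_dd: "smooth_on W F \<Longrightarrow> smooth_on W (\<lambda>y. dd v F y)"
  unfolding smooth_on_def by (metis Ck_on.simps(2))

lemma smooth_on_differentiable: "smooth_on W F \<Longrightarrow> y \<in> W \<Longrightarrow> F differentiable (at y)"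
  unfolding smooth_on_def by (metis Ck_on.simps(2))

lemma smooth_on_has_derivative:
  "smooth_on W F \<Longrightarrow> y \<in> W \<Longrightarrow> (F has_derivative (\<lambda>w. dd w F y)) (at y)"
  using smooth_on_differentiable[of W F y] frechet_derivative_works by blast

lemma smooth_on_continuous: "smooth_on W F \<Longrightarrow> continuous_on W F"
  unfolding smooth_on_def by (metis Ck_on.simps(1))

lemma smooth_on_const: "smooth_on W (\<lambda>x. c)"
  by (simp add: smooth_on_def Ck_on_const)

lemma smooth_on_cong:
  "open W \<Longrightarrow> (\<And>x. x \<in> W \<Longrightarrow> F x = H x) \<Longrightarrow> smooth_on W F \<longleftrightarrow> smooth_on W H"
  unfolding smooth_on_def using Ck_on_cong by blast

lemma smooth_on_subset: "smooth_on W F \<Longrightarrow> W' \<subseteq> W \<Longrightarrow> smooth_on W' F"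
proof -
  have "Ck_on k W F \<Longrightarrow> W' \<subseteq> W \<Longrightarrow> Ck_on k W' F" for k
    by (induction k arbitrary: F) (auto intro: continuous_on_subset)
  then show "smooth_on W F \<Longrightarrow> W' \<subseteq> W \<Longrightarrow> smooth_on W' F" unfolding smooth_on_def by blast
qed

context
  fixes W :: "'a::real_normed_vector set"
  assumes W: "open W"
begin

lemma smooth_on_bounded_linear:
  "bounded_linear L \<Longrightarrow> smooth_on W F \<Longrightarrow> smooth_on W (\<lambda>x. L (F x))"
  unfolding smooth_on_def using Ck_on_bounded_linear[OF W] by blast

lemma smooth_on_linear:
  fixes L :: "'b::euclidean_space \<Rightarrow> 'c::real_normed_vector"
  shows "linear L \<Longrightarrow> smooth_on W F \<Longrightarrow> smooth_on W (\<lambda>x. L (F x))"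
  using smooth_on_bounded_linear linear_conv_bounded_linear by blast

lemma smooth_on_bounded_bilinear:
  "bounded_bilinear B \<Longrightarrow> smooth_on W F \<Longrightarrow> smooth_on W H \<Longrightarrow> smooth_on W (\<lambda>x. B (F x) (H x))"
  unfolding smooth_on_def using Ck_on_bounded_bilinear[OF W] by blast

lemma smooth_on_add: "smooth_on W F \<Longrightarrow> smooth_on W H \<Longrightarrow> smooth_on W (\<lambda>x. F x + H x)"
  unfolding smooth_on_def using Ck_on_add[OF W] by blast

lemma smooth_on_minus: "smooth_on W F \<Longrightarrow> smooth_on W (\<lambda>x. - F x)"
  by (rule smooth_on_bounded_linear[OF bounded_linear_minus[OF bounded_linear_ident]])

lemma smooth_on_diff: "smooth_on W F \<Longrightarrow> smooth_on W H \<Longrightarrow> smooth_on W (\<lambda>x. F x - H x)"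
  using smooth_on_add[of F "\<lambda>x. - H x"] smooth_on_minus by auto

lemma smooth_on_scaleR:
  "smooth_on W F \<Longrightarrow> smooth_on W H \<Longrightarrow> smooth_on W (\<lambda>x. F x *\<^sub>R H x)"
  by (rule smooth_on_bounded_bilinear[OF bounded_bilinear_scaleR])

lemma smooth_on_mult:
  fixes F H :: "'a \<Rightarrow> real"
  shows "smooth_on W F \<Longrightarrow> smooth_on W H \<Longrightarrow> smooth_on W (\<lambda>x. F x * H x)"
  by (rule smooth_on_bounded_bilinear[OF bounded_bilinear_mult])

lemma smooth_on_divide:
  fixes F H :: "'a \<Rightarrow> real"
  shows "smooth_on W F \<Longrightarrow> smooth_on W H \<Longrightarrow> (\<And>x. x \<in> W \<Longrightarrow> H x \<noteq> 0) \<Longrightarrow> smooth_on W (\<lambda>x. F x / H x)"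
  unfolding divide_inverse
  by (rule smooth_on_mult) (auto simp: smooth_on_def intro!: Ck_on_inverse[OF W])

lemma smooth_on_sum:
  assumes "\<And>i. i \<in> I \<Longrightarrow> smooth_on W (F i)"
  shows "smooth_on W (\<lambda>x. \<Sum>i\<in>I. F i x)"
  using assms by (induction I rule: infinite_finite_induct) (simp_all add: smooth_on_const smooth_on_add)

lemma smooth_on_prod:
  fixes F :: "'i \<Rightarrow> 'a \<Rightarrow> real"
  assumes "\<And>i. i \<in> I \<Longrightarrow> smooth_on W (F i)"
  shows "smooth_on W (\<lambda>x. \<Prod>i\<in>I. F i x)"
  using assms by (induction I rule: infinite_finite_induct) (simp_all add: smooth_on_const smooth_on_mult)

lemma smooth_on_nth:
  fixes F :: "'a \<Rightarrow> real^'n"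
  shows "smooth_on W F \<Longrightarrow> smooth_on W (\<lambda>x. F x $ i)"
  by (rule smooth_on_bounded_linear[OF bounded_linear_vec_nth])

lemma smooth_on_vec:
  fixes F :: "'i::finite \<Rightarrow> 'a \<Rightarrow> real"
  assumes "\<And>i. smooth_on W (F i)"
  shows "smooth_on W (\<lambda>x. \<chi> i. F i x)"
proof -
  have "(\<lambda>x. \<chi> i. F i x) = (\<lambda>x. \<Sum>i\<in>UNIV. F i x *\<^sub>R axis i 1)"
    by (simp add: fun_eq_iff vec_eq_iff axis_def if_distrib cong: if_cong)
  then show ?thesis
    by (simp only:) (intro smooth_on_sum smooth_on_scaleR smooth_on_const assms)
qed

lemma smooth_on_det:
  fixes M :: "'a \<Rightarrow> real^'n^'n"
  assumes "\<And>i j. smooth_on W (\<lambda>x. M x $ i $ j)"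
  shows "smooth_on W (\<lambda>x. det (M x))"
  unfolding det_def by (intro smooth_on_sum smooth_on_mult smooth_on_const smooth_on_prod assms)

text \<open>Cramer's rule writes the solution as quotients of determinants. It gives smoothness of
  maps that are defined only by description or choice: the tangential and transversal components,
  the Christoffel symbols and the comparison field in
  \<open>product_locally_determined\<close>.\<close>

lemma smooth_on_solution:
  fixes M :: "'a \<Rightarrow> real^'n^'n" and b x :: "'a \<Rightarrow> real^'n"
  assumes M: "\<And>i j. smooth_on W (\<lambda>x. M x $ i $ j)" and b: "smooth_on W b"
    and nz: "\<And>y. y \<in> W \<Longrightarrow> det (M y) \<noteq> 0" and x: "\<And>y. y \<in> W \<Longrightarrow> M y *v x y = b y"
  shows "smooth_on W x"
proof -
  let ?x = "\<lambda>y. \<chi> k. det (\<chi> i j. if j = k then b y $ i else M y $ i $ j) / det (M y)"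
  have "x y = ?x y" if "y \<in> W" for y
    using iffD1[OF cramer[OF nz[OF that]] x[OF that]] .
  moreover have "smooth_on W ?x"
  proof (rule smooth_on_vec, rule smooth_on_divide)
    fix k
    have "smooth_on W (\<lambda>y. (\<chi> i j. if j = k then b y $ i else M y $ i $ j) $ i $ j)" for i j
      by (cases "j = k") (simp_all add: M smooth_on_nth[OF b])
    then show "smooth_on W (\<lambda>y. det (\<chi> i j. if j = k then b y $ i else M y $ i $ j))"
      by (rule smooth_on_det)
    show "smooth_on W (\<lambda>x. det (M x))" by (rule smooth_on_det[OF M])
  qed (use nz in auto)
  ultimately show ?thesis using smooth_on_cong[OF W, of x ?x] by blast
qed

end

section \<open>Linear and bilinear maps depending smoothly on a point\<close>

lemma linear_axis_expansion:
  fixes L :: "real^'n \<Rightarrow> 'b::real_vector"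
  assumes "linear L" shows "L a = (\<Sum>i\<in>UNIV. (a $ i) *\<^sub>R L (axis i 1))"
proof -
  have "L a = L (\<Sum>i\<in>UNIV. (a $ i) *\<^sub>R axis i 1)" using basis_expansion[of a] by (simp add: scalar_mult_eq_scaleR)
  then show ?thesis using assms by (simp add: linear_sum linear_cmul)
qed

text \<open>Product rule for a linear map that varies with the point and is known to be smooth only
  on each fixed vector. The first term on the right differentiates \<open>B\<close> with its
  argument frozen at \<open>a y\<close>; expansion over the standard basis reduces everything to
  finitely many products of a scalar function with the value of \<open>B\<close> on a fixed
  vector.\<close>

lemma
  fixes B :: "real^'d \<Rightarrow> real^'n \<Rightarrow> 'b::real_normed_vector"
  assumes W: "open W" and lin: "\<And>y. y \<in> W \<Longrightarrow> linear (B y)"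
    and B: "\<And>a. smooth_on W (\<lambda>y. B y a)" and a: "smooth_on W a"
  shows smooth_on_linear_family: "smooth_on W (\<lambda>y. B y (a y))"
    and dd_linear_family: "y \<in> W \<Longrightarrow>
      dd w (\<lambda>x. B x (a x)) y = dd w (\<lambda>x. B x (a y)) y + B y (dd w a y)"
proof -
  have eq: "B y (a y) = (\<Sum>i\<in>UNIV. (a y $ i) *\<^sub>R B y (axis i 1))" if "y \<in> W" for y a
    using linear_axis_expansion[OF lin[OF that]] .
  have "smooth_on W (\<lambda>y. \<Sum>i\<in>UNIV. (a y $ i) *\<^sub>R B y (axis i 1))"
    by (intro smooth_on_sum[OF W] smooth_on_scaleR[OF W] smooth_on_nth[OF W] a B)
  then show "smooth_on W (\<lambda>y. B y (a y))"
    using smooth_on_cong[OF W, of "\<lambda>y. B y (a y)"] eq by simp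
  assume y: "y \<in> W"
  note d = smooth_on_differentiable[OF _ y]
  have dterm: "dd w (\<lambda>x. (a x $ i) *\<^sub>R B x (axis i 1)) y =
      (a y $ i) *\<^sub>R dd w (\<lambda>x. B x (axis i 1)) y + (dd w a y $ i) *\<^sub>R B y (axis i 1)"
    if "smooth_on W a" for i a
    using dd_bounded_bilinear[OF bounded_bilinear_scaleR d[OF smooth_on_nth[OF W that]] d[OF B]]
      dd_bounded_linear[OF bounded_linear_vec_nth d[OF that]] by simp
  have dfam: "dd w (\<lambda>x. B x (a x)) y =
      (\<Sum>i\<in>UNIV. (a y $ i) *\<^sub>R dd w (\<lambda>x. B x (axis i 1)) y) + (\<Sum>i\<in>UNIV. (dd w a y $ i) *\<^sub>R B y (axis i 1))"
    if a: "smooth_on W a" for a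
  proof -
    have "dd w (\<lambda>x. B x (a x)) y = dd w (\<lambda>x. \<Sum>i\<in>UNIV. (a x $ i) *\<^sub>R B x (axis i 1)) y"
      by (rule dd_cong[OF W y eq])
    also have "\<dots> = (\<Sum>i\<in>UNIV. dd w (\<lambda>x. (a x $ i) *\<^sub>R B x (axis i 1)) y)"
      by (rule dd_sum) (intro d smooth_on_scaleR[OF W] smooth_on_nth[OF W] a B)
    finally show ?thesis using dterm[OF a] by (simp add: sum.distrib)
  qed
  show "dd w (\<lambda>x. B x (a x)) y = dd w (\<lambda>x. B x (a y)) y + B y (dd w a y)"
    using dfam[OF a] dfam[of "\<lambda>_. a y", OF smooth_on_const] linear_axis_expansion[OF lin[OF y], of "dd w a y"]
    by (simp only:) simp
qed

lemma
  fixes B :: "real^'d \<Rightarrow> real^'n \<Rightarrow> real^'m \<Rightarrow> 'b::real_normed_vector"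
  assumes W: "open W" and bil: "\<And>y. y \<in> W \<Longrightarrow> bilinear (B y)"
    and B: "\<And>a b. smooth_on W (\<lambda>y. B y a b)" and a: "smooth_on W a" and b: "smooth_on W b"
  shows smooth_on_bilinear_family: "smooth_on W (\<lambda>y. B y (a y) (b y))"
    and dd_bilinear_family: "y \<in> W \<Longrightarrow>
      dd w (\<lambda>x. B x (a x) (b x)) y
        = dd w (\<lambda>x. B x (a y) (b y)) y + B y (dd w a y) (b y) + B y (a y) (dd w b y)"
proof -
  have l1: "linear (\<lambda>v. B y v u)" and l2: "linear (B y v')" if "y \<in> W" for y u v'
    using bil[OF that] by (auto simp: bilinear_def)
  have B1: "smooth_on W (\<lambda>y. B y (a y) v)" if "smooth_on W a" for v a
    by (rule smooth_on_linear_family[OF W _ _ that, of "\<lambda>y u. B y u v"]) (fact l1 B)+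
  show "smooth_on W (\<lambda>y. B y (a y) (b y))"
    by (rule smooth_on_linear_family[OF W _ _ b, of "\<lambda>y. B y (a y)"]) (fact l2 B1[OF a])+
  assume y: "y \<in> W"
  have "dd w (\<lambda>x. B x (a x) (b x)) y = dd w (\<lambda>x. B x (a x) (b y)) y + B y (a y) (dd w b y)"
    by (rule dd_linear_family[OF W _ _ b y, of "\<lambda>y. B y (a y)"]) (fact l2 B1[OF a])+
  moreover have "dd w (\<lambda>x. B x (a x) (b y)) y = dd w (\<lambda>x. B x (a y) (b y)) y + B y (dd w a y) (b y)"
    by (rule dd_linear_family[OF W _ _ a y, of "\<lambda>x u. B x u (b y)"]) (fact l1 B)+
  ultimately show "dd w (\<lambda>x. B x (a x) (b x)) y
        = dd w (\<lambda>x. B x (a y) (b y)) y + B y (dd w a y) (b y) + B y (a y) (dd w b y)" by simp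
qed

section \<open>Symmetry of second derivatives\<close>

lemma has_real_derivative_along_line:
  fixes F :: "'a::real_normed_vector \<Rightarrow> real"
  assumes "F differentiable (at (a + t *\<^sub>R u))"
  shows "((\<lambda>t. F (a + t *\<^sub>R u)) has_real_derivative dd u F (a + t *\<^sub>R u)) (at t)"
proof -
  let ?F' = "frechet_derivative F (at (a + t *\<^sub>R u))"
  have F: "(F has_derivative ?F') (at (a + t *\<^sub>R u))"
    using assms frechet_derivative_works by blast
  have "((\<lambda>t. a + t *\<^sub>R u) has_derivative (\<lambda>s. s *\<^sub>R u)) (at t)"
    by (auto intro!: derivative_eq_intros)
  then have "((\<lambda>t. F (a + t *\<^sub>R u)) has_derivative (\<lambda>s. ?F' (s *\<^sub>R u))) (at t)"
    by (rule has_derivative_compose) (rule F)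
  moreover have "?F' (s *\<^sub>R u) = ?F' u * s" for s
    using linear_cmul[OF has_derivative_linear[OF F]] by simp
  ultimately show ?thesis by (simp add: has_field_derivative_def)
qed

text \<open>The mean value theorem is applied twice, first to the difference \<open>P\<close> in
  direction \<open>u\<close>, then in direction \<open>v\<close>. The second difference is symmetric
  in \<open>u\<close> and \<open>v\<close>, so exchanging them compares both mixed derivatives at
  points near \<open>y\<close>.\<close>

lemma second_difference:
  fixes F :: "'a::real_normed_vector \<Rightarrow> real"
  assumes F: "smooth_on W F" and s: "s > 0"
    and W: "\<And>p q. 0 \<le> p \<Longrightarrow> p \<le> s \<Longrightarrow> 0 \<le> q \<Longrightarrow> q \<le> s \<Longrightarrow> y + p *\<^sub>R u + q *\<^sub>R v \<in> W"
  obtains p q where "0 < p" "p < s" "0 < q" "q < s"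
    "F (y + s *\<^sub>R u + s *\<^sub>R v) - F (y + s *\<^sub>R u) - F (y + s *\<^sub>R v) + F y =
       s * s * dd v (\<lambda>x. dd u F x) (y + p *\<^sub>R u + q *\<^sub>R v)"
proof -
  define P where "P t = F (y + s *\<^sub>R v + t *\<^sub>R u) - F (y + t *\<^sub>R u)" for t
  have dF: "F differentiable (at x)" "(\<lambda>x. dd u F x) differentiable (at x)" if "x \<in> W" for x
    using smooth_on_differentiable[OF _ that] F smooth_on_dd by auto
  have P': "(P has_real_derivative dd u F (y + s *\<^sub>R v + t *\<^sub>R u) - dd u F (y + t *\<^sub>R u)) (at t)"
    if "0 \<le> t" "t \<le> s" for t
    unfolding P_def
    using W[OF that, of s] W[OF that, of 0] s
    by (intro derivative_intros has_real_derivative_along_line dF) (simp_all add: algebra_simps)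
  from MVT2[OF s P'] obtain p where p: "0 < p" "p < s"
    "P s - P 0 = (s - 0) * (dd u F (y + s *\<^sub>R v + p *\<^sub>R u) - dd u F (y + p *\<^sub>R u))" by auto
  have Q': "((\<lambda>t. dd u F (y + p *\<^sub>R u + t *\<^sub>R v)) has_real_derivative
      dd v (\<lambda>x. dd u F x) (y + p *\<^sub>R u + t *\<^sub>R v)) (at t)" if "0 \<le> t" "t \<le> s" for t
    using p(1,2) that by (intro has_real_derivative_along_line dF W) auto
  from MVT2[OF s Q'] obtain q where q: "0 < q" "q < s"
    "dd u F (y + p *\<^sub>R u + s *\<^sub>R v) - dd u F (y + p *\<^sub>R u + 0 *\<^sub>R v) =
      (s - 0) * dd v (\<lambda>x. dd u F x) (y + p *\<^sub>R u + q *\<^sub>R v)" by auto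
  show ?thesis
    by (rule that[OF p(1,2) q(1,2)]) (use p(3) q(3) in \<open>simp add: P_def algebra_simps\<close>)
qed

lemma dd_commute_real:
  fixes F :: "'a::real_normed_vector \<Rightarrow> real"
  assumes "open W" "y \<in> W" and F: "smooth_on W F"
  shows "dd u (\<lambda>x. dd v F x) y = dd v (\<lambda>x. dd u F x) y"
proof (rule ccontr)
  let ?P = "\<lambda>x. dd u (\<lambda>x. dd v F x) x" and ?Q = "\<lambda>x. dd v (\<lambda>x. dd u F x) x"
  assume ne: "?P y \<noteq> ?Q y"
  define e where "e = \<bar>?P y - ?Q y\<bar> / 2"
  have e: "e > 0" using ne by (simp add: e_def)
  have "continuous_on W ?P" "continuous_on W ?Q"
    using F by (intro smooth_on_continuous smooth_on_dd; assumption)+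
  then have cP: "isCont ?P y" and cQ: "isCont ?Q y"
    using assms(2) by (simp_all add: continuous_on_eq_continuous_at[OF assms(1)])
  obtain d1 where d1: "d1 > 0" "\<And>x. dist x y < d1 \<Longrightarrow> \<bar>?P x - ?P y\<bar> < e"
    using cP[unfolded continuous_at_eps_delta dist_real_def, rule_format, OF e] by blast
  obtain d2 where d2: "d2 > 0" "\<And>x. dist x y < d2 \<Longrightarrow> \<bar>?Q x - ?Q y\<bar> < e"
    using cQ[unfolded continuous_at_eps_delta dist_real_def, rule_format, OF e] by blast
  obtain d3 where d3: "d3 > 0" "ball y d3 \<subseteq> W" using assms(1,2) openE by blast
  define d where "d = min d1 (min d2 d3)"
  have d: "d > 0" using d1 d2 d3 by (simp add: d_def)
  \<comment> \<open>The parallelogram with sides \<open>s u\<close> and \<open>s v\<close> then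
    stays within \<open>d / 2\<close> of \<open>y\<close>; adding one keeps the denominator positive
    when \<open>u = v = 0\<close>.\<close>
  define s where "s = d / (2 * (norm u + norm v + 1))"
  have np: "norm u + norm v + 1 > 0" by (simp add: add_nonneg_pos)
  have s: "s > 0" using d np by (simp add: s_def)
  have near: "dist (y + p *\<^sub>R u + q *\<^sub>R v) y < d" if "0 \<le> p" "p \<le> s" "0 \<le> q" "q \<le> s" for p q
  proof -
    have "dist (y + p *\<^sub>R u + q *\<^sub>R v) y \<le> p * norm u + q * norm v"
      using norm_triangle_ineq[of "p *\<^sub>R u" "q *\<^sub>R v"] that by (simp add: dist_norm add.assoc)
    also have "\<dots> \<le> s * norm u + s * norm v" using that by (intro add_mono mult_right_mono) auto
    also have "\<dots> \<le> s * (norm u + norm v + 1)" using s by (simp add: algebra_simps)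
    also have "\<dots> = d / 2"
    proof -
      have "d / (2 * c) * c = d / 2" if "c > 0" for c using that by simp
      then show ?thesis unfolding s_def using np .
    qed
    finally show ?thesis using d by simp
  qed
  have W1: "y + p *\<^sub>R u + q *\<^sub>R v \<in> W" if "0 \<le> p" "p \<le> s" "0 \<le> q" "q \<le> s" for p q
    using near[OF that] d3 by (auto simp: d_def dist_commute)
  have W2: "y + p *\<^sub>R v + q *\<^sub>R u \<in> W" if "0 \<le> p" "p \<le> s" "0 \<le> q" "q \<le> s" for p q
    using W1[of q p] that by (simp add: add_ac)
  obtain p q where pq: "0 < p" "p < s" "0 < q" "q < s"
    "F (y + s *\<^sub>R u + s *\<^sub>R v) - F (y + s *\<^sub>R u) - F (y + s *\<^sub>R v) + F y
      = s * s * ?Q (y + p *\<^sub>R u + q *\<^sub>R v)"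
    using second_difference[OF F s W1] by blast
  obtain p' q' where pq': "0 < p'" "p' < s" "0 < q'" "q' < s"
    "F (y + s *\<^sub>R v + s *\<^sub>R u) - F (y + s *\<^sub>R v) - F (y + s *\<^sub>R u) + F y
      = s * s * ?P (y + p' *\<^sub>R v + q' *\<^sub>R u)"
    using second_difference[OF F s W2] by blast
  have "s * s * ?Q (y + p *\<^sub>R u + q *\<^sub>R v) = s * s * ?P (y + p' *\<^sub>R v + q' *\<^sub>R u)"
  proof -
    have "y + s *\<^sub>R v + s *\<^sub>R u = y + s *\<^sub>R u + s *\<^sub>R v" by simp
    then show ?thesis using pq(5) pq'(5) by (simp only:)
  qed
  then have eq: "?Q (y + p *\<^sub>R u + q *\<^sub>R v) = ?P (y + q' *\<^sub>R u + p' *\<^sub>R v)"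
    using s by (simp add: add_ac)
  have "\<bar>?Q (y + p *\<^sub>R u + q *\<^sub>R v) - ?Q y\<bar> < e"
    by (rule d2(2)) (use near[of p q] pq in \<open>simp add: d_def\<close>)
  moreover have "\<bar>?P (y + q' *\<^sub>R u + p' *\<^sub>R v) - ?P y\<bar> < e"
    by (rule d1(2)) (use near[of q' p'] pq' in \<open>simp add: d_def\<close>)
  ultimately have "\<bar>?P y - ?Q y\<bar> < 2 * e" using eq by linarith
  then show False by (simp add: e_def)
qed

lemma dd_commute:
  fixes F :: "'a::real_normed_vector \<Rightarrow> real^'n"
  assumes "open W" "y \<in> W" and F: "smooth_on W F"
  shows "dd u (\<lambda>x. dd v F x) y = dd v (\<lambda>x. dd u F x) y"
proof -
  have nth: "dd u (\<lambda>x. dd v F x) y $ i = dd u (\<lambda>x. dd v (\<lambda>x. F x $ i) x) y" for u v i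
  proof -
    have "dd u (\<lambda>x. dd v F x) y $ i = dd u (\<lambda>x. dd v F x $ i) y"
      using dd_bounded_linear[OF bounded_linear_vec_nth smooth_on_differentiable[OF smooth_on_dd[OF F] assms(2)]]
      by metis
    also have "\<dots> = dd u (\<lambda>x. dd v (\<lambda>x. F x $ i) x) y"
      by (rule dd_cong[OF assms(1,2)])
        (use dd_bounded_linear[OF bounded_linear_vec_nth smooth_on_differentiable[OF F]] in metis)
    finally show ?thesis .
  qed
  show ?thesis
    unfolding vec_eq_iff nth
    using dd_commute_real[OF assms(1,2) smooth_on_nth[OF assms(1) F]] by blast
qed

section \<open>Derivatives of determinants\<close>

lemma dd_nth:
  fixes F :: "'a::real_normed_vector \<Rightarrow> real^'n"
  shows "F differentiable (at y) \<Longrightarrow> dd w (\<lambda>x. F x $ i) y = dd w F y $ i"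
  by (rule dd_bounded_linear[OF bounded_linear_vec_nth])

text \<open>Jacobi's formula for \<open>M' = A M\<close>. Differentiating the Leibniz expansion
  replaces one row of \<open>M\<close> at a time; row \<open>i\<close> becomes the combination of
  the rows of \<open>M\<close> with the coefficients of row \<open>i\<close> of \<open>A\<close>,
  and Cramer's lemma leaves \<open>A $ i $ i\<close> times the determinant.\<close>

lemma
  fixes M :: "'a::real_normed_vector \<Rightarrow> real^'n^'n" and A :: "real^'n^'n"
  assumes d: "\<And>i j. (\<lambda>x. M x $ i $ j) differentiable (at y)"
    and A: "\<And>i j. dd w (\<lambda>x. M x $ i $ j) y = (A ** M y) $ i $ j"
  shows dd_det_left: "dd w (\<lambda>x. det (M x)) y = trace A * det (M y)"
proof -
  let ?N = "\<lambda>i j. dd w (\<lambda>x. M x $ i $ j) y"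
  have "((\<lambda>x. det (M x)) has_derivative (\<lambda>w. \<Sum>p\<in>{p. p permutes UNIV}. of_int (sign p) *
     (\<Sum>i\<in>UNIV. dd w (\<lambda>x. M x $ i $ p i) y * (\<Prod>j\<in>UNIV - {i}. M y $ j $ p j)))) (at y)"
    unfolding det_def
    by (intro has_derivative_sum has_derivative_mult_right has_derivative_prod d[unfolded frechet_derivative_works])
  then have "dd w (\<lambda>x. det (M x)) y = (\<Sum>p\<in>{p. p permutes UNIV}. of_int (sign p) *
     (\<Sum>i\<in>UNIV. ?N i (p i) * (\<Prod>j\<in>UNIV - {i}. M y $ j $ p j)))"
    by (rule dd_eqI)
  also have "\<dots> = (\<Sum>i\<in>UNIV. \<Sum>p\<in>{p. p permutes UNIV}. of_int (sign p) *
     (?N i (p i) * (\<Prod>j\<in>UNIV - {i}. M y $ j $ p j)))"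
    by (simp add: sum_distrib_left sum.swap[of _ UNIV])
  also have "\<dots> = (\<Sum>i\<in>UNIV. det (\<chi> j. if j = i then (\<Sum>l\<in>UNIV. (A $ i) $ l *s row l (M y)) else row j (M y)))"
  proof (rule sum.cong[OF refl], unfold det_def, rule sum.cong[OF refl], rule arg_cong2[where f="(*)", OF refl])
    fix i p
    let ?R = "\<chi> j. if j = i then (\<Sum>l\<in>UNIV. (A $ i) $ l *s row l (M y)) else row j (M y)"
    have "(\<Prod>j\<in>UNIV. ?R $ j $ p j) = ?R $ i $ p i * (\<Prod>j\<in>UNIV - {i}. ?R $ j $ p j)"
      by (rule prod.remove) auto
    also have "?R $ i $ p i = ?N i (p i)"
      by (simp add: A matrix_matrix_mult_def row_def)
    also have "(\<Prod>j\<in>UNIV - {i}. ?R $ j $ p j) = (\<Prod>j\<in>UNIV - {i}. M y $ j $ p j)"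
      by (rule prod.cong) (auto simp: row_def)
    finally show "?N i (p i) * (\<Prod>j\<in>UNIV - {i}. M y $ j $ p j) = (\<Prod>j\<in>UNIV. ?R $ j $ p j)" by simp
  qed
  also have "\<dots> = (\<Sum>i\<in>UNIV. (A $ i) $ i * det (M y))"
    by (simp only: cramer_lemma_transpose)
  finally show ?thesis by (simp add: trace_def sum_distrib_right)
qed

lemma trace_transpose: "trace (transpose A) = trace A"
  by (simp add: trace_def transpose_def)

lemma dd_det_right:
  fixes M :: "'a::real_normed_vector \<Rightarrow> real^'n^'n" and A :: "real^'n^'n"
  assumes d: "\<And>i j. (\<lambda>x. M x $ i $ j) differentiable (at y)"
    and A: "\<And>i j. dd w (\<lambda>x. M x $ i $ j) y = (M y ** A) $ i $ j"
  shows "dd w (\<lambda>x. det (M x)) y = trace A * det (M y)"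
proof -
  have "dd w (\<lambda>x. det (transpose (M x))) y = trace (transpose A) * det (transpose (M y))"
    by (rule dd_det_left) (simp_all add: d A transpose_def flip: matrix_transpose_mul[unfolded transpose_def])
  then show ?thesis by (simp add: det_transpose trace_transpose)
qed

section \<open>Commutative algebras with nondegenerate trace form\<close>

abbreviation tr :: "(real^'n \<Rightarrow> real^'n) \<Rightarrow> real" where
  "tr F \<equiv> trace (matrix F)"

lemma tr_alt: "tr F = (\<Sum>i\<in>UNIV. F (axis i 1) $ i)"
  by (simp add: trace_def matrix_def)

lemma tr_commute:
  fixes F :: "real^'n \<Rightarrow> real^'m" and H :: "real^'m \<Rightarrow> real^'n"
  assumes "linear F" "linear H"
  shows "tr (\<lambda>x. F (H x)) = tr (\<lambda>x. H (F x))"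
proof -
  have "matrix (\<lambda>x. F (H x)) = matrix F ** matrix H" "matrix (\<lambda>x. H (F x)) = matrix H ** matrix F"
    using matrix_compose[OF assms(2,1)] matrix_compose[OF assms] by (simp_all add: o_def)
  then show ?thesis using trace_mul_sym[of "matrix F" "matrix H"] by simp
qed

text \<open>Nondegeneracy of the trace form is the etale condition over the reals; it yields both
  the dual basis used for rigidity and the absence of nilpotents used for the classification.
  Product and identity are parameters, since they vary with the point of the hypersphere.\<close>

locale comm_algebra =
  fixes mu :: "real^'e \<Rightarrow> real^'e \<Rightarrow> real^'e" (infixl "\<star>" 70) and e :: "real^'e"
  assumes bil: "bilinear (\<star>)"
    and comm: "a \<star> b = b \<star> a"
    and assoc: "(a \<star> b) \<star> c = a \<star> (b \<star> c)"
    and unit: "e \<star> a = a"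
    and trace_nondeg: "(\<And>b. tr ((\<star>) (a \<star> b)) = 0) \<Longrightarrow> a = 0"
begin

lemma linR: "linear ((\<star>) a)" and linL: "linear (\<lambda>a. a \<star> b)"
  using bil by (auto simp: bilinear_def)

lemmas mu_simps = linear_add[OF linR] linear_add[OF linL] linear_diff[OF linR] linear_diff[OF linL]
  linear_cmul[OF linR] linear_cmul[OF linL] linear_0[OF linR] linear_0[OF linL]
  linear_neg[OF linR] linear_neg[OF linL]

lemma mu_sum: "a \<star> (\<Sum>i\<in>I. F i) = (\<Sum>i\<in>I. a \<star> F i)" "(\<Sum>i\<in>I. F i) \<star> b = (\<Sum>i\<in>I. F i \<star> b)"
  by (rule linear_sum[OF linR], rule linear_sum[OF linL])

lemma unit': "a \<star> e = a"
  using unit comm by metis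

lemma lcomm: "a \<star> (b \<star> c) = b \<star> (a \<star> c)"
  using comm assoc by metis

lemmas mu_ac = assoc comm lcomm

definition t :: "real^'e \<Rightarrow> real" where "t a = tr ((\<star>) a)"

lemma linear_t: "linear t"
proof -
  have "t a = (\<Sum>i\<in>UNIV. (a \<star> axis i 1) $ i)" for a by (simp add: t_def tr_alt)
  then show ?thesis
    by (intro linearI) (simp_all add: mu_simps sum.distrib sum_distrib_left)
qed

lemma linear_trace_form: "linear (\<lambda>b. t (a \<star> b))"
  using linear_compose[OF linR linear_t] by (simp add: o_def)

lemma t_nondeg: "(\<And>b. t (a \<star> b) = 0) \<Longrightarrow> a = 0"
  unfolding t_def by (rule trace_nondeg)

lemma functional_represented:
  fixes \<phi> :: "real^'e \<Rightarrow> real"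
  assumes "linear \<phi>"
  shows "\<exists>u. \<forall>b. t (u \<star> b) = \<phi> b"
proof -
  define T where "T a = (\<chi> i. t (a \<star> axis i 1))" for a
  have tb: "t (a \<star> b) = (\<Sum>i\<in>UNIV. b $ i * T a $ i)" for a b
    using linear_axis_expansion[OF linear_trace_form, of a b] by (simp add: T_def)
  have lT: "linear T"
    unfolding T_def
    by (intro linearI) (simp_all add: vec_eq_iff mu_simps linear_add[OF linear_t] linear_cmul[OF linear_t])
  have "inj T"
  proof (subst linear_injective_0[OF lT], safe)
    fix a assume "T a = 0"
    then show "a = 0" by (intro t_nondeg) (simp add: tb)
  qed
  then have "surj T" by (rule linear_injective_imp_surjective[OF lT]) simp
  then obtain u where u: "T u = (\<chi> i. \<phi> (axis i 1))" by (metis surjD)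
  have "t (u \<star> b) = \<phi> b" for b
    using linear_axis_expansion[OF assms, of b] by (simp add: tb u)
  then show ?thesis by blast
qed

definition dual :: "'e \<Rightarrow> real^'e" where
  "dual i = (SOME u. \<forall>b. t (u \<star> b) = b $ i)"

lemma t_dual: "t (dual i \<star> b) = b $ i"
proof -
  have "\<exists>u. \<forall>b. t (u \<star> b) = b $ i"
    by (rule functional_represented) (auto intro: linearI)
  then show ?thesis unfolding dual_def by (rule someI2_ex) blast
qed

lemma dual_expansion: "a = (\<Sum>i\<in>UNIV. t (a \<star> axis i 1) *\<^sub>R dual i)"
proof -
  have "t ((a - (\<Sum>i\<in>UNIV. t (a \<star> axis i 1) *\<^sub>R dual i)) \<star> b) = 0" for b
  proof -
    have "t ((a - (\<Sum>i\<in>UNIV. t (a \<star> axis i 1) *\<^sub>R dual i)) \<star> b) =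
        t (a \<star> b) - (\<Sum>i\<in>UNIV. t (a \<star> axis i 1) * b $ i)"
      by (simp add: mu_simps mu_sum linear_diff[OF linear_t] linear_sum[OF linear_t]
          linear_cmul[OF linear_t] t_dual)
    then show ?thesis
      using linear_axis_expansion[OF linear_trace_form, of a b] by (simp add: mult.commute)
  qed
  from t_nondeg[OF this] show ?thesis by (simp only: right_minus_eq)
qed

text \<open>Paired with \<open>c\<close> under the trace form, the sum gives the trace of
  multiplication by \<open>c\<close>, which is also the pairing of \<open>e\<close> with
  \<open>c\<close>.\<close>

lemma sum_axis_dual: "(\<Sum>i\<in>UNIV. axis i 1 \<star> dual i) = e"
proof -
  have "t (((\<Sum>i\<in>UNIV. axis i 1 \<star> dual i) - e) \<star> c) = 0" for c
  proof -
    have "t ((axis i 1 \<star> dual i) \<star> c) = (c \<star> axis i 1) $ i" for i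
      using t_dual[of i "c \<star> axis i 1"] by (simp add: mu_ac)
    then have "t ((\<Sum>i\<in>UNIV. axis i 1 \<star> dual i) \<star> c) = t c"
      by (simp add: mu_sum linear_sum[OF linear_t]) (simp add: t_def tr_alt)
    then show ?thesis by (simp add: mu_simps unit linear_diff[OF linear_t])
  qed
  from t_nondeg[OF this] show ?thesis by (simp only: right_minus_eq)
qed

text \<open>The tensor of the standard basis with its trace-dual basis is the separability
  idempotent: the actions of the algebra on its two legs agree on it. The bilinear \<open>B\<close>
  stands for an arbitrary linear map out of the tensor product.\<close>

lemma separability:
  fixes B :: "real^'e \<Rightarrow> real^'e \<Rightarrow> 'b::real_vector"
  assumes l1: "\<And>b. linear (\<lambda>a. B a b)" and l2: "\<And>a. linear (B a)"
  shows "(\<Sum>i\<in>UNIV. B (a \<star> axis i 1) (dual i)) = (\<Sum>i\<in>UNIV. B (axis i 1) (a \<star> dual i))"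
proof -
  have "(\<Sum>i\<in>UNIV. B (a \<star> axis i 1) (dual i)) =
      (\<Sum>i\<in>UNIV. \<Sum>j\<in>UNIV. ((a \<star> axis i 1) $ j) *\<^sub>R B (axis j 1) (dual i))"
    by (rule sum.cong[OF refl]) (rule linear_axis_expansion[OF l1])
  also have "\<dots> = (\<Sum>j\<in>UNIV. \<Sum>i\<in>UNIV. ((a \<star> axis i 1) $ j) *\<^sub>R B (axis j 1) (dual i))"
    by (rule sum.swap)
  also have "\<dots> = (\<Sum>j\<in>UNIV. B (axis j 1) (a \<star> dual j))"
  proof (rule sum.cong[OF refl])
    fix j
    have "(a \<star> axis i 1) $ j = t ((a \<star> dual j) \<star> axis i 1)" for i
      using t_dual[of j "a \<star> axis i 1"] by (simp add: mu_ac)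
    then have "a \<star> dual j = (\<Sum>i\<in>UNIV. ((a \<star> axis i 1) $ j) *\<^sub>R dual i)"
      using dual_expansion[of "a \<star> dual j"] by (simp only:)
    then show "(\<Sum>i\<in>UNIV. ((a \<star> axis i 1) $ j) *\<^sub>R B (axis j 1) (dual i)) = B (axis j 1) (a \<star> dual j)"
      by (simp only: linear_sum[OF l2] linear_cmul[OF l2])
  qed
  finally show ?thesis .
qed

text \<open>Etale algebras have no nontrivial first-order deformations; the symmetry in the direction
  of deformation and the two trace conditions exclude the trivial ones.\<close>

lemma symmetric_cocycle_zero:
  fixes Q :: "real^'e \<Rightarrow> real^'e \<Rightarrow> real^'e \<Rightarrow> real^'e"
  assumes lin: "\<And>a b. linear (Q a b)"
    and s1: "\<And>a b c. Q a b c = Q b a c" and s2: "\<And>a b c. Q a b c = Q a c b"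
    and cocycle: "\<And>w a b c. Q w (a \<star> b) c + Q w a b \<star> c = Q w a (b \<star> c) + a \<star> Q w b c"
    and tQ: "\<And>a b c. t (Q a b c) = 0" and trQ: "\<And>a b. tr (Q a b) = 0"
  shows "Q a b c = 0"
proof -
  \<comment> \<open>Contraction of the last argument of \<open>Q\<close> with the separability
    idempotent, the standard homotopy that turns Hochschild cocycles into coboundaries.\<close>
  define F where "F w a = (\<Sum>i\<in>UNIV. Q w a (axis i 1) \<star> dual i)" for w a
  have swap: "(\<Sum>i\<in>UNIV. L (b \<star> axis i 1) \<star> dual i) = b \<star> (\<Sum>i\<in>UNIV. L (axis i 1) \<star> dual i)"
    if "linear L" for L :: "real^'e \<Rightarrow> real^'e" and b
  proof -
    have "(\<Sum>i\<in>UNIV. L (b \<star> axis i 1) \<star> dual i) = (\<Sum>i\<in>UNIV. L (axis i 1) \<star> (b \<star> dual i))"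
      by (rule separability[of "\<lambda>x y. L x \<star> y"])
        (use linear_compose[OF that linL] linR in \<open>auto simp: o_def\<close>)
    then show ?thesis by (simp add: mu_sum lcomm)
  qed
  have Fsym: "F w a = F a w" for w a unfolding F_def using s1 by presburger
  \<comment> \<open>Put the basis vectors for \<open>c\<close> in the cocycle identity, multiply by
    the dual vectors and sum: \<open>Q w\<close> is the coboundary of \<open>F w\<close>.\<close>
  have QF: "Q w a b = F w b \<star> a + F w a \<star> b - F w (a \<star> b)" for w a b
  proof -
    have "Q w (a \<star> b) (axis i 1) \<star> dual i + Q w a b \<star> (axis i 1 \<star> dual i)
        = Q w a (b \<star> axis i 1) \<star> dual i + a \<star> (Q w b (axis i 1) \<star> dual i)" for i
      using arg_cong[OF cocycle[of w a b "axis i 1"], of "\<lambda>x. x \<star> dual i"]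
      by (simp add: mu_simps assoc)
    then have "(\<Sum>i\<in>UNIV. Q w (a \<star> b) (axis i 1) \<star> dual i + Q w a b \<star> (axis i 1 \<star> dual i))
        = (\<Sum>i\<in>UNIV. Q w a (b \<star> axis i 1) \<star> dual i + a \<star> (Q w b (axis i 1) \<star> dual i))" by simp
    then have "F w (a \<star> b) + Q w a b \<star> e = b \<star> F w a + a \<star> F w b"
      unfolding sum.distrib mu_sum(1)[symmetric] sum_axis_dual swap[OF lin] F_def[symmetric] .
    then show ?thesis by (simp add: unit unit' comm algebra_simps)
  qed
  have tF: "t (F w a) = 0" for w a
    using trQ[of w a] t_dual by (simp add: F_def linear_sum[OF linear_t] comm[of "Q w a _"] tr_alt)
  \<comment> \<open>\<open>S\<close> is symmetric in its first two arguments because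
    \<open>F\<close> is, and skew in the last two because both \<open>Q\<close> and \<open>F\<close>
    have trace zero in \<open>QF\<close>. The two symmetries together force it to vanish.\<close>
  define S where "S w b a = t (F w b \<star> a)" for w b a
  have skew: "S w b a = - S w a b" for w a b
    using arg_cong[OF QF[of w a b], of t]
    by (simp add: tQ tF S_def linear_add[OF linear_t] linear_diff[OF linear_t])
  have sym: "S w b a = S b w a" for w b a using Fsym by (simp add: S_def)
  have "S w b a = 0" for w b a
  proof -
    have "S w b a = - S w a b" by (rule skew)
    also have "\<dots> = - S a w b" by (simp only: sym[of w a])
    also have "\<dots> = S a b w" by (simp only: skew[of a b w])
    also have "\<dots> = S b a w" by (rule sym)
    also have "\<dots> = - S b w a" by (rule skew)
    also have "\<dots> = - S w b a" by (simp only: sym[of b w])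
    finally show ?thesis by simp
  qed
  then have "F w b = 0" for w b by (intro t_nondeg) (simp add: S_def)
  then show ?thesis using QF by (simp add: mu_simps)
qed

end

section \<open>Polynomials in one element and minimal ideals\<close>

lemma tr_square_zero:
  fixes B :: "real^'n \<Rightarrow> real^'n"
  assumes B: "linear B" and sq: "\<And>x. B (B x) = 0"
  shows "tr B = 0"
proof -
  have "subspace {x. B x = 0}" using B by (rule linear_subspace_kernel)
  \<comment> \<open>\<open>P\<close> projects onto the kernel of \<open>B\<close>. The range of
    \<open>B\<close> lies in that kernel, so \<open>P B = B\<close> while \<open>B P = 0\<close>,
    and these two composites have the same trace.\<close>
  from linear_exists_left_inverse_on[OF linear_id this inj_on_id]
  obtain P where P: "range P \<subseteq> {x. B x = 0}" "linear P" "\<And>x. B x = 0 \<Longrightarrow> P x = x"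
    by (auto simp: id_def)
  have "(\<lambda>x. P (B x)) = B" "(\<lambda>x. B (P x)) = (\<lambda>x. 0)" using P(1,3) sq by auto
  then show ?thesis using tr_commute[OF P(2) B] by (simp add: tr_alt)
qed

lemma map_poly_of_real_add:
  "map_poly complex_of_real (p + q) = map_poly complex_of_real p + map_poly complex_of_real q"
  by (rule poly_eqI) (simp add: coeff_map_poly)

lemma map_poly_of_real_smult:
  "map_poly complex_of_real (smult c p) = smult (complex_of_real c) (map_poly complex_of_real p)"
  by (rule poly_eqI) (simp add: coeff_map_poly)

lemma map_poly_of_real_mult:
  "map_poly complex_of_real (p * q) = map_poly complex_of_real p * map_poly complex_of_real q"
  by (induction p)
    (simp_all add: map_poly_of_real_add map_poly_of_real_smult map_poly_pCons)

lemma poly_map_poly_of_real: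
  "poly (map_poly complex_of_real p) (complex_of_real x) = complex_of_real (poly p x)"
  by (induction p) (simp_all add: map_poly_pCons)

text \<open>A complex root is either real or, with its conjugate, gives a real quadratic. The
  remainder modulo that quadratic is real of degree at most one and vanishes at a non-real point, so
  it is zero.\<close>

lemma real_poly_factor:
  fixes p :: "real poly"
  assumes "degree p > 0"
  obtains a s where "p = [:-a, 1:] * s"
  | a b s where "b \<noteq> 0" "p = [:a\<^sup>2 + b\<^sup>2, -2 * a, 1:] * s"
proof -
  let ?c = "map_poly complex_of_real"
  have "degree (?c p) = degree p" by (rule degree_map_poly) simp
  then have "\<not> constant (poly (?c p))" using assms by (simp add: constant_degree)
  then obtain z where z: "poly (?c p) z = 0" using fundamental_theorem_of_algebra by blast
  show thesis
  proof (cases "Im z = 0")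
    case True
    then have "z = complex_of_real (Re z)" by (simp add: complex_eq_iff)
    then have "complex_of_real (poly p (Re z)) = 0"
      using z poly_map_poly_of_real[of p "Re z"] by metis
    then have "poly p (Re z) = 0" by simp
    then show ?thesis using that(1) by (auto simp: poly_eq_0_iff_dvd elim!: dvdE)
  next
    case False
    define q where "q = [:(Re z)\<^sup>2 + (Im z)\<^sup>2, -2 * Re z, 1:]"
    have qz: "poly (?c q) z = 0"
      by (simp add: q_def map_poly_pCons complex_eq_iff power2_eq_square algebra_simps)
    have "p = q * (p div q) + p mod q" by simp
    then have "?c p = ?c q * ?c (p div q) + ?c (p mod q)"
      using map_poly_of_real_add map_poly_of_real_mult by metis
    then have rz: "poly (?c (p mod q)) z = 0" using z qz by simp
    have q0: "q \<noteq> 0" "degree q = 2" by (simp_all add: q_def)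
    have "degree (p mod q) < 2 \<or> p mod q = 0" using degree_mod_less[OF q0(1), of p] q0 by auto
    then have "p mod q = [:coeff (p mod q) 0, coeff (p mod q) 1:]"
      by (intro poly_eqI) (auto simp: coeff_pCons coeff_eq_0 split: nat.split)
    then obtain c d where cd: "p mod q = [:c, d:]" by blast
    have "d * Im z = 0" "c + Re z * d = 0"
      using rz by (auto simp: cd map_poly_pCons complex_eq_iff)
    then have "p mod q = 0" using False cd by simp
    then have "p = q * (p div q)" using \<open>p = q * (p div q) + p mod q\<close> by simp
    then show ?thesis using that(2) False unfolding q_def by blast
  qed
qed

context comm_algebra
begin

text \<open>If \<open>a\<close> squares to zero, so does multiplication by every product of
  \<open>a\<close> and \<open>b\<close>, and such a map has trace zero.\<close>

lemma reduced:
  assumes "a \<star> a = 0" shows "a = 0"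
proof (rule trace_nondeg)
  fix b
  have "(a \<star> b) \<star> ((a \<star> b) \<star> x) = (a \<star> a) \<star> (b \<star> (b \<star> x))" for x by (simp add: mu_ac)
  then have "(a \<star> b) \<star> ((a \<star> b) \<star> x) = 0" for x by (simp add: assms mu_simps)
  then show "tr ((\<star>) (a \<star> b)) = 0" by (rule tr_square_zero[OF linR])
qed

definition ideal :: "(real^'e) set \<Rightarrow> bool" where
  "ideal I \<longleftrightarrow> subspace I \<and> (\<forall>a. \<forall>x\<in>I. a \<star> x \<in> I)"

text \<open>Powers start at \<open>u\<close> instead of \<open>e\<close> because polynomials are
  evaluated inside an ideal with its own identity \<open>u\<close>.\<close>

primrec pw :: "real^'e \<Rightarrow> real^'e \<Rightarrow> nat \<Rightarrow> real^'e" where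
  "pw u x 0 = u"
| "pw u x (Suc n) = x \<star> pw u x n"

definition ev :: "real^'e \<Rightarrow> real^'e \<Rightarrow> real poly \<Rightarrow> real^'e" where
  "ev u x p = (\<Sum>i\<le>degree p. coeff p i *\<^sub>R pw u x i)"

lemma ev_bound: "degree p \<le> n \<Longrightarrow> ev u x p = (\<Sum>i\<le>n. coeff p i *\<^sub>R pw u x i)"
  unfolding ev_def by (rule sum.mono_neutral_left) (auto simp: coeff_eq_0)

lemma ev_pCons: "ev u x (pCons a p) = a *\<^sub>R u + x \<star> ev u x p"
proof -
  have "ev u x (pCons a p) = (\<Sum>i\<le>Suc (degree p). coeff (pCons a p) i *\<^sub>R pw u x i)"
    by (rule ev_bound) (simp add: degree_pCons_le)
  also have "\<dots> = a *\<^sub>R u + (\<Sum>i\<le>degree p. coeff p i *\<^sub>R (x \<star> pw u x i))"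
    by (subst sum.atMost_Suc_shift) simp
  finally show ?thesis by (simp add: ev_def mu_sum mu_simps)
qed

lemma ev_0: "ev u x 0 = 0"
  by (simp add: ev_def)

lemma ev_add: "ev u x (p + q) = ev u x p + ev u x q"
proof -
  let ?n = "max (degree p) (degree q)"
  have "degree (p + q) \<le> ?n" by (rule degree_add_le) auto
  then show ?thesis
    by (simp add: ev_bound[of _ ?n] scaleR_add_left sum.distrib)
qed

lemma ev_smult: "ev u x (smult c p) = c *\<^sub>R ev u x p"
  by (simp add: ev_bound[OF degree_smult_le] ev_def scaleR_sum_right)

lemma ev_unit:
  assumes "u \<star> u = u" "u \<star> x = x" shows "u \<star> ev u x p = ev u x p"
proof (induction p)
  case (pCons a p)
  have "u \<star> (x \<star> ev u x p) = x \<star> ev u x p" using assms(2) assoc by metis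
  then show ?case by (simp add: ev_pCons mu_simps assms)
qed (simp add: ev_0 mu_simps)

lemma ev_mult:
  assumes "u \<star> u = u" "u \<star> x = x" shows "ev u x (p * q) = ev u x p \<star> ev u x q"
  by (induction p)
    (simp_all add: ev_0 ev_add ev_smult ev_pCons mu_simps assoc ev_unit[OF assms])

lemma ev_annihilator: "\<exists>p. p \<noteq> 0 \<and> ev u x p = 0"
proof -
  \<comment> \<open>\<open>'e option\<close> has one element more than the dimension, so the powers
    of \<open>x\<close> with the distinct exponents \<open>g j\<close> are linearly dependent as a
    family.\<close>
  obtain g :: "'e option \<Rightarrow> nat" where g: "inj g" using finite_imp_inj_to_nat_seg[of "UNIV :: 'e option set"] by auto
  define T where "T c = (\<Sum>j\<in>UNIV. (c $ j) *\<^sub>R pw u x (g j))" for c :: "real^('e option)"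
  have lT: "linear T"
    unfolding T_def by (intro linearI) (simp_all add: scaleR_add_left sum.distrib scaleR_sum_right)
  have "\<not> inj T"
  proof
    assume "inj T"
    then have "dim (range T) = dim (UNIV :: (real^('e option)) set)"
      using dim_image_eq[OF lT, of UNIV] by simp
    moreover have "dim (range T) \<le> CARD('e)" using dim_subset_UNIV[of "range T"] by simp
    ultimately show False by simp
  qed
  then obtain c where c: "c \<noteq> 0" "T c = 0" using linear_injective_0[OF lT] by blast
  define p where "p = (\<Sum>j\<in>UNIV. monom (c $ j) (g j))"
  have "coeff p (g j) = c $ j" for j
    using g by (simp add: p_def coeff_sum inj_eq if_distrib cong: if_cong)
  then have "p \<noteq> 0" using c(1) by (metis coeff_0 vec_eq_iff zero_index)
  moreover have "ev u x p = 0"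
  proof -
    have ev_sum: "ev u x (\<Sum>j\<in>J. P j) = (\<Sum>j\<in>J. ev u x (P j))" for J and P :: "'e option \<Rightarrow> real poly"
      by (induction J rule: infinite_finite_induct) (simp_all add: ev_0 ev_add)
    have "ev u x (monom a n) = a *\<^sub>R pw u x n" for a n
      by (induction n) (simp_all add: monom_0 monom_Suc ev_pCons ev_0 mu_simps)
    then show ?thesis using c(2) by (simp add: p_def ev_sum T_def)
  qed
  ultimately show ?thesis by blast
qed

text \<open>An annihilating polynomial is split into real factors of degree one and two. As
  \<open>nzd\<close> excludes zero divisors, either the split factor annihilates \<open>x\<close> or
  the cofactor does, and then the degree drops. A quadratic factor is completed to a square; a
  linear factor is the case \<open>b = 0\<close>.\<close>

lemma field_element_quadratic:
  assumes u: "u \<noteq> 0" "u \<star> u = u" "u \<star> x = x"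
    and nzd: "\<And>y z. u \<star> y = y \<Longrightarrow> u \<star> z = z \<Longrightarrow> y \<star> z = 0 \<Longrightarrow> y = 0 \<or> z = 0"
  obtains a b where "(x - a *\<^sub>R u) \<star> (x - a *\<^sub>R u) = - (b\<^sup>2) *\<^sub>R u"
proof -
  have "\<exists>a b. (x - a *\<^sub>R u) \<star> (x - a *\<^sub>R u) = - (b\<^sup>2) *\<^sub>R u"
    if "p \<noteq> 0" "ev u x p = 0" for p
    using that
  proof (induction "degree p" arbitrary: p rule: less_induct)
    case less
    let ?G = "\<exists>a b. (x - a *\<^sub>R u) \<star> (x - a *\<^sub>R u) = - (b\<^sup>2) *\<^sub>R u"
    have xu: "x \<star> u = x" using u comm by metis
    have lin: "ev u x [:-a, 1:] = x - a *\<^sub>R u" for a by (simp add: ev_pCons ev_0 mu_simps xu)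
    have quad: "ev u x [:a\<^sup>2 + b\<^sup>2, -2 * a, 1:] = (x - a *\<^sub>R u) \<star> (x - a *\<^sub>R u) + (b\<^sup>2) *\<^sub>R u" for a b
      by (simp add: ev_pCons ev_0 mu_simps xu u vec_eq_iff algebra_simps power2_eq_square)
    have zd: "ev u x q = 0 \<or> ev u x s = 0" if "p = q * s" for q s
      using less.prems(2) ev_mult[OF u(2,3)] nzd ev_unit[OF u(2,3)] that by metis
    have "degree p > 0"
    proof (rule ccontr)
      assume "\<not> degree p > 0"
      then obtain a where "p = [:a:]" using degree_eq_zeroE by blast
      then show False using less.prems u by (simp add: ev_pCons ev_0 mu_simps)
    qed
    then show ?G
    proof (cases rule: real_poly_factor)
      case (1 a s)
      have s0: "s \<noteq> 0" using 1 less.prems by auto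
      have "degree p = Suc (degree s)" unfolding 1 by (subst degree_mult_eq) (use s0 in auto)
      then have IH: ?G if "ev u x s = 0" using less.hyps[of s] s0 that by simp
      show ?thesis
      proof (cases "ev u x s = 0")
        case False
        then have "x - a *\<^sub>R u = 0" using zd[OF 1] lin by simp
        then have "(x - a *\<^sub>R u) \<star> (x - a *\<^sub>R u) = - (0\<^sup>2) *\<^sub>R u" by (simp add: mu_simps(7))
        then show ?thesis by blast
      qed (rule IH)
    next
      case (2 a b s)
      have s0: "s \<noteq> 0" using 2 less.prems by auto
      have "degree p = 2 + degree s" unfolding 2 by (subst degree_mult_eq) (use s0 in auto)
      then have IH: ?G if "ev u x s = 0" using less.hyps[of s] s0 that by simp
      show ?thesis
      proof (cases "ev u x s = 0")
        case False
        then have "(x - a *\<^sub>R u) \<star> (x - a *\<^sub>R u) + (b\<^sup>2) *\<^sub>R u = 0" using zd[OF 2(2)] quad by simp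
        then have "(x - a *\<^sub>R u) \<star> (x - a *\<^sub>R u) = - (b\<^sup>2) *\<^sub>R u" by (simp add: add_eq_0_iff2)
        then show ?thesis by blast
      qed (rule IH)
    qed
  qed
  then show thesis using ev_annihilator that by blast
qed

text \<open>An atom is the identity \<open>u\<close> of a minimal ideal, with \<open>f = 0\<close> if the ideal is
  a copy of the reals and \<open>f\<close> an imaginary unit if it is a copy of the complex numbers.\<close>

definition atom :: "real^'e \<Rightarrow> real^'e \<Rightarrow> bool" where
  "atom u f \<longleftrightarrow> u \<noteq> 0 \<and> u \<star> u = u \<and> u \<star> f = f \<and> (f = 0 \<or> f \<star> f = - u)"

text \<open>Take a nonzero ideal \<open>I0\<close> of least dimension inside \<open>I\<close>. For
  \<open>a\<close> nonzero in \<open>I0\<close>, the multiples of \<open>a\<close> by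
  \<open>I0\<close> form an ideal containing the nonzero square of \<open>a\<close>, hence all of
  \<open>I0\<close>; so \<open>I0\<close> is a field with some identity \<open>u\<close>. Its
  elements are quadratic over the reals, which leaves the real and the complex numbers.\<close>

lemma minimal_ideal:
  assumes I: "ideal I" "I \<noteq> {0}"
  obtains u f where "atom u f" "u \<in> I" "f \<in> I" "\<And>x. u \<star> x \<in> span {u, f}"
    "dim (span {u, f}) = (if f = 0 then 1 else 2)"
proof -
  have "\<exists>I0. (ideal I0 \<and> I0 \<noteq> {0} \<and> I0 \<subseteq> I) \<and>
      (\<forall>J. ideal J \<and> J \<noteq> {0} \<and> J \<subseteq> I \<longrightarrow> dim I0 \<le> dim J)"
    using I by (intro ex_has_least_nat[where k=I]) auto
  then obtain I0 where I0: "ideal I0" "I0 \<noteq> {0}" "I0 \<subseteq> I"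
    and min: "\<And>J. ideal J \<Longrightarrow> J \<noteq> {0} \<Longrightarrow> J \<subseteq> I \<Longrightarrow> dim I0 \<le> dim J" by blast
  have sub: "subspace I0" and cl: "\<And>a x. x \<in> I0 \<Longrightarrow> a \<star> x \<in> I0" using I0 by (auto simp: ideal_def)
  have surj: "\<exists>y\<in>I0. a \<star> y = x" if a: "a \<in> I0" "a \<noteq> 0" and x: "x \<in> I0" for a x
  proof -
    let ?J = "(\<star>) a ` I0"
    have J: "subspace ?J" using sub linR by (rule linear_subspace_image[rotated])
    have "b \<star> (a \<star> y) \<in> ?J" if "y \<in> I0" for b y
      using cl[OF that, of b] lcomm[of b a y] by (metis imageI)
    then have "ideal ?J" using J by (auto simp: ideal_def)
    moreover have "a \<star> a \<in> ?J" using a by simp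
    then have "?J \<noteq> {0}" using reduced[of a] a by auto
    moreover have JI: "?J \<subseteq> I0" using cl by auto
    ultimately have "dim I0 \<le> dim ?J" using min I0(3) by blast
    then have "?J = I0" by (rule subspace_dim_equal[OF J sub JI])
    then show ?thesis using x by (metis imageE)
  qed
  obtain a where a: "a \<in> I0" "a \<noteq> 0" using I0(2) subspace_0[OF sub] by blast
  obtain u where u: "u \<in> I0" "a \<star> u = a" using surj[OF a a(1)] by blast
  have ux: "u \<star> x = x" if x: "x \<in> I0" for x
  proof -
    obtain y where "a \<star> y = x" using surj[OF a x] by blast
    then show ?thesis using u(2) assoc comm by metis
  qed
  have u0: "u \<noteq> 0" using u a by (auto simp: mu_simps)
  have uu: "u \<star> u = u" by (rule ux[OF u(1)])
  have memI: "y \<in> I0" if "u \<star> y = y" for y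
    using cl[OF u(1), of y] that comm by metis
  have nzd: "y = 0 \<or> z = 0" if yz: "u \<star> y = y" "u \<star> z = z" "y \<star> z = 0" for y z
  proof (rule ccontr)
    assume "\<not> (y = 0 \<or> z = 0)"
    then obtain w where w: "y \<star> w = z"
      using surj[OF memI[OF yz(1)] _ memI[OF yz(2)]] by auto
    have "(y \<star> w) \<star> z = w \<star> (y \<star> z)" by (simp add: mu_ac)
    then have "z \<star> z = w \<star> (y \<star> z)" unfolding w .
    then have "z = 0" using reduced[of z] yz by (simp add: mu_simps)
    then show False using \<open>\<not> (y = 0 \<or> z = 0)\<close> by simp
  qed
  have quad: "\<exists>a b. (x - a *\<^sub>R u) \<star> (x - a *\<^sub>R u) = - (b\<^sup>2) *\<^sub>R u" if "x \<in> I0" for x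
    using field_element_quadratic[OF u0 uu ux[OF that] nzd] by blast
  have uI: "u \<star> x \<in> I0" for x using cl[OF u(1), of x] comm by metis
  show thesis
  proof (cases "I0 \<subseteq> span {u}")
    case True
    show thesis
    proof (rule that[of u 0])
      show "atom u 0" using u0 uu by (simp add: atom_def mu_simps)
      show "u \<in> I" "0 \<in> I" using subsetD[OF I0(3)] u(1) subspace_0[OF sub] by blast+
      show "u \<star> x \<in> span {u, 0}" for x
        by (rule subsetD[OF span_mono[of "{u}" "{u, 0}"] subsetD[OF True uI]]) simp
      show "dim (span {u, 0}) = (if (0::real^'e) = 0 then 1 else 2)"
        using u0 span_insert_0[of "{u}"] by (simp only: insert_commute[of u 0] dim_span dim_singleton if_False) simp
    qed
  next
    case False
    then obtain x where x: "x \<in> I0" "x \<notin> span {u}" by blast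
    obtain a b where ab: "(x - a *\<^sub>R u) \<star> (x - a *\<^sub>R u) = - (b\<^sup>2) *\<^sub>R u" using quad[OF x(1)] by blast
    have xa: "x - a *\<^sub>R u \<noteq> 0" using x(2) by (auto simp: span_singleton)
    have b0: "b \<noteq> 0"
    proof
      assume "b = 0"
      then have "(x - a *\<^sub>R u) \<star> (x - a *\<^sub>R u) = 0" using ab by simp
      then show False using reduced xa by blast
    qed
    define f where "f = (1 / b) *\<^sub>R (x - a *\<^sub>R u)"
    have ff: "f \<star> f = - u"
    proof -
      have "f \<star> f = (1 / b) *\<^sub>R (1 / b) *\<^sub>R ((x - a *\<^sub>R u) \<star> (x - a *\<^sub>R u))"
        unfolding f_def by (simp only: linear_cmul[OF linR] linear_cmul[OF linL])
      then show ?thesis unfolding ab using b0 by (simp add: power2_eq_square)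
    qed
    have fI: "f \<in> I0" unfolding f_def using x u sub by (intro subspace_scale subspace_diff)
    have span: "y \<in> span {u, f}" if y: "y \<in> I0" for y
    proof -
      obtain c d where cd: "(y - c *\<^sub>R u) \<star> (y - c *\<^sub>R u) = - (d\<^sup>2) *\<^sub>R u" using quad[OF y] by blast
      \<comment> \<open>A difference of squares: \<open>y - c u\<close> and \<open>d f\<close> have
        the same square, so one of the two factors vanishes and \<open>y\<close> is a combination of
        \<open>u\<close> and \<open>f\<close>.\<close>
      have "(y - c *\<^sub>R u - d *\<^sub>R f) \<star> (y - c *\<^sub>R u + d *\<^sub>R f) =
          (y - c *\<^sub>R u) \<star> (y - c *\<^sub>R u) - (d * d) *\<^sub>R (f \<star> f)"
        using comm[of f y] comm[of f u]
        by (simp add: mu_simps algebra_simps)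
      also have "\<dots> = 0" unfolding cd ff by (simp add: power2_eq_square)
      finally have "(y - c *\<^sub>R u - d *\<^sub>R f) \<star> (y - c *\<^sub>R u + d *\<^sub>R f) = 0" .
      moreover have "u \<star> (y - c *\<^sub>R u - d *\<^sub>R f) = y - c *\<^sub>R u - d *\<^sub>R f"
        "u \<star> (y - c *\<^sub>R u + d *\<^sub>R f) = y - c *\<^sub>R u + d *\<^sub>R f"
        using y fI u(1) by (simp_all add: mu_simps ux)
      ultimately have "y - c *\<^sub>R u - d *\<^sub>R f = 0 \<or> y - c *\<^sub>R u + d *\<^sub>R f = 0" using nzd by blast
      moreover have "y = p + q" if "y - p - q = 0" for p q
        using arg_cong[OF that, of "\<lambda>z. z + p + q"] by simp
      moreover have "y = p + - q" if "y - p + q = 0" for p q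
        using arg_cong[OF that, of "\<lambda>z. z + p - q"] by simp
      ultimately have "y = c *\<^sub>R u + d *\<^sub>R f \<or> y = c *\<^sub>R u + (-d) *\<^sub>R f"
        unfolding scaleR_minus_left by metis
      moreover have "c *\<^sub>R u + d *\<^sub>R f \<in> span {u, f}" for c d
        by (intro span_add span_scale span_base) auto
      ultimately show ?thesis by metis
    qed
    have fu: "f \<notin> span {u}"
    proof
      assume "f \<in> span {u}"
      then have "b *\<^sub>R f + a *\<^sub>R u \<in> span {u}"
        using span_base[of u "{u}"] by (intro span_add span_scale) auto
      moreover have "b *\<^sub>R f + a *\<^sub>R u = x" using b0 by (simp only: f_def scaleR_scaleR) simp
      ultimately show False using x(2) by simp
    qed
    have f0: "f \<noteq> 0" using fu span_zero[of "{u}"] by auto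
    show thesis
    proof (rule that[of u f])
      show "atom u f" using u0 uu ff ux[OF fI] by (simp add: atom_def)
      show "u \<in> I" "f \<in> I" using u fI I0 by auto
      show "u \<star> x \<in> span {u, f}" for x by (rule span[OF uI])
      have "dim (insert f {u}) = dim {u} + 1" using fu by (simp only: dim_insert if_False)
      also have "insert f {u} = {u, f}" by (rule insert_commute)
      finally show "dim (span {u, f}) = (if f = 0 then 1 else 2)"
        using f0 u0 by (simp only: dim_span dim_singleton if_False)
    qed
  qed
qed

end

context comm_algebra
begin

text \<open>The identity \<open>u\<close> of a minimal ideal in \<open>I\<close> splits
  \<open>I\<close> into the span of its atom and the annihilator \<open>I1\<close> of
  \<open>u\<close>, an ideal of smaller dimension. The dimension count is carried along because it
  gives the parity of the number of real atoms.\<close>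

lemma ideal_decomposition:
  assumes "ideal I"
  shows "\<exists>S. finite S \<and> (\<forall>A\<in>S. atom (fst A) (snd A)) \<and>
     (\<forall>A\<in>S. \<forall>B\<in>S. A \<noteq> B \<longrightarrow> fst A \<star> fst B = 0) \<and>
     I = span (fst ` S \<union> snd ` S) \<and> dim I = (\<Sum>A\<in>S. if snd A = 0 then 1 else 2)"
  using assms
proof (induction "dim I" arbitrary: I rule: less_induct)
  case less
  show ?case
  proof (cases "I = {0}")
    case True
    then show ?thesis by (intro exI[of _ "{}"]) simp
  next
    case False
    from minimal_ideal[OF less.prems False] obtain u f where
      at: "atom u f" and uf: "u \<in> I" "f \<in> I" and sp: "\<And>x. u \<star> x \<in> span {u, f}"
      and dsp: "dim (span {u, f}) = (if f = 0 then 1 else 2)" by blast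
    have sub: "subspace I" and cl: "\<And>a x. x \<in> I \<Longrightarrow> a \<star> x \<in> I" using less.prems by (auto simp: ideal_def)
    have a: "u \<noteq> 0" "u \<star> u = u" "u \<star> f = f" using at by (auto simp: atom_def)
    define I1 where "I1 = {x \<in> I. u \<star> x = 0}"
    have sub1: "subspace I1"
      using sub unfolding I1_def subspace_def by (auto simp: mu_simps)
    have id1: "ideal I1"
      unfolding ideal_def
    proof (intro conjI allI ballI sub1)
      fix a x assume "x \<in> I1"
      then show "a \<star> x \<in> I1" using cl lcomm[of u a x] by (simp add: I1_def mu_simps)
    qed
    have "u \<notin> I1" using a by (simp add: I1_def)
    then have "I1 \<subset> I" using uf by (auto simp: I1_def)
    then have "span I1 \<subset> span I" using sub sub1 by (simp only: span_eq_iff[THEN iffD2])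
    then have "dim I1 < dim I" by (rule dim_psubset)
    from less.hyps[OF this id1] obtain S where S: "finite S" "\<And>A. A \<in> S \<Longrightarrow> atom (fst A) (snd A)"
      "\<And>A B. A \<in> S \<Longrightarrow> B \<in> S \<Longrightarrow> A \<noteq> B \<Longrightarrow> fst A \<star> fst B = 0"
      "I1 = span (fst ` S \<union> snd ` S)" "dim I1 = (\<Sum>A\<in>S. if snd A = 0 then 1 else 2)" by (elim exE conjE) blast
    have inI1: "fst A \<in> I1" if "A \<in> S" for A
      unfolding S(4) using that by (intro span_base) simp
    have ufS: "u \<star> fst A = 0" if "A \<in> S" for A
      using inI1[OF that] by (simp add: I1_def)
    have notin: "(u, f) \<notin> S" using ufS[of "(u, f)"] a by auto
    have sum: "I = {x + y |x y. x \<in> span {u, f} \<and> y \<in> I1}"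
    proof safe
      fix x assume x: "x \<in> I"
      have "u \<star> (u \<star> x) = u \<star> x" using a assoc by metis
      then have "x - u \<star> x \<in> I1" using x cl sub by (simp add: I1_def subspace_diff mu_simps)
      then show "\<exists>x' y. x = x' + y \<and> x' \<in> span {u, f} \<and> y \<in> I1"
        using sp[of x] by (intro exI[of _ "u \<star> x"] exI[of _ "x - u \<star> x"]) simp
    next
      fix x y assume x: "x \<in> span {u, f}" and y: "y \<in> I1"
      have "span {u, f} \<subseteq> I" using uf sub by (simp add: span_minimal)
      then have "x \<in> I" using x by blast
      then show "x + y \<in> I" using y sub by (auto simp: I1_def intro: subspace_add)
    qed
    have "span {u, f} \<inter> I1 = {0}"
    proof safe
      fix x assume x: "x \<in> span {u, f}" and x1: "x \<in> I1"
      have "u \<star> x = x"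
      proof -
        have "subspace {x. u \<star> x = x}" unfolding subspace_def by (auto simp: mu_simps)
        then have "span {u, f} \<subseteq> {x. u \<star> x = x}" using a by (intro span_minimal) auto
        then show ?thesis using x by blast
      qed
      then show "x = 0" using x1 by (simp add: I1_def)
    qed (use sub1 in \<open>auto simp: subspace_0 span_zero\<close>)
    then have "dim I = dim (span {u, f}) + dim I1"
      using dim_sums_Int[OF subspace_span[of "{u, f}"] sub1] unfolding sum[symmetric] by simp
    then have dimI: "dim I = (\<Sum>A\<in>insert (u, f) S. if snd A = 0 then 1 else 2)"
      using S(1) notin dsp by (simp add: S(5))
    have spI: "I = span (fst ` insert (u, f) S \<union> snd ` insert (u, f) S)"
    proof -
      have "fst ` insert (u, f) S \<union> snd ` insert (u, f) S = {u, f} \<union> (fst ` S \<union> snd ` S)" by auto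
      then show ?thesis using sum span_Un[of "{u, f}" "fst ` S \<union> snd ` S"] S(4) by simp
    qed
    show ?thesis
    proof (intro exI[of _ "insert (u, f) S"] conjI)
      show "\<forall>A\<in>insert (u, f) S. atom (fst A) (snd A)" using at S(2) by auto
      show "\<forall>A\<in>insert (u, f) S. \<forall>B\<in>insert (u, f) S. A \<noteq> B \<longrightarrow> fst A \<star> fst B = 0"
        using S(3) ufS comm[of "fst _" u] by auto
    qed (use S(1) spI dimI in auto)
  qed
qed

text \<open>The algebra is a product of copies of \<open>\<real>[f] / (f\<^sup>2 + \<epsilon>)\<close> with \<open>\<epsilon> = \<plusminus>1\<close>: the real
  atoms are grouped in pairs.\<close>

theorem algebra_classification:
  assumes card: "CARD('e) = 2 * CARD('k::finite)"
  obtains U F :: "'k::finite \<Rightarrow> real^'e" and \<epsilon> :: "'k \<Rightarrow> real"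
  where "\<And>k. \<epsilon> k = 1 \<or> \<epsilon> k = -1" "\<And>k. U k \<star> U k = U k" "\<And>k. U k \<star> F k = F k"
    "\<And>k. F k \<star> F k = - \<epsilon> k *\<^sub>R U k"
    "\<And>k l. k \<noteq> l \<Longrightarrow> U k \<star> U l = 0" "span (range U \<union> range F) = UNIV"
proof -
  have "ideal UNIV" by (simp add: ideal_def)
  from ideal_decomposition[OF this] obtain S where S: "finite S" "\<And>A. A \<in> S \<Longrightarrow> atom (fst A) (snd A)"
      "\<And>A B. A \<in> S \<Longrightarrow> B \<in> S \<Longrightarrow> A \<noteq> B \<Longrightarrow> fst A \<star> fst B = 0"
      "UNIV = span (fst ` S \<union> snd ` S)"
      "dim (UNIV :: (real^'e) set) = (\<Sum>A\<in>S. if snd A = 0 then 1 else 2)" by (elim exE conjE) blast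
  define R C where "R = {A \<in> S. snd A = 0}" and "C = {A \<in> S. snd A \<noteq> 0}"
  have fin: "finite R" "finite C" and RC: "S = R \<union> C" "R \<inter> C = {}"
    using S(1) by (auto simp: R_def C_def)
  have "(\<Sum>A\<in>S. if snd A = 0 then 1 else 2) = (\<Sum>A\<in>R. if snd A = 0 then 1 else 2) + (\<Sum>A\<in>C. if snd A = 0 then 1 else (2::nat))"
    unfolding RC(1) by (rule sum.union_disjoint) (use fin RC in auto)
  also have "\<dots> = card R + 2 * card C"
    by (simp add: R_def C_def)
  finally have cardS: "card R + 2 * card C = 2 * CARD('k)" using S(5) card by simp
  \<comment> \<open>The dimension is even and each complex atom contributes two, so the real atoms
    can be paired.\<close>
  then have "even (card R)" by presburger
  then obtain m where m: "card R = 2 * m" by blast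
  have mC: "m + card C = CARD('k)" using cardS m by simp
  obtain \<beta> :: "'k \<Rightarrow> nat" where \<beta>: "bij_betw \<beta> UNIV {0..<CARD('k)}"
    using ex_bij_betw_finite_nat[of "UNIV :: 'k set"] by auto
  obtain r where r: "bij_betw r {0..<2*m} R" using ex_bij_betw_nat_finite[OF fin(1)] m by auto
  obtain c where c: "bij_betw c {0..<card C} C" using ex_bij_betw_nat_finite[OF fin(2)] by auto
  \<comment> \<open>For two real atoms with orthogonal idempotents, the sum is an identity and the
    difference squares to it, the case \<open>\<epsilon> = -1\<close>. A complex atom supplies its
    own imaginary unit, the case \<open>\<epsilon> = 1\<close>.\<close>
  define U where "U k = (if \<beta> k < m then fst (r (2 * \<beta> k)) + fst (r (2 * \<beta> k + 1)) else fst (c (\<beta> k - m)))" for k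
  define F where "F k = (if \<beta> k < m then fst (r (2 * \<beta> k)) - fst (r (2 * \<beta> k + 1)) else snd (c (\<beta> k - m)))" for k
  define \<epsilon> where "\<epsilon> k = (if \<beta> k < m then -1 else (1::real))" for k
  have rR: "r i \<in> R" if "i < 2 * m" for i using bij_betwE[OF r] that by auto
  have rS: "r i \<in> S" if "i < 2 * m" for i using rR[OF that] by (simp add: R_def)
  have cC: "c i \<in> C" if "i < card C" for i using bij_betwE[OF c] that by auto
  have cS: "c i \<in> S" if "i < card C" for i using cC[OF that] by (simp add: C_def)
  note at = S(2)
  have rr: "fst (r i) \<star> fst (r j) = (if i = j then fst (r i) else 0)" if "i < 2 * m" "j < 2 * m" for i j
  proof (cases "i = j")
    case True
    then show ?thesis using at[OF rS[OF that(1)]] by (simp add: atom_def)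
  next
    case False
    then have "r i \<noteq> r j" using inj_on_eq_iff[OF bij_betw_imp_inj_on[OF r], of i j] that by simp
    then show ?thesis using S(3)[OF rS[OF that(1)] rS[OF that(2)]] False by simp
  qed
  have rc: "fst (r i) \<star> fst (c j) = 0" if "i < 2 * m" "j < card C" for i j
  proof (rule S(3)[OF rS[OF that(1)] cS[OF that(2)]])
    have "snd (r i) = 0" "snd (c j) \<noteq> 0"
      using rR[OF that(1)] cC[OF that(2)] by (simp_all add: R_def C_def)
    then show "r i \<noteq> c j" by (metis (full_types))
  qed
  have cc: "fst (c i) \<star> fst (c j) = 0" if "i < card C" "j < card C" "i \<noteq> j" for i j
  proof -
    have "c i \<noteq> c j" using inj_on_eq_iff[OF bij_betw_imp_inj_on[OF c], of i j] that by simp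
    then show ?thesis using S(3)[OF cS[OF that(1)] cS[OF that(2)]] by simp
  qed
  have \<beta>m: "\<beta> k - m < card C" if "\<not> \<beta> k < m" for k
  proof -
    have "\<beta> k < CARD('k)" using bij_betwE[OF \<beta>] by simp
    then show ?thesis using that mC by linarith
  qed
  have \<beta>inj: "\<beta> k = \<beta> l \<Longrightarrow> k = l" for k l using injD[OF bij_betw_imp_inj_on[OF \<beta>]] .
  show thesis
  proof (rule that[of \<epsilon> U F])
    fix k
    show "\<epsilon> k = 1 \<or> \<epsilon> k = -1" by (simp add: \<epsilon>_def)
    have "U k \<star> U k = U k \<and> U k \<star> F k = F k \<and> F k \<star> F k = - \<epsilon> k *\<^sub>R U k"
    proof (cases "\<beta> k < m")
      case True
      then have "2 * \<beta> k < 2 * m" "2 * \<beta> k + 1 < 2 * m" by auto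
      then show ?thesis using True by (simp add: U_def F_def \<epsilon>_def mu_simps rr)
    next
      case False
      have "c (\<beta> k - m) \<in> C" by (rule cC[OF \<beta>m[OF False]])
      then show ?thesis
        using False at[of "c (\<beta> k - m)"] by (simp add: U_def F_def \<epsilon>_def C_def atom_def)
    qed
    then show "U k \<star> U k = U k" "U k \<star> F k = F k" "F k \<star> F k = - \<epsilon> k *\<^sub>R U k" by auto
  next
    fix k l :: 'k assume "k \<noteq> l"
    then have ne: "\<beta> k \<noteq> \<beta> l" using \<beta>inj by blast
    show "U k \<star> U l = 0"
    proof (cases "\<beta> k < m")
      case k: True
      then have k2: "2 * \<beta> k < 2 * m" "2 * \<beta> k + 1 < 2 * m" by auto
      show ?thesis
      proof (cases "\<beta> l < m")
        case True
        then have l2: "2 * \<beta> l < 2 * m" "2 * \<beta> l + 1 < 2 * m" by auto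
        have "2 * \<beta> k \<noteq> 2 * \<beta> l" "2 * \<beta> k + 1 \<noteq> 2 * \<beta> l" "2 * \<beta> k \<noteq> 2 * \<beta> l + 1" "2 * \<beta> k + 1 \<noteq> 2 * \<beta> l + 1"
          using ne by presburger+
        then show ?thesis
          using k True rr[OF k2(1) l2(1)] rr[OF k2(1) l2(2)] rr[OF k2(2) l2(1)] rr[OF k2(2) l2(2)]
          by (simp add: U_def mu_simps)
      next
        case False
        then show ?thesis
          using k rc[OF k2(1) \<beta>m[OF False]] rc[OF k2(2) \<beta>m[OF False]] by (simp add: U_def mu_simps)
      qed
    next
      case k: False
      show ?thesis
      proof (cases "\<beta> l < m")
        case True
        then have l2: "2 * \<beta> l < 2 * m" "2 * \<beta> l + 1 < 2 * m" by auto
        then show ?thesis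
          using k True rc[OF l2(1) \<beta>m[OF k]] rc[OF l2(2) \<beta>m[OF k]]
          by (simp add: U_def mu_simps comm[of "fst (c _)"])
      next
        case False
        then show ?thesis using k ne cc[OF \<beta>m[OF k] \<beta>m[OF False]] by (simp add: U_def)
      qed
    qed
  next
    let ?T = "span (range U \<union> range F)"
    have surj\<beta>: "\<exists>k. \<beta> k = i" if "i < CARD('k)" for i
      using \<beta> that unfolding bij_betw_def by (metis atLeastLessThan_iff imageE le0)
    have UT: "U k \<in> ?T" "F k \<in> ?T" for k by (auto intro: span_base)
    have rT: "fst (r (2 * i)) \<in> ?T \<and> fst (r (2 * i + 1)) \<in> ?T" if im: "i < m" for i
    proof -
      obtain k where k: "\<beta> k = i" using surj\<beta>[of i] im mC by auto
      have "fst (r (2 * i)) = (1/2) *\<^sub>R (U k + F k)" "fst (r (2 * i + 1)) = (1/2) *\<^sub>R (U k - F k)"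
        using im by (simp_all add: U_def F_def k flip: scaleR_2)
      then show ?thesis using UT[of k] by (metis span_add span_diff span_scale)
    qed
    have RT: "fst A \<in> ?T" if A: "A \<in> R" for A
    proof -
      obtain i where i: "i < 2 * m" "A = r i"
        using r A unfolding bij_betw_def by (metis atLeastLessThan_iff imageE)
      have "i = 2 * (i div 2) \<or> i = 2 * (i div 2) + 1" by presburger
      moreover have "i div 2 < m" using i by simp
      ultimately show ?thesis using rT[of "i div 2"] i(2) by metis
    qed
    have CT: "fst A \<in> ?T" "snd A \<in> ?T" if A: "A \<in> C" for A
    proof -
      obtain i where i: "i < card C" "A = c i"
        using c A unfolding bij_betw_def by (metis atLeastLessThan_iff imageE)
      obtain k where k: "\<beta> k = m + i" using surj\<beta>[of "m + i"] i mC by auto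
      have "fst A = U k" "snd A = F k" using i k by (simp_all add: U_def F_def)
      then show "fst A \<in> ?T" "snd A \<in> ?T" using UT by auto
    qed
    have "fst ` S \<union> snd ` S \<subseteq> ?T"
    proof safe
      fix v g assume vg: "(v, g) \<in> S"
      show "fst (v, g) \<in> ?T" using vg RT CT unfolding RC(1) by blast
      show "snd (v, g) \<in> ?T"
      proof (cases "g = 0")
        case True
        then show ?thesis using span_zero by simp
      next
        case False
        then show ?thesis using vg CT(2)[of "(v, g)"] by (simp add: C_def)
      qed
    qed
    then have "UNIV \<subseteq> ?T" unfolding S(4) by (rule span_minimal) simp
    then show "?T = UNIV" by blast
  qed
qed

end

section \<open>Split coordinates and the norm form\<close>

lemma sum_UNIV_Plus:
  fixes h :: "'a::finite + 'b::finite \<Rightarrow> 'c::comm_monoid_add"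
  shows "(\<Sum>j\<in>UNIV. h j) = (\<Sum>k\<in>UNIV. h (Inl k)) + (\<Sum>k\<in>UNIV. h (Inr k))"
  unfolding UNIV_Plus_UNIV[symmetric] by (subst sum.Plus) auto

text \<open>In a two-dimensional factor with generator \<open>f\<close>, where \<open>f\<close>
  squares to \<open>-\<epsilon>\<close>, the element \<open>x + y f\<close> has norm
  \<open>x^2 + \<epsilon> y^2\<close>.\<close>

definition quad_norm :: "('k::finite \<Rightarrow> real) \<Rightarrow> real^('k + 'k) \<Rightarrow> real" where
  "quad_norm \<epsilon> v = (\<Prod>k\<in>UNIV. (v $ Inl k)\<^sup>2 + \<epsilon> k * (v $ Inr k)\<^sup>2)"

context comm_algebra
begin

text \<open>The components \<open>Inl k\<close> and \<open>Inr k\<close> are the coefficients of the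
  identity and of the generator in factor \<open>k\<close>. The last clause is the trace of
  multiplication by \<open>a\<close>, to which each factor contributes twice its first
  coefficient.\<close>

definition split_coordinates :: "('k::finite \<Rightarrow> real) \<Rightarrow> (real^'e \<Rightarrow> real^('k + 'k)) \<Rightarrow> bool" where
  "split_coordinates \<epsilon> \<Phi> \<longleftrightarrow> (\<forall>k. \<epsilon> k = 1 \<or> \<epsilon> k = -1) \<and> linear \<Phi> \<and> bij \<Phi> \<and>
     (\<forall>a b k. \<Phi> (a \<star> b) $ Inl k = \<Phi> a $ Inl k * \<Phi> b $ Inl k - \<epsilon> k * (\<Phi> a $ Inr k * \<Phi> b $ Inr k)) \<and>
     (\<forall>a b k. \<Phi> (a \<star> b) $ Inr k = \<Phi> a $ Inl k * \<Phi> b $ Inr k + \<Phi> a $ Inr k * \<Phi> b $ Inl k) \<and>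
     (\<forall>k. \<Phi> e $ Inl k = 1 \<and> \<Phi> e $ Inr k = 0) \<and>
     (\<forall>a. t a = 2 * (\<Sum>k\<in>UNIV. \<Phi> a $ Inl k))"

theorem split_coordinates_exist:
  assumes card: "CARD('e) = 2 * CARD('k::finite)"
  obtains \<epsilon> :: "'k::finite \<Rightarrow> real" and \<Phi> where "split_coordinates \<epsilon> \<Phi>"
proof (rule algebra_classification[OF card])
  fix U F :: "'k \<Rightarrow> real^'e" and \<epsilon> :: "'k \<Rightarrow> real"
  assume eps: "\<And>k. \<epsilon> k = 1 \<or> \<epsilon> k = -1" and UU: "\<And>k. U k \<star> U k = U k" and UF: "\<And>k. U k \<star> F k = F k"
    and FF: "\<And>k. F k \<star> F k = - \<epsilon> k *\<^sub>R U k"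
    and orth: "\<And>k l. k \<noteq> l \<Longrightarrow> U k \<star> U l = 0" and span: "span (range U \<union> range F) = UNIV"
  have FU: "F k \<star> U k = F k" for k using UF comm by metis
  define \<Psi> where "\<Psi> v = (\<Sum>k\<in>UNIV. (v $ Inl k) *\<^sub>R U k + (v $ Inr k) *\<^sub>R F k)" for v :: "real^('k + 'k)"
  have lin: "linear \<Psi>"
    unfolding \<Psi>_def
    by (intro linearI) (simp_all add: scaleR_add_left sum.distrib scaleR_sum_right scaleR_add_right algebra_simps)
  have "U k \<in> range \<Psi>" "F k \<in> range \<Psi>" for k
  proof -
    have "\<Psi> (axis (Inl k) 1) = U k" "\<Psi> (axis (Inr k) 1) = F k"
      by (simp_all add: \<Psi>_def axis_def if_distrib[of "\<lambda>c. c *\<^sub>R _"] cong: if_cong)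
    then show "U k \<in> range \<Psi>" "F k \<in> range \<Psi>" by (metis rangeI)+
  qed
  then have "span (range U \<union> range F) \<subseteq> range \<Psi>"
    by (intro span_minimal linear_subspace_image[OF lin subspace_UNIV]) auto
  then have surj: "surj \<Psi>" using span by auto
  have inj: "inj \<Psi>"
    by (rule linear_surjective_imp_injective[OF lin surj]) (use card in simp)
  define \<Phi> where "\<Phi> = inv \<Psi>"
  have \<Psi>\<Phi>: "\<Psi> (\<Phi> a) = a" for a by (simp add: \<Phi>_def surj_f_inv_f[OF surj])
  have \<Phi>\<Psi>: "\<Phi> (\<Psi> v) = v" for v by (simp add: \<Phi>_def inv_f_f[OF inj])
  have lin\<Phi>: "linear \<Phi>"
    by (intro linearI injD[OF inj]) (simp_all add: \<Psi>\<Phi> linear_add[OF lin] linear_cmul[OF lin])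
  have bij\<Phi>: "bij \<Phi>" unfolding \<Phi>_def by (intro bij_imp_bij_inv bijI inj surj)
  have prod: "\<Psi> v \<star> \<Psi> w = \<Psi> (\<chi> j. case j of
      Inl k \<Rightarrow> v $ Inl k * w $ Inl k - \<epsilon> k * (v $ Inr k * w $ Inr k)
    | Inr k \<Rightarrow> v $ Inl k * w $ Inr k + v $ Inr k * w $ Inl k)" for v w
  proof -
    let ?T = "\<lambda>v k. (v $ Inl k) *\<^sub>R U k + (v $ Inr k) *\<^sub>R F k"
    have z: "?T v k \<star> ?T w l = 0" if "k \<noteq> l" for k l
    proof -
      \<comment> \<open>\<open>F l\<close> is absorbed by \<open>U l\<close>, so orthogonality of
        the idempotents extends to the generators.\<close>
      have UkFl: "U k \<star> F l = 0" if "k \<noteq> l" for k l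
      proof -
        have "U k \<star> (U l \<star> F l) = (U k \<star> U l) \<star> F l" by (simp add: assoc)
        then show ?thesis using orth[OF that] UF by (simp add: mu_simps)
      qed
      have "F k \<star> F l = F k \<star> (U k \<star> F l)"
        using FU[of k] assoc[of "F k" "U k" "F l"] by simp
      then have "F k \<star> F l = 0" using UkFl[OF that] by (simp add: mu_simps)
      then show ?thesis
        using orth[OF that] UkFl[OF that] UkFl[OF not_sym[OF that]] comm[of "F k" "U l"]
        by (simp add: mu_simps)
    qed
    have "\<Psi> v \<star> \<Psi> w = (\<Sum>k\<in>UNIV. \<Sum>l\<in>UNIV. ?T v k \<star> ?T w l)"
      unfolding \<Psi>_def by (simp only: mu_sum) (rule sum.swap)
    also have "\<dots> = (\<Sum>k\<in>UNIV. \<Sum>l\<in>UNIV. if l = k then ?T v k \<star> ?T w k else 0)"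
      by (intro sum.cong refl) (simp add: z)
    also have "\<dots> = (\<Sum>k\<in>UNIV. ?T v k \<star> ?T w k)" by simp
    also have "\<dots> = \<Psi> (\<chi> j. case j of
      Inl k \<Rightarrow> v $ Inl k * w $ Inl k - \<epsilon> k * (v $ Inr k * w $ Inr k)
    | Inr k \<Rightarrow> v $ Inl k * w $ Inr k + v $ Inr k * w $ Inl k)"
      unfolding \<Psi>_def
      by (intro sum.cong refl) (simp add: mu_simps UU UF FU FF algebra_simps)
    finally show ?thesis .
  qed
  have \<Phi>prod: "\<Phi> (a \<star> b) = (\<chi> j. case j of
      Inl k \<Rightarrow> \<Phi> a $ Inl k * \<Phi> b $ Inl k - \<epsilon> k * (\<Phi> a $ Inr k * \<Phi> b $ Inr k)
    | Inr k \<Rightarrow> \<Phi> a $ Inl k * \<Phi> b $ Inr k + \<Phi> a $ Inr k * \<Phi> b $ Inl k)" for a b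
    using arg_cong[OF prod[of "\<Phi> a" "\<Phi> b"], of \<Phi>] unfolding \<Psi>\<Phi> \<Phi>\<Psi> .
  have unitU: "e = (\<Sum>k\<in>UNIV. U k)"
  proof -
    let ?s = "\<Sum>k\<in>UNIV. U k"
    have s: "?s = \<Psi> (\<chi> j. case j of Inl k \<Rightarrow> 1 | Inr k \<Rightarrow> 0)" by (simp add: \<Psi>_def)
    have "?s \<star> \<Psi> v = \<Psi> v" for v
      unfolding s prod by (rule arg_cong[of _ _ \<Psi>]) (simp add: vec_eq_iff split: sum.split)
    from this[of "\<Phi> e"] have "?s \<star> e = e" unfolding \<Psi>\<Phi> .
    then show ?thesis by (simp add: unit')
  qed
  have "\<Phi> e = (\<chi> j. case j of Inl k \<Rightarrow> 1 | Inr k \<Rightarrow> 0)"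
  proof -
    have "e = \<Psi> (\<chi> j. case j of Inl k \<Rightarrow> 1 | Inr k \<Rightarrow> 0)" unfolding unitU by (simp add: \<Psi>_def)
    from arg_cong[OF this, of \<Phi>] show ?thesis unfolding \<Phi>\<Psi> .
  qed
  moreover have "t a = 2 * (\<Sum>k\<in>UNIV. \<Phi> a $ Inl k)" for a
  proof -
    have lM: "linear (\<lambda>x. \<Phi> (a \<star> x))" using linear_compose[OF linR lin\<Phi>] by (simp add: o_def)
    have "t a = tr (\<lambda>x. \<Psi> (\<Phi> (a \<star> x)))" by (simp add: t_def \<Psi>\<Phi>)
    \<comment> \<open>The trace is invariant under conjugation by \<open>\<Psi>\<close>, and in
      split coordinates it is read off from the diagonal.\<close>
    also have "\<dots> = tr (\<lambda>v. \<Phi> (a \<star> \<Psi> v))" by (rule tr_commute[OF lin lM])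
    also have "\<dots> = 2 * (\<Sum>k\<in>UNIV. \<Phi> a $ Inl k)"
      by (simp add: tr_alt sum_UNIV_Plus \<Phi>prod \<Phi>\<Psi> axis_def)
    finally show ?thesis .
  qed
  ultimately have "split_coordinates \<epsilon> \<Phi>"
    unfolding split_coordinates_def using eps lin\<Phi> bij\<Phi> by (simp add: \<Phi>prod)
  then show thesis by (rule that)
qed

end

section \<open>Immersions with a transversal field\<close>

text \<open>The bijection \<open>\<sigma>\<close> numbers the columns of the frame matrix.\<close>

locale transversal_immersion =
  fixes U :: "(real^'d) set" and g c :: "real^'d \<Rightarrow> real^'e" and \<sigma> :: "'e \<Rightarrow> 'd option"
  assumes U: "open U" and g: "smooth_on U g" and c: "smooth_on U c" and \<sigma>: "bij \<sigma>"
    and inj_dg: "y \<in> U \<Longrightarrow> inj (frechet_derivative g (at y))"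
    and transv: "y \<in> U \<Longrightarrow> c y \<notin> tangent_image g y"
begin

lemma inv_\<sigma> [simp]: "\<sigma> (inv \<sigma> a) = a" "inv \<sigma> (\<sigma> j) = j"
  using \<sigma> by (simp_all add: bij_is_surj surj_f_inv_f bij_is_inj inv_f_f)

abbreviation "\<rho> \<equiv> tangential g c"
abbreviation "\<pi> \<equiv> transversal g c"

lemma sm_g: "smooth_on U (\<lambda>y. dd v g y)"
  using smooth_on_dd[OF g] .

lemma sm_g2: "smooth_on U (\<lambda>y. dd u (\<lambda>x. dd v g x) y)"
  using smooth_on_dd[OF sm_g] .

lemma dg_linear: "y \<in> U \<Longrightarrow> linear (\<lambda>w. dd w g y)"
  by (rule linear_dd[OF smooth_on_differentiable[OF g]])

lemma decomposition_unique:
  assumes y: "y \<in> U" and eq: "dd w g y + s *\<^sub>R c y = dd w' g y + s' *\<^sub>R c y"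
  shows "w = w' \<and> s = s'"
proof -
  note l = dg_linear[OF y]
  have e: "dd (w - w') g y = (s' - s) *\<^sub>R c y"
    using eq by (simp add: linear_diff[OF l] algebra_simps)
  have s: "s' - s = 0"
  proof (rule ccontr)
    assume n: "s' - s \<noteq> 0"
    have "c y = dd ((1 / (s' - s)) *\<^sub>R (w - w')) g y" using n e by (simp add: linear_cmul[OF l])
    then show False using transv[OF y] by (auto simp: tangent_image_def)
  qed
  then have "dd w g y = dd w' g y" using e by (simp add: linear_diff[OF l])
  then show ?thesis using s injD[OF inj_dg[OF y]] by auto
qed

text \<open>Frame matrix: its columns are the images of the standard basis and the transversal
  vector, in the order of \<open>\<sigma>\<close>. With the order \<open>frame_column\<close> its
  determinant is \<open>Theta\<close> on the standard frame.\<close>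

definition P :: "real^'d \<Rightarrow> real^'e^'e" where
  "P y = (\<chi> i j. (case \<sigma> j of Some a \<Rightarrow> dd (axis a 1) g y | None \<Rightarrow> c y) $ i)"

lemma sum_\<sigma>: "(\<Sum>j\<in>UNIV. F (\<sigma> j)) = F None + (\<Sum>a\<in>UNIV. F (Some a))"
  for F :: "'d option \<Rightarrow> 'b::comm_monoid_add"
proof -
  have "(\<Sum>j\<in>UNIV. F (\<sigma> j)) = (\<Sum>a\<in>UNIV. F a)"
    by (rule sum.reindex_bij_betw[OF \<sigma>])
  then show ?thesis by (simp add: UNIV_option_conv sum.reindex)
qed

lemma P_mult: "y \<in> U \<Longrightarrow> P y *v x = dd (\<chi> a. x $ inv \<sigma> (Some a)) g y + (x $ inv \<sigma> None) *\<^sub>R c y"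
proof -
  assume y: "y \<in> U"
  have "(P y *v x) $ i = (\<Sum>j\<in>UNIV. (case \<sigma> j of Some a \<Rightarrow> dd (axis a 1) g y | None \<Rightarrow> c y) $ i * x $ inv \<sigma> (\<sigma> j))" for i
    by (simp add: P_def matrix_vector_mult_def)
  also have "\<dots> i = c y $ i * x $ inv \<sigma> None + (\<Sum>a\<in>UNIV. dd (axis a 1) g y $ i * x $ inv \<sigma> (Some a))" for i
    by (subst sum_\<sigma>) simp
  also have "\<dots> i = (dd (\<chi> a. x $ inv \<sigma> (Some a)) g y + (x $ inv \<sigma> None) *\<^sub>R c y) $ i" for i
    using linear_axis_expansion[OF dg_linear[OF y], of "\<chi> a. x $ inv \<sigma> (Some a)"]
    by (simp add: mult.commute)
  finally show ?thesis by (simp add: vec_eq_iff)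
qed

lemma det_P: assumes y: "y \<in> U" shows "det (P y) \<noteq> 0"
proof -
  have "inj ((*v) (P y))"
  proof (subst linear_injective_0[OF matrix_vector_mul_linear], safe)
    fix x assume "P y *v x = 0"
    then have "dd (\<chi> a. x $ inv \<sigma> (Some a)) g y + (x $ inv \<sigma> None) *\<^sub>R c y = dd 0 g y + 0 *\<^sub>R c y"
      by (simp add: P_mult[OF y] linear_0[OF dg_linear[OF y]])
    from decomposition_unique[OF y this] have "x $ inv \<sigma> a = 0" for a
      by (cases a) (auto simp: vec_eq_iff)
    then have "x $ j = 0" for j using inv_\<sigma>(2) by metis
    then show "x = 0" by (simp add: vec_eq_iff)
  qed
  then show ?thesis
    using matrix_left_invertible_injective[of "P y"] invertible_left_inverse[of "P y"] invertible_det_nz by blast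
qed

lemma decomposition_exists: assumes y: "y \<in> U" shows "\<exists>w s. v = dd w g y + s *\<^sub>R c y"
proof -
  obtain B where B: "P y ** B = mat 1"
    using det_P[OF y] invertible_det_nz[of "P y"] unfolding invertible_def by blast
  have "v = P y *v (B *v v)" by (simp add: matrix_vector_mul_assoc B)
  then show ?thesis using P_mult[OF y, of "B *v v"] by (simp only:) blast
qed

lemma components_eqI:
  assumes y: "y \<in> U" and v: "v = dd w g y + s *\<^sub>R c y"
  shows "\<rho> y v = w" "\<pi> y v = s"
proof -
  have u: "w' = w \<and> s' = s" if "v = dd w' g y + s' *\<^sub>R c y" for w' s'
    using decomposition_unique[OF y, of w' s' w s] that v by simp
  show "\<rho> y v = w" unfolding tangential_def using v u by (intro the_equality) blast+
  show "\<pi> y v = s" unfolding transversal_def using v u by (intro the_equality) blast+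
qed

lemma decomposition: assumes y: "y \<in> U" shows "v = dd (\<rho> y v) g y + \<pi> y v *\<^sub>R c y"
proof -
  obtain w s where v: "v = dd w g y + s *\<^sub>R c y" using decomposition_exists[OF y] by blast
  then show ?thesis unfolding components_eqI[OF y v] .
qed

lemma
  assumes y: "y \<in> U"
  shows \<rho>_linear: "linear (\<rho> y)" and \<pi>_linear: "linear (\<pi> y)"
proof -
  note l = dg_linear[OF y]
  have a: "v + w = dd (\<rho> y v + \<rho> y w) g y + (\<pi> y v + \<pi> y w) *\<^sub>R c y" for v w
    using arg_cong2[OF decomposition[OF y, of v] decomposition[OF y, of w], of "(+)"]
    by (simp add: linear_add[OF l] algebra_simps)
  have s: "r *\<^sub>R v = dd (r *\<^sub>R \<rho> y v) g y + (r * \<pi> y v) *\<^sub>R c y" for r v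
    using arg_cong[OF decomposition[OF y, of v], of "\<lambda>v. r *\<^sub>R v"]
    by (simp add: linear_cmul[OF l] algebra_simps)
  show "linear (\<rho> y)" by (intro linearI components_eqI[OF y a] components_eqI[OF y s])
  show "linear (\<pi> y)"
    by (intro linearI) (simp_all add: components_eqI[OF y a] components_eqI[OF y s])
qed

lemma components_simps [simp]:
  assumes y: "y \<in> U"
  shows "\<rho> y (dd w g y) = w" "\<pi> y (dd w g y) = 0" "\<rho> y (c y) = 0" "\<pi> y (c y) = 1"
  using components_eqI[OF y, of "dd w g y" w 0] components_eqI[OF y, of "c y" 0 1]
  by (simp_all add: linear_0[OF dg_linear[OF y]])

lemma tangent_iff: assumes y: "y \<in> U" shows "v \<in> tangent_image g y \<longleftrightarrow> \<pi> y v = 0"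
proof
  assume "v \<in> tangent_image g y"
  then show "\<pi> y v = 0" using y by (auto simp: tangent_image_def)
next
  assume "\<pi> y v = 0"
  then have "v = dd (\<rho> y v) g y" using decomposition[OF y, of v] by simp
  then show "v \<in> tangent_image g y" unfolding tangent_image_def by (metis rangeI)
qed

lemma sm_P: "smooth_on U (\<lambda>y. P y $ i $ j)"
  by (cases "\<sigma> j") (simp_all add: P_def smooth_on_nth[OF U] sm_g c)

lemma
  shows sm_\<rho>: "smooth_on U (\<lambda>y. \<rho> y v)" and sm_\<pi>: "smooth_on U (\<lambda>y. \<pi> y v)"
proof -
  define X where "X y = (\<chi> j. case \<sigma> j of Some a \<Rightarrow> \<rho> y v $ a | None \<Rightarrow> \<pi> y v)" for y
  have "P y *v X y = v" if y: "y \<in> U" for y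
    unfolding P_mult[OF y] using decomposition[OF y, of v] by (simp add: X_def)
  then have X: "smooth_on U X"
    by (intro smooth_on_solution[OF U, where M=P and b="\<lambda>_. v" and x=X] sm_P smooth_on_const det_P)
  have "(\<lambda>y. \<rho> y v) = (\<lambda>y. \<chi> a. X y $ inv \<sigma> (Some a))" "(\<lambda>y. \<pi> y v) = (\<lambda>y. X y $ inv \<sigma> None)"
    by (simp_all add: X_def vec_eq_iff)
  then show "smooth_on U (\<lambda>y. \<rho> y v)" "smooth_on U (\<lambda>y. \<pi> y v)"
    using smooth_on_vec[OF U smooth_on_nth[OF U X]] smooth_on_nth[OF U X] by simp_all
qed

lemmas sm_\<rho>' = smooth_on_linear_family[OF U \<rho>_linear sm_\<rho>]
lemmas sm_\<pi>' = smooth_on_linear_family[OF U \<pi>_linear sm_\<pi>]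
lemmas dd_\<pi> = dd_linear_family[OF U \<pi>_linear sm_\<pi>]

section \<open>Second derivatives and the affine metric\<close>

definition d2 :: "real^'d \<Rightarrow> real^'d \<Rightarrow> real^'d \<Rightarrow> real^'e" where
  "d2 y u v = dd u (\<lambda>x. dd v g x) y"

definition h :: "real^'d \<Rightarrow> real^'d \<Rightarrow> real^'d \<Rightarrow> real" where
  "h y u v = \<pi> y (d2 y u v)"

lemma h_form_eq: "h_form g c = h"
  by (simp add: fun_eq_iff h_form_def h_def d2_def D_def push_def[abs_def])

lemma sm_d2: "smooth_on U (\<lambda>y. d2 y u v)"
  unfolding d2_def by (rule sm_g2)

lemma d2_sym: "y \<in> U \<Longrightarrow> d2 y u v = d2 y v u"
  unfolding d2_def by (rule dd_commute[OF U _ g])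

lemma d2_linear: assumes y: "y \<in> U" shows "linear (\<lambda>u. d2 y u v)"
  unfolding d2_def by (rule linear_dd[OF smooth_on_differentiable[OF sm_g y]])

lemma d2_bilinear: assumes y: "y \<in> U" shows "bilinear (d2 y)"
  using d2_linear[OF y] d2_linear[OF y, of "_"] d2_sym[OF y] unfolding bilinear_def
  by (metis (no_types, lifting) ext)

lemma h_bilinear: assumes y: "y \<in> U" shows "bilinear (h y)"
  using d2_bilinear[OF y] linear_compose[OF _ \<pi>_linear[OF y]]
  unfolding bilinear_def h_def o_def by blast

lemma h_sym: "y \<in> U \<Longrightarrow> h y u v = h y v u"
  by (simp add: h_def d2_sym[of y u v])

lemma sm_h: "smooth_on U (\<lambda>y. h y u v)"
  unfolding h_def by (rule sm_\<pi>'[OF _ sm_d2])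

lemma dd_dg:
  assumes y: "y \<in> U" and a: "smooth_on U a"
  shows "dd u (\<lambda>x. dd (a x) g x) y = d2 y u (a y) + dd (dd u a y) g y"
  unfolding d2_def by (rule dd_linear_family[OF U dg_linear sm_g a y])

lemma sm_dg: "smooth_on U a \<Longrightarrow> smooth_on U (\<lambda>x. dd (a x) g x)"
  by (rule smooth_on_linear_family[OF U dg_linear sm_g])

text \<open>The projection varies with the point: at \<open>x\<close> it annihilates
  \<open>dd v g x\<close>, and differentiating this relation moves the derivative from the tangent
  vector to the projection.\<close>

lemma dd_\<pi>_tangent:
  assumes y: "y \<in> U" shows "dd w (\<lambda>x. \<pi> x (dd v g y)) y = - h y w v"
proof -
  have "dd w (\<lambda>x. \<pi> x (dd v g x)) y = dd w (\<lambda>x. \<pi> x (dd v g y)) y + h y w v"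
    unfolding h_def d2_def by (rule dd_\<pi>[OF _ sm_g y])
  moreover have "dd w (\<lambda>x. \<pi> x (dd v g x)) y = 0"
    using dd_cong[OF U y, of "\<lambda>x. \<pi> x (dd v g x)" "\<lambda>x. 0"] by simp
  ultimately show ?thesis by simp
qed

end

text \<open>Polarizing \<open>sec\<close> in the middle pair gives, with the Bianchi identity,
  \<open>R u v w u = 0\<close>; polarizing in the outer pair gives skewness in the first and last
  argument. Together with the other skew symmetries this makes the three terms of the Bianchi
  identity equal.\<close>

lemma curvature_tensor_zero:
  fixes R :: "'a::real_vector \<Rightarrow> 'a \<Rightarrow> 'a \<Rightarrow> 'a \<Rightarrow> real"
  assumes l2: "\<And>u v v' w z. R u (v + v') w z = R u v w z + R u v' w z"
    and l3: "\<And>u v w w' z. R u v (w + w') z = R u v w z + R u v w' z"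
    and l1: "\<And>u u' v w z. R (u + u') v w z = R u v w z + R u' v w z"
    and l4: "\<And>u v w z z'. R u v w (z + z') = R u v w z + R u v w z'"
    and a12: "\<And>u v w z. R u v w z = - R v u w z" and a34: "\<And>u v w z. R u v w z = - R u v z w"
    and bianchi: "\<And>u v w z. R u v w z + R v w u z + R w u v z = 0"
    and sec: "\<And>u v. R u v v u = 0"
  shows "R u v w z = 0"
proof -
  have s: "R u v w u = 0" for u v w
  proof -
    have "R u v w u + R u w v u = 0" using sec[of u "v + w"] sec[of u v] sec[of u w] by (simp add: l2 l3)
    moreover have "R u v w u = R u w v u"
      using bianchi[of u v w u] a34[of v w u u] a12[of w u v u] by simp
    ultimately show ?thesis by simp
  qed
  have a14: "R u v w z = - R z v w u" for u v w z
    using s[of "u + z" v w] s[of u v w] s[of z v w] by (simp add: l1 l4)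
  have cyc: "R v w u z = R u v w z" for u v w z
  proof -
    have "R v w u z = - R w v u z" by (rule a12)
    also have "\<dots> = R z v u w" using a14[of w v u z] by simp
    also have "\<dots> = - R z v w u" by (rule a34)
    also have "\<dots> = R u v w z" using a14[of u v w z] by simp
    finally show ?thesis .
  qed
  show ?thesis using bianchi[of u v w z] cyc[of v w u z] cyc[of u v w z] by simp
qed

text \<open>Some \<open>u\<close> has \<open>b u u \<noteq> 0\<close> by polarization. If every
  plane through \<open>u\<close> were degenerate, polarization would give
  \<open>b u u * b v w = b u v * b u w\<close>, so a nonzero \<open>v\<close> orthogonal to
  \<open>u\<close>, which exists by dimension, would be orthogonal to everything.\<close>

lemma nondegenerate_plane_exists:
  fixes b :: "real^'d \<Rightarrow> real^'d \<Rightarrow> real"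
  assumes b: "bilinear b" and sym: "\<And>u v. b u v = b v u"
    and nondeg: "\<And>u. (\<And>v. b u v = 0) \<Longrightarrow> u = 0" and card: "CARD('d) \<ge> 2"
  obtains u v where "b u u * b v v - (b u v)\<^sup>2 \<noteq> 0"
proof -
  have l1: "linear (b u)" and l2: "linear (\<lambda>u. b u v)" for u v using b by (auto simp: bilinear_def)
  note b_add = linear_add[OF l1] linear_add[OF l2]
  have "\<exists>u. b u u \<noteq> 0"
  proof (rule ccontr)
    assume "\<nexists>u. b u u \<noteq> 0"
    then have z: "b u u = 0" for u by blast
    have "b u v = 0" for u v
      using z[of "u + v"] z[of u] z[of v] sym[of u v] by (simp add: b_add)
    then have "u = 0" for u :: "real^'d" using nondeg by blast
    then have "axis undefined 1 = (0 :: real^'d)" .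
    then show False by simp
  qed
  then obtain u where u: "b u u \<noteq> 0" by blast
  have "\<exists>v. b u u * b v v - (b u v)\<^sup>2 \<noteq> 0"
  proof (rule ccontr)
    assume "\<nexists>v. b u u * b v v - (b u v)\<^sup>2 \<noteq> 0"
    then have d: "b u u * b v v = (b u v)\<^sup>2" for v by (metis eq_iff_diff_eq_0)
    have p: "b u u * b v w = b u v * b u w" for v w
      using d[of "v + w"] d[of v] d[of w] sym[of w v]
      by (simp add: b_add power2_eq_square algebra_simps)
    have "\<not> inj (b u)"
    proof
      assume "inj (b u)"
      then have "dim (range (b u)) = dim (UNIV :: (real^'d) set)"
        using dim_image_eq[OF l1[of u], of UNIV] by simp
      moreover have "dim (range (b u)) \<le> DIM(real)" by (rule dim_subset_UNIV)
      ultimately show False using card by simp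
    qed
    then obtain v where v: "v \<noteq> 0" "b u v = 0" using linear_injective_0[OF l1] by blast
    have "b v w = 0" for w using p[of v w] v u by simp
    then show False using nondeg v by blast
  qed
  then show thesis using that by blast
qed

text \<open>Here \<open>'a\<close> indexes chart coordinates and \<open>'b\<close> ambient ones.
  \<open>vol\<close> is the equality of the two volume forms on the standard basis; the fourth power
  removes the square root, the absolute value and the orientation sign.\<close>

locale flat_hypersphere_chart = transversal_immersion +
  fixes l :: real
  assumes l: "l \<noteq> 0" and shape: "y \<in> U \<Longrightarrow> dd u c y = - l *\<^sub>R dd u g y"
    and card_d: "CARD('a) \<ge> 2"
    and nondeg: "y \<in> U \<Longrightarrow> (\<And>v. h y u v = 0) \<Longrightarrow> u = 0"
    and flat: "y \<in> U \<Longrightarrow> plane_discriminant h y u v \<noteq> 0 \<Longrightarrow> sectional_curvature h y u v = 0"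
    and vol: "y \<in> U \<Longrightarrow> det (P y) ^ 4 = (det (\<chi> i j. h y (axis i 1) (axis j 1))) ^ 2"
begin

lemma hR: "y \<in> U \<Longrightarrow> linear (h y u)" and hL: "y \<in> U \<Longrightarrow> linear (\<lambda>u. h y u v)"
  using h_bilinear[of y] by (auto simp: bilinear_def)

definition hm :: "real^'a \<Rightarrow> real^'a^'a" where
  "hm y = (\<chi> i j. h y (axis i 1) (axis j 1))"

lemma hm_mult: "y \<in> U \<Longrightarrow> (hm y *v w) $ i = h y w (axis i 1)"
  using linear_axis_expansion[OF hR[of y "axis i 1"], of w]
  by (simp add: hm_def matrix_vector_mult_def mult.commute h_sym[of y w])

lemma h_determined:
  assumes y: "y \<in> U" and "\<And>i. h y a (axis i 1) = h y b (axis i 1)" shows "a = b"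
proof -
  have "h y (a - b) v = 0" for v
    using linear_axis_expansion[OF hR[OF y], of "a - b" v] assms(2)
    by (simp add: linear_diff[OF hL[OF y]])
  then have "a - b = 0" by (rule nondeg[OF y])
  then show ?thesis by simp
qed

lemma h_eqI: assumes y: "y \<in> U" and "\<And>z. h y a z = h y b z" shows "a = b"
  using h_determined[OF y] assms(2) by blast

lemma hm_invertible: assumes y: "y \<in> U" shows "invertible (hm y)"
proof -
  have "inj ((*v) (hm y))"
  proof (subst linear_injective_0[OF matrix_vector_mul_linear], safe)
    fix x assume x: "hm y *v x = 0"
    have "h y x (axis i 1) = h y 0 (axis i 1)" for i
      using hm_mult[OF y, of x i] x by (simp add: linear_0[OF hL[OF y]])
    then show "x = 0" by (rule h_determined[OF y])
  qed
  then show ?thesis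
    using matrix_left_invertible_injective[of "hm y"] invertible_left_inverse[of "hm y"] by blast
qed

section \<open>The Levi-Civita connection and its curvature\<close>

definition kos :: "real^'a \<Rightarrow> real^'a \<Rightarrow> real^'a \<Rightarrow> real^'a \<Rightarrow> real" where
  "kos y u v z = dd u (\<lambda>p. h p v z) y + dd v (\<lambda>p. h p u z) y - dd z (\<lambda>p. h p u v) y"

lemma dd_h_linear:
  assumes y: "y \<in> U"
  shows "linear (\<lambda>u. dd u (\<lambda>p. h p v z) y)" "linear (\<lambda>v. dd u (\<lambda>p. h p v z) y)" "linear (\<lambda>z. dd u (\<lambda>p. h p v z) y)"
proof -
  note d = smooth_on_differentiable[OF sm_h y]
  show "linear (\<lambda>u. dd u (\<lambda>p. h p v z) y)" by (rule linear_dd[OF d])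
  show "linear (\<lambda>v. dd u (\<lambda>p. h p v z) y)"
  proof (rule linearI)
    show "dd u (\<lambda>p. h p (a + b) z) y = dd u (\<lambda>p. h p a z) y + dd u (\<lambda>p. h p b z) y" for a b
      by (subst dd_add[OF d d, symmetric]) (rule dd_cong[OF U y], simp add: linear_add[OF hL])
    show "dd u (\<lambda>p. h p (r *\<^sub>R a) z) y = r *\<^sub>R dd u (\<lambda>p. h p a z) y" for r a
      by (subst dd_bounded_linear[OF bounded_linear_scaleR_right d, symmetric])
        (rule dd_cong[OF U y], simp add: linear_cmul[OF hL])
  qed
  show "linear (\<lambda>z. dd u (\<lambda>p. h p v z) y)"
  proof (rule linearI)
    show "dd u (\<lambda>p. h p v (a + b)) y = dd u (\<lambda>p. h p v a) y + dd u (\<lambda>p. h p v b) y" for a b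
      by (subst dd_add[OF d d, symmetric]) (rule dd_cong[OF U y], simp add: linear_add[OF hR])
    show "dd u (\<lambda>p. h p v (r *\<^sub>R a)) y = r *\<^sub>R dd u (\<lambda>p. h p v a) y" for r a
      by (subst dd_bounded_linear[OF bounded_linear_scaleR_right d, symmetric])
        (rule dd_cong[OF U y], simp add: linear_cmul[OF hR])
  qed
qed

lemma kos_linear: assumes y: "y \<in> U" shows "linear (\<lambda>u. kos y u v z)" "linear (\<lambda>v. kos y u v z)" "linear (kos y u v)"
  unfolding kos_def by (auto intro!: linear_compose_add linear_compose_sub dd_h_linear[OF y])

lemma dd_h_sym: "y \<in> U \<Longrightarrow> dd u (\<lambda>p. h p v z) y = dd u (\<lambda>p. h p z v) y"
  by (rule dd_cong[OF U]) (auto intro: h_sym)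

definition \<Gamma> :: "real^'a \<Rightarrow> real^'a \<Rightarrow> real^'a \<Rightarrow> real^'a" where
  "\<Gamma> = christoffel h"

lemma \<Gamma>_eqI:
  assumes y: "y \<in> U" and w: "\<And>z. 2 * h y w z = kos y u v z"
  shows "\<Gamma> y u v = w"
  unfolding \<Gamma>_def christoffel_def D_def
proof (rule the_equality)
  show "\<forall>z. 2 * h y w z = dd u (\<lambda>p. h p v z) y + dd v (\<lambda>p. h p u z) y - dd z (\<lambda>p. h p u v) y"
    using w by (simp add: kos_def)
  fix w' assume "\<forall>z. 2 * h y w' z = dd u (\<lambda>p. h p v z) y + dd v (\<lambda>p. h p u z) y - dd z (\<lambda>p. h p u v) y"
  then have "2 * h y w' z = 2 * h y w z" for z unfolding w[of z] kos_def by blast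
  then have "h y w' z = h y w z" for z by simp
  then show "w' = w" by (rule h_eqI[OF y])
qed

lemma koszul: assumes y: "y \<in> U" shows "2 * h y (\<Gamma> y u v) z = kos y u v z"
proof -
  obtain B where B: "hm y ** B = mat 1" using hm_invertible[OF y] unfolding invertible_def by blast
  define w where "w = B *v (\<chi> i. kos y u v (axis i 1) / 2)"
  have "hm y *v w = (\<chi> i. kos y u v (axis i 1) / 2)"
    by (simp add: w_def matrix_vector_mul_assoc B)
  then have i: "h y w (axis i 1) = kos y u v (axis i 1) / 2" for i
    using hm_mult[OF y, of w i] by simp
  have w: "2 * h y w z = kos y u v z" for z
    using linear_axis_expansion[OF hR[OF y], of w z] linear_axis_expansion[OF kos_linear(3)[OF y], of u v z]
    by (simp add: i sum_distrib_left)
  then show ?thesis using \<Gamma>_eqI[OF y w] by simp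
qed

lemma sm_\<Gamma>: "smooth_on U (\<lambda>y. \<Gamma> y u v)"
proof -
  have "smooth_on U (\<lambda>y. kos y u v z)" for z
    unfolding kos_def by (intro smooth_on_add[OF U] smooth_on_diff[OF U] smooth_on_dd sm_h)
  then have "smooth_on U (\<lambda>y. \<chi> i. (1/2) * kos y u v (axis i 1))"
    by (intro smooth_on_vec[OF U] smooth_on_mult[OF U] smooth_on_const)
  moreover have "hm y *v \<Gamma> y u v = (\<chi> i. (1/2) * kos y u v (axis i 1))" if "y \<in> U" for y
    by (simp add: vec_eq_iff hm_mult[OF that] flip: koszul[OF that])
  moreover have "smooth_on U (\<lambda>y. hm y $ i $ j)" for i j by (simp add: hm_def sm_h)
  ultimately show ?thesis
    by (intro smooth_on_solution[OF U, where M=hm and x="\<lambda>y. \<Gamma> y u v"])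
      (auto simp: invertible_det_nz[symmetric] hm_invertible)
qed

lemma \<Gamma>_sym: assumes y: "y \<in> U" shows "\<Gamma> y u v = \<Gamma> y v u"
proof (rule \<Gamma>_eqI[OF y])
  show "2 * h y (\<Gamma> y v u) z = kos y u v z" for z
    using koszul[OF y, of v u z] dd_h_sym[OF y, where u=z and v=u and z=v] by (simp add: kos_def)
qed

lemma \<Gamma>L: assumes y: "y \<in> U" shows "linear (\<lambda>u. \<Gamma> y u v)"
proof (rule linearI)
  show "\<Gamma> y (a + b) v = \<Gamma> y a v + \<Gamma> y b v" for a b
    by (rule \<Gamma>_eqI[OF y])
      (simp add: linear_add[OF hL[OF y]] linear_add[OF kos_linear(1)[OF y]] koszul[OF y] distrib_left)
  show "\<Gamma> y (r *\<^sub>R a) v = r *\<^sub>R \<Gamma> y a v" for r a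
  proof (rule \<Gamma>_eqI[OF y])
    show "2 * h y (r *\<^sub>R \<Gamma> y a v) z = kos y (r *\<^sub>R a) v z" for z
      using koszul[OF y, of a v z] by (simp add: linear_cmul[OF hL[OF y]] linear_cmul[OF kos_linear(1)[OF y]])
  qed
qed

lemma \<Gamma>R: assumes y: "y \<in> U" shows "linear (\<Gamma> y u)"
proof -
  have "\<Gamma> y u = (\<lambda>v. \<Gamma> y v u)" by (rule ext) (rule \<Gamma>_sym[OF y])
  then show ?thesis using \<Gamma>L[OF y] by simp
qed

lemma metric_compat:
  assumes y: "y \<in> U"
  shows "dd z (\<lambda>p. h p u v) y = h y (\<Gamma> y z u) v + h y u (\<Gamma> y z v)"
  using koszul[OF y, of z u v] koszul[OF y, of z v u] dd_h_sym[OF y, where u=z and v=u and z=v]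
    dd_h_sym[OF y, where u=v and v=z and z=u] dd_h_sym[OF y, where u=u and v=v and z=z]
    h_sym[OF y, of u "\<Gamma> y z v"]
  by (simp add: kos_def)

lemma sm_h': "smooth_on U a \<Longrightarrow> smooth_on U b \<Longrightarrow> smooth_on U (\<lambda>y. h y (a y) (b y))"
  by (rule smooth_on_bilinear_family[OF U h_bilinear sm_h])

lemma dd_h:
  assumes y: "y \<in> U" and a: "smooth_on U a" and b: "smooth_on U b"
  shows "dd w (\<lambda>x. h x (a x) (b x)) y =
    h y (\<Gamma> y w (a y) + dd w a y) (b y) + h y (a y) (\<Gamma> y w (b y) + dd w b y)"
  using dd_bilinear_family[OF U h_bilinear sm_h a b y, of w] metric_compat[OF y, where z=w and u="a y" and v="b y"]
  by (simp add: linear_add[OF hL[OF y]] linear_add[OF hR[OF y]])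

text \<open>\<open>N y w a\<close> is the covariant derivative along \<open>w\<close> of a vector field \<open>a\<close>.\<close>

definition N :: "real^'a \<Rightarrow> real^'a \<Rightarrow> (real^'a \<Rightarrow> real^'a) \<Rightarrow> real^'a" where
  "N y w a = dd w a y + \<Gamma> y w (a y)"

text \<open>The curvature on constant fields, whose bracket is zero.\<close>

definition R :: "real^'a \<Rightarrow> real^'a \<Rightarrow> real^'a \<Rightarrow> real^'a \<Rightarrow> real^'a" where
  "R y u v w = N y u (\<lambda>x. \<Gamma> x v w) - N y v (\<lambda>x. \<Gamma> x u w)"

lemma riemann_eq:
  assumes y: "y \<in> U"
  shows "riemann_curvature h (\<lambda>_. u) (\<lambda>_. v) (\<lambda>_. w) y = R y u v w"
proof -
  have "\<Gamma> y 0 w = 0" using linear_0[OF \<Gamma>L[OF y]] .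
  moreover have "levi_civita h (\<lambda>_. a) (\<lambda>_. b) = (\<lambda>x. \<Gamma> x a b)" for a b
    by (simp add: fun_eq_iff levi_civita_def D_def \<Gamma>_def)
  ultimately show ?thesis
    by (simp add: riemann_curvature_def) (simp add: levi_civita_def lie_bracket_def D_def R_def N_def flip: \<Gamma>_def)
qed

lemma dd_\<Gamma>_linear:
  assumes y: "y \<in> U"
  shows "linear (\<lambda>u. dd u (\<lambda>x. \<Gamma> x v w) y)" "linear (\<lambda>v. dd u (\<lambda>x. \<Gamma> x v w) y)"
    "linear (\<lambda>w. dd u (\<lambda>x. \<Gamma> x v w) y)"
proof -
  note d = smooth_on_differentiable[OF sm_\<Gamma> y]
  show "linear (\<lambda>u. dd u (\<lambda>x. \<Gamma> x v w) y)" by (rule linear_dd[OF d])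
  show "linear (\<lambda>v. dd u (\<lambda>x. \<Gamma> x v w) y)"
  proof (rule linearI)
    show "dd u (\<lambda>p. \<Gamma> p (a + b) w) y = dd u (\<lambda>p. \<Gamma> p a w) y + dd u (\<lambda>p. \<Gamma> p b w) y" for a b
      by (subst dd_add[OF d d, symmetric]) (rule dd_cong[OF U y], simp add: linear_add[OF \<Gamma>L])
    show "dd u (\<lambda>p. \<Gamma> p (r *\<^sub>R a) w) y = r *\<^sub>R dd u (\<lambda>p. \<Gamma> p a w) y" for r a
      by (subst dd_bounded_linear[OF bounded_linear_scaleR_right d, symmetric])
        (rule dd_cong[OF U y], simp add: linear_cmul[OF \<Gamma>L])
  qed
  show "linear (\<lambda>w. dd u (\<lambda>x. \<Gamma> x v w) y)"
  proof (rule linearI)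
    show "dd u (\<lambda>p. \<Gamma> p v (a + b)) y = dd u (\<lambda>p. \<Gamma> p v a) y + dd u (\<lambda>p. \<Gamma> p v b) y" for a b
      by (subst dd_add[OF d d, symmetric]) (rule dd_cong[OF U y], simp add: linear_add[OF \<Gamma>R])
    show "dd u (\<lambda>p. \<Gamma> p v (r *\<^sub>R a)) y = r *\<^sub>R dd u (\<lambda>p. \<Gamma> p v a) y" for r a
      by (subst dd_bounded_linear[OF bounded_linear_scaleR_right d, symmetric])
        (rule dd_cong[OF U y], simp add: linear_cmul[OF \<Gamma>R])
  qed
qed

lemmas \<Gamma>_simps = linear_add[OF \<Gamma>L] linear_add[OF \<Gamma>R] linear_cmul[OF \<Gamma>L] linear_cmul[OF \<Gamma>R]
lemmas h_simps = linear_add[OF hL] linear_add[OF hR] linear_cmul[OF hL] linear_cmul[OF hR]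
  linear_diff[OF hL] linear_diff[OF hR] linear_neg[OF hL] linear_neg[OF hR]
lemmas dd_\<Gamma>_simps =
  linear_add[OF dd_\<Gamma>_linear(1)] linear_add[OF dd_\<Gamma>_linear(2)] linear_add[OF dd_\<Gamma>_linear(3)]
  linear_cmul[OF dd_\<Gamma>_linear(1)] linear_cmul[OF dd_\<Gamma>_linear(2)] linear_cmul[OF dd_\<Gamma>_linear(3)]

lemma R_simps:
  assumes y: "y \<in> U"
  shows "R y (u + u') v w = R y u v w + R y u' v w" "R y u (v + v') w = R y u v w + R y u v' w"
    "R y u v (w + w') = R y u v w + R y u v w'"
    "R y (r *\<^sub>R u) v w = r *\<^sub>R R y u v w" "R y u (r *\<^sub>R v) w = r *\<^sub>R R y u v w"
    "R y u v (r *\<^sub>R w) = r *\<^sub>R R y u v w"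
  by (simp_all add: R_def N_def \<Gamma>_simps[OF y] dd_\<Gamma>_simps[OF y] algebra_simps)

lemma R_antisym: "R y u v w = - R y v u w"
  by (simp add: R_def)

lemma R_bianchi: assumes y: "y \<in> U" shows "R y u v w + R y v w u + R y w u v = 0"
proof -
  have "N y u (\<lambda>x. \<Gamma> x v w) = N y u (\<lambda>x. \<Gamma> x w v)" for u v w
    unfolding N_def using \<Gamma>_sym[OF y, of v w] dd_cong[OF U y, of "\<lambda>x. \<Gamma> x v w" "\<lambda>x. \<Gamma> x w v"] \<Gamma>_sym
    by (metis (no_types, lifting))
  note this[of u w v] this[of v w u] this[of w u v]
  then show ?thesis unfolding R_def by simp
qed

text \<open>Both mixed second derivatives of \<open>h w z\<close> are expanded by metric
  compatibility. The products of two first covariant derivatives occur in both orders and cancel;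
  what remains is the skewness.\<close>

lemma R_skew: assumes y: "y \<in> U" shows "h y (R y u v w) z = - h y (R y u v z) w"
proof -
  have dd2: "dd u (\<lambda>p. dd v (\<lambda>x. h x w z) p) y =
     h y (N y u (\<lambda>x. \<Gamma> x v w)) z + h y (\<Gamma> y v w) (\<Gamma> y u z)
      + (h y (\<Gamma> y u w) (\<Gamma> y v z) + h y w (N y u (\<lambda>x. \<Gamma> x v z)))" for u v
  proof -
    have "dd u (\<lambda>p. dd v (\<lambda>x. h x w z) p) y = dd u (\<lambda>p. h p (\<Gamma> p v w) z + h p w (\<Gamma> p v z)) y"
      by (rule dd_cong[OF U y]) (rule metric_compat)
    also have "\<dots> = dd u (\<lambda>p. h p (\<Gamma> p v w) z) y + dd u (\<lambda>p. h p w (\<Gamma> p v z)) y"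
      by (intro dd_add smooth_on_differentiable[OF sm_h' y] sm_\<Gamma> smooth_on_const)
    finally show ?thesis
      using dd_h[OF y sm_\<Gamma>[of v w] smooth_on_const[of U z], where w=u]
        dd_h[OF y smooth_on_const[of U w] sm_\<Gamma>[of v z], where w=u]
      by (simp add: N_def add.commute)
  qed
  have "dd u (\<lambda>p. dd v (\<lambda>x. h x w z) p) y = dd v (\<lambda>p. dd u (\<lambda>x. h x w z) p) y"
    by (rule dd_commute_real[OF U y sm_h])
  then show ?thesis
    unfolding dd2 R_def using h_sym[OF y] by (simp add: h_simps[OF y])
qed

text \<open>Flatness speaks only of nondegenerate planes. A fixed nondegenerate plane
  \<open>u0\<close>, \<open>v0\<close> perturbs the given pair: the discriminant is a polynomial in
  \<open>s\<close> whose coefficient of \<open>s^4\<close> is the discriminant of that plane, so it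
  vanishes for finitely many \<open>s\<close> only, and continuity at \<open>0\<close> gives the
  claim.\<close>

lemma sectional_zero: assumes y: "y \<in> U" shows "h y (R y u v v) u = 0"
proof -
  have hs: "h y a b = h y b a" for a b by (rule h_sym[OF y])
  obtain u0 v0 where uv0: "h y u0 u0 * h y v0 v0 - (h y u0 v0)\<^sup>2 \<noteq> 0"
    using nondegenerate_plane_exists[OF h_bilinear[OF y] hs nondeg[OF y] card_d] by blast
  define f where "f s = h y (R y (u + s *\<^sub>R u0) (v + s *\<^sub>R v0) (v + s *\<^sub>R v0)) (u + s *\<^sub>R u0)" for s
  define q where "q = [:h y u u, 2 * h y u u0, h y u0 u0:] * [:h y v v, 2 * h y v v0, h y v0 v0:]
     - [:h y u v, h y u v0 + h y u0 v, h y u0 v0:]\<^sup>2"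
  have q: "poly q s = plane_discriminant h y (u + s *\<^sub>R u0) (v + s *\<^sub>R v0)" for s
    by (simp add: q_def plane_discriminant_def h_simps[OF y] hs[of u0 u] hs[of v0 v] algebra_simps power2_eq_square)
  have "coeff q 4 = h y u0 u0 * h y v0 v0 - (h y u0 v0)\<^sup>2"
    by (simp add: q_def power2_eq_square numeral_eq_Suc)
  then have "q \<noteq> 0" using uv0 by auto
  then have fin: "finite {s. poly q s = 0}" by (rule poly_roots_finite)
  have f0: "f s = 0" if "poly q s \<noteq> 0" for s
    using flat[OF y, of "u + s *\<^sub>R u0" "v + s *\<^sub>R v0"] that
    unfolding q sectional_curvature_def riemann_eq[OF y] f_def by simp
  have "isCont f 0"
    unfolding f_def R_simps[OF y] h_simps[OF y] by (intro continuous_intros)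
  then have "(f \<longlongrightarrow> f 0) (at 0)" by (simp add: isCont_def)
  moreover have "eventually (\<lambda>s. f s = 0) (at 0)"
  proof -
    have "finite ({s. poly q s = 0} - {0})" using fin by simp
    then have "open (- ({s. poly q s = 0} - {0}))" by (intro open_Compl finite_imp_closed)
    then have "eventually (\<lambda>s. s \<in> - ({s. poly q s = 0} - {0})) (at 0)"
      by (rule eventually_at_in_open') simp
    moreover have "eventually (\<lambda>s::real. s \<noteq> 0) (at 0)" by (rule eventually_neq_at_within)
    ultimately show ?thesis by eventually_elim (use f0 in auto)
  qed
  ultimately have "f 0 = 0"
    using tendsto_eventually[of f 0 "at 0"] tendsto_unique[of "at (0::real)" f] trivial_limit_at by blast
  then show ?thesis by (simp add: f_def)
qed

lemma R_zero: assumes y: "y \<in> U" shows "N y u (\<lambda>x. \<Gamma> x v w) = N y v (\<lambda>x. \<Gamma> x u w)"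
proof -
  have "h y (R y u v w) z = 0" for z
  proof (rule curvature_tensor_zero[of "\<lambda>u v w z. h y (R y u v w) z"])
    show "h y (R y u v w) z + h y (R y v w u) z + h y (R y w u v) z = 0" for u v w z
      using arg_cong[OF R_bianchi[OF y, of u v w], of "\<lambda>a. h y a z"]
      by (simp add: h_simps[OF y] linear_0[OF hL[OF y]])
    show "h y (R y u v w) z = - h y (R y v u w) z" for u v w z
      using R_antisym[of y u v w] by (simp add: h_simps[OF y])
    show "h y (R y u v w) z = - h y (R y u v z) w" for u v w z by (rule R_skew[OF y])
  qed (simp_all add: R_simps[OF y] h_simps[OF y] sectional_zero[OF y])
  then have "R y u v w = 0" by (rule nondeg[OF y])
  then show ?thesis by (simp add: R_def)
qed

end

lemma dd_power:
  fixes F :: "'a::real_normed_vector \<Rightarrow> real"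
  assumes "F differentiable (at y)"
  shows "dd w (\<lambda>x. F x ^ n) y = real n * F y ^ (n - 1) * dd w F y"
  by (rule dd_eqI) (use assms[unfolded frechet_derivative_works] in \<open>auto intro!: derivative_eq_intros\<close>)

context flat_hypersphere_chart
begin

section \<open>The algebra structure on the ambient space\<close>

text \<open>The position vector of the hypersphere relative to its centre.\<close>

definition G :: "real^'a \<Rightarrow> real^'b" where "G y = (- 1 / l) *\<^sub>R c y"

text \<open>The coefficient along \<open>G\<close>, since the transversal vector is
  \<open>- l\<close> times \<open>G\<close>.\<close>

definition p :: "real^'a \<Rightarrow> real^'b \<Rightarrow> real" where "p y v = - l * \<pi> y v"

definition H :: "real^'a \<Rightarrow> real^'a \<Rightarrow> real^'a \<Rightarrow> real^'b" where
  "H y u v = d2 y u v - dd (\<Gamma> y u v) g y"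

text \<open>The difference of the induced and the Levi-Civita connection, because
  \<open>\<rho> y (d2 y u v)\<close> is the induced derivative of constant fields.\<close>

definition K :: "real^'a \<Rightarrow> real^'a \<Rightarrow> real^'a \<Rightarrow> real^'a" where
  "K y u v = \<rho> y (H y u v)"

text \<open>The product with identity \<open>G\<close> that maps a pair of tangent vectors to the value \<open>H\<close> of the
  Hessian of the immersion with respect to the Levi-Civita connection.\<close>

definition mu :: "real^'a \<Rightarrow> real^'b \<Rightarrow> real^'b \<Rightarrow> real^'b" where
  "mu y a b = H y (\<rho> y a) (\<rho> y b) + p y a *\<^sub>R b + p y b *\<^sub>R a - (p y a * p y b) *\<^sub>R G y"

lemma c_eq: "c y = - l *\<^sub>R G y"
  using l by (simp add: G_def)

lemma sm_G: "smooth_on U G"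
  unfolding G_def using smooth_on_scaleR[OF U smooth_on_const c] .

lemma dd_G: assumes y: "y \<in> U" shows "dd w G y = dd w g y"
proof -
  have "dd w G y = (- 1 / l) *\<^sub>R dd w c y"
    unfolding G_def by (rule dd_bounded_linear[OF bounded_linear_scaleR_right smooth_on_differentiable[OF c y]])
  then show ?thesis using l by (simp add: shape[OF y])
qed

lemma p_linear: "y \<in> U \<Longrightarrow> linear (p y)"
  by (intro linearI) (simp_all add: p_def linear_add[OF \<pi>_linear] linear_cmul[OF \<pi>_linear] algebra_simps)

lemma sm_p: "smooth_on U (\<lambda>y. p y v)"
  unfolding p_def by (intro smooth_on_mult[OF U] smooth_on_const sm_\<pi>)

lemmas dd_p = dd_linear_family[OF U p_linear sm_p]

lemma G_components [simp]:
  assumes y: "y \<in> U" shows "\<rho> y (G y) = 0" "p y (G y) = 1" "p y (dd w g y) = 0"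
  using l y by (simp_all add: G_def p_def linear_cmul[OF \<rho>_linear[OF y]] linear_cmul[OF \<pi>_linear[OF y]]
      linear_neg[OF \<rho>_linear[OF y]] linear_neg[OF \<pi>_linear[OF y]])

lemma G_decomposition: "y \<in> U \<Longrightarrow> v = dd (\<rho> y v) g y + p y v *\<^sub>R G y"
  using decomposition[of y v] l by (simp add: p_def G_def)

lemma G_components_eqI:
  assumes y: "y \<in> U" and v: "v = dd w g y + s *\<^sub>R G y" shows "\<rho> y v = w" "p y v = s"
  unfolding v using y
  by (simp_all add: linear_add[OF \<rho>_linear] linear_cmul[OF \<rho>_linear] linear_add[OF p_linear] linear_cmul[OF p_linear])

lemma vector_eqI: "y \<in> U \<Longrightarrow> \<rho> y v = \<rho> y w \<Longrightarrow> p y v = p y w \<Longrightarrow> v = w"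
  using G_decomposition[of y v] G_decomposition[of y w] by simp

lemma sm_H: "smooth_on U (\<lambda>y. H y u v)"
  unfolding H_def by (intro smooth_on_diff[OF U] sm_d2 sm_dg sm_\<Gamma>)

lemma H_sym: "y \<in> U \<Longrightarrow> H y u v = H y v u"
  by (simp add: H_def d2_sym[of y u v] \<Gamma>_sym[of y u v])

lemma HL: assumes y: "y \<in> U" shows "linear (\<lambda>u. H y u v)"
  unfolding H_def using linear_compose[OF \<Gamma>L[OF y] dg_linear[OF y]] d2_linear[OF y]
  by (auto intro!: linear_compose_sub simp: o_def)

lemma HR: assumes y: "y \<in> U" shows "linear (H y u)"
proof -
  have "H y u = (\<lambda>v. H y v u)" by (rule ext) (rule H_sym[OF y])
  then show ?thesis using HL[OF y] by simp
qed

lemma H_bilinear: "y \<in> U \<Longrightarrow> bilinear (H y)"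
  using HL HR by (simp add: bilinear_def)

lemma \<pi>_H: "y \<in> U \<Longrightarrow> \<pi> y (H y u v) = h y u v"
  by (simp add: H_def h_def linear_diff[OF \<pi>_linear])

lemma H_eq: "y \<in> U \<Longrightarrow> H y u v = dd (K y u v) g y + h y u v *\<^sub>R c y"
  using decomposition[of y "H y u v"] by (simp add: K_def \<pi>_H)

lemma d2_eq: "y \<in> U \<Longrightarrow> d2 y u v = H y u v + dd (\<Gamma> y u v) g y"
  by (simp add: H_def)

lemma sm_K: "smooth_on U (\<lambda>y. K y u v)"
  unfolding K_def by (rule sm_\<rho>'[OF _ sm_H])

lemma K_sym: "y \<in> U \<Longrightarrow> K y u v = K y v u"
  by (simp add: K_def H_sym[of y u v])

lemma KL: "y \<in> U \<Longrightarrow> linear (\<lambda>u. K y u v)"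
  unfolding K_def using linear_compose[OF HL \<rho>_linear] by (simp add: o_def)

lemma KR: "y \<in> U \<Longrightarrow> linear (K y u)"
  unfolding K_def using linear_compose[OF HR \<rho>_linear] by (simp add: o_def)

lemmas HK_simps = linear_add[OF HL] linear_add[OF HR] linear_cmul[OF HL] linear_cmul[OF HR]
  linear_0[OF HL] linear_0[OF HR]
  linear_add[OF KL] linear_add[OF KR] linear_cmul[OF KL] linear_cmul[OF KR] linear_0[OF KL] linear_0[OF KR]

text \<open>\<open>T\<close> and \<open>V\<close> are the covariant derivatives of \<open>H\<close> and \<open>K\<close>.\<close>

definition T :: "real^'a \<Rightarrow> real^'a \<Rightarrow> real^'a \<Rightarrow> real^'a \<Rightarrow> real^'b" where
  "T y w u v = dd w (\<lambda>x. H x u v) y - H y (\<Gamma> y w u) v - H y u (\<Gamma> y w v)"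

definition V :: "real^'a \<Rightarrow> real^'a \<Rightarrow> real^'a \<Rightarrow> real^'a \<Rightarrow> real^'a" where
  "V y w u v = N y w (\<lambda>x. K x u v) - K y (\<Gamma> y w u) v - K y u (\<Gamma> y w v)"

text \<open>Ricci identity: the third derivatives of \<open>g\<close> commute, and the only other
  asymmetry is the curvature of the affine metric, mapped by the differential of \<open>g\<close>,
  which vanishes by \<open>R_zero\<close>.\<close>

lemma T_sym: assumes y: "y \<in> U" shows "T y w u v = T y u w v"
proof -
  have dH: "dd w (\<lambda>x. H x u v) y =
      dd w (\<lambda>x. dd u (\<lambda>x. dd v g x) x) y - H y w (\<Gamma> y u v) - dd (N y w (\<lambda>x. \<Gamma> x u v)) g y" for w u v
  proof -
    have "dd w (\<lambda>x. H x u v) y = dd w (\<lambda>x. d2 x u v) y - dd w (\<lambda>x. dd (\<Gamma> x u v) g x) y"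
      unfolding H_def
      by (intro dd_diff smooth_on_differentiable[OF _ y] sm_d2 sm_dg sm_\<Gamma>)
    then show ?thesis
      by (simp add: dd_dg[OF y sm_\<Gamma>] d2_eq[OF y, of w] N_def linear_add[OF dg_linear[OF y]])
        (simp add: d2_def)
  qed
  have "dd w (\<lambda>x. dd u (\<lambda>x. dd v g x) x) y = dd u (\<lambda>x. dd w (\<lambda>x. dd v g x) x) y"
    by (rule dd_commute[OF U y sm_g])
  then show ?thesis
    unfolding T_def dH R_zero[OF y, of w u v]
    using \<Gamma>_sym[OF y, of w u] H_sym[OF y, of w "\<Gamma> y u v"] H_sym[OF y, of u "\<Gamma> y w v"] H_sym[OF y, of "\<Gamma> y u w" v]
    by (simp add: algebra_simps)
qed

text \<open>The decomposition \<open>H_eq\<close> is differentiated. Parallelism of \<open>h\<close>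
  removes the derivative of the coefficient of \<open>c\<close>, and the derivative of
  \<open>c\<close> itself is \<open>- l\<close> times that of \<open>g\<close>.\<close>

lemma T_eq: assumes y: "y \<in> U"
  shows "T y w u v = dd (V y w u v) g y + H y w (K y u v) - (l * h y u v) *\<^sub>R dd w g y"
proof -
  note d = smooth_on_differentiable[OF _ y]
  have "dd w (\<lambda>x. H x u v) y = dd w (\<lambda>x. dd (K x u v) g x + h x u v *\<^sub>R c x) y"
    by (rule dd_cong[OF U y]) (rule H_eq)
  also have "\<dots> = dd w (\<lambda>x. dd (K x u v) g x) y + dd w (\<lambda>x. h x u v *\<^sub>R c x) y"
    by (intro dd_add d sm_dg sm_K smooth_on_scaleR[OF U] sm_h c)
  also have "dd w (\<lambda>x. h x u v *\<^sub>R c x) y = h y u v *\<^sub>R dd w c y + dd w (\<lambda>x. h x u v) y *\<^sub>R c y"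
    by (intro dd_bounded_bilinear[OF bounded_bilinear_scaleR] d sm_h c)
  finally have *: "dd w (\<lambda>x. H x u v) y = dd (N y w (\<lambda>x. K x u v)) g y + H y w (K y u v)
      - (l * h y u v) *\<^sub>R dd w g y + h y (\<Gamma> y w u) v *\<^sub>R c y + h y u (\<Gamma> y w v) *\<^sub>R c y"
    by (simp add: dd_dg[OF y sm_K] d2_eq[OF y, of w] N_def linear_add[OF dg_linear[OF y]] shape[OF y]
       metric_compat[OF y] algebra_simps)
  show ?thesis
    unfolding T_def * H_eq[OF y, of "\<Gamma> y w u" v] H_eq[OF y, of u "\<Gamma> y w v"] V_def
    by (simp add: linear_diff[OF dg_linear[OF y]] linear_add[OF dg_linear[OF y]] algebra_simps)
qed

text \<open>By \<open>T_eq\<close> the transversal component of \<open>T y w u v\<close> is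
  \<open>h y w (K y u v)\<close>, so the symmetry of \<open>T\<close> in \<open>w\<close> and
  \<open>u\<close> makes the cubic form of \<open>K\<close> totally symmetric.\<close>

lemma \<kappa>_sym: assumes y: "y \<in> U" shows "h y (K y u v) w = h y (K y w v) u"
proof -
  have "\<pi> y (T y w u v) = h y w (K y u v)" for w u
    by (simp add: T_eq[OF y] linear_add[OF \<pi>_linear[OF y]] linear_diff[OF \<pi>_linear[OF y]]
        linear_cmul[OF \<pi>_linear[OF y]] y \<pi>_H)
  then have "h y w (K y u v) = h y u (K y w v)" using T_sym[OF y, of w u v] by metis
  then show ?thesis using h_sym[OF y] by metis
qed

lemma \<kappa>_sym': "y \<in> U \<Longrightarrow> h y (K y u v) w = h y (K y u w) v"
  using \<kappa>_sym[of y v u w] K_sym[of y u v] K_sym[of y u w] by simp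

text \<open>Each \<open>K y u\<close> is self-adjoint for \<open>h\<close>; since \<open>h\<close>
  is parallel, this persists under covariant differentiation.\<close>

lemma V_skew: assumes y: "y \<in> U" shows "h y (V y w u v) z = h y (V y w u z) v"
proof -
  have *: "h y (V y w u v) z = dd w (\<lambda>x. h x (K x u v) z) y - h y (K y u v) (\<Gamma> y w z)
      - h y (K y (\<Gamma> y w u) v) z - h y (K y u (\<Gamma> y w v)) z" for v z
    using dd_h[OF y sm_K[of u v] smooth_on_const[of U z], where w=w]
    by (simp add: V_def N_def h_simps[OF y] add.commute)
  have "dd w (\<lambda>x. h x (K x u v) z) y = dd w (\<lambda>x. h x (K x u z) v) y"
    by (rule dd_cong[OF U y]) (rule \<kappa>_sym')
  then show ?thesis
    unfolding * using \<kappa>_sym'[OF y, of u v "\<Gamma> y w z"] \<kappa>_sym'[OF y, of u "\<Gamma> y w v" z]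
      \<kappa>_sym'[OF y, of "\<Gamma> y w u" v z]
    by simp
qed

text \<open>The difference \<open>E\<close> of the two sides is symmetric by the invariance of the cubic form and
  antisymmetric by the expression of the curvature in \<open>K\<close>.\<close>

lemma gauss_codazzi:
  assumes y: "y \<in> U"
  shows gauss: "K y w (K y u v) - (l * h y u v) *\<^sub>R w = K y u (K y w v) - (l * h y w v) *\<^sub>R u"
    and codazzi: "V y w u v = V y u w v"
proof -
  define A where "A w u v = K y w (K y u v) - (l * h y u v) *\<^sub>R w" for w u v
  have "\<rho> y (T y w u v) = V y w u v + A w u v" for w u v
    by (simp add: T_eq[OF y] linear_add[OF \<rho>_linear[OF y]] linear_diff[OF \<rho>_linear[OF y]]
        linear_cmul[OF \<rho>_linear[OF y]] y A_def flip: K_def)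
  then have VA: "V y w u v + A w u v = V y u w v + A u w v" for v using T_sym[OF y, of w u v] by metis
  define E where "E v = A w u v - A u w v" for v
  have EV: "E v = V y u w v - V y w u v" for v using VA[of v] by (simp add: E_def algebra_simps)
  have s: "h y (E v) z = h y (E z) v" for v z
    unfolding EV h_simps[OF y] V_skew[OF y, of _ _ v z] ..
  have hA: "h y (A w u v) z = h y (K y u v) (K y w z) - l * h y u v * h y w z" for w u v z
    using \<kappa>_sym'[OF y, of w "K y u v" z] h_sym[OF y, of "K y w z" "K y u v"]
    by (simp add: A_def h_simps[OF y])
  have a: "h y (E v) z = - h y (E z) v" for v z
    unfolding E_def h_simps[OF y] hA
    using h_sym[OF y, of "K y u v" "K y w z"] h_sym[OF y, of "K y w v" "K y u z"] by (simp add: algebra_simps)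
  have "h y (E v) z = 0" for z using s[of v z] a[of v z] by simp
  then have E0: "E v = 0" by (rule nondeg[OF y])
  then show "K y w (K y u v) - (l * h y u v) *\<^sub>R w = K y u (K y w v) - (l * h y w v) *\<^sub>R u"
    by (simp add: E_def A_def)
  show "V y w u v = V y u w v" using E0 EV[of v] by simp
qed

lemma V_sym: assumes y: "y \<in> U" shows "V y w u v = V y w v u"
proof -
  have "N y w (\<lambda>x. K x u v) = N y w (\<lambda>x. K x v u)"
    using dd_cong[OF U y, of "\<lambda>x. K x u v" "\<lambda>x. K x v u" w] K_sym[OF y, of u v] K_sym by (simp add: N_def)
  then show ?thesis
    using K_sym[OF y, of "\<Gamma> y w u" v] K_sym[OF y, of u "\<Gamma> y w v"] by (simp add: V_def)
qed

section \<open>The commutative algebra at a point\<close>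

lemma mu_tangent: "y \<in> U \<Longrightarrow> mu y (dd u g y) (dd v g y) = H y u v"
  by (simp add: mu_def)

lemma mu_comm: "y \<in> U \<Longrightarrow> mu y a b = mu y b a"
  by (simp add: mu_def H_sym[of y "\<rho> y a"] add.commute mult.commute)

lemma mu_G: "y \<in> U \<Longrightarrow> mu y (G y) b = b"
  by (simp add: mu_def HK_simps)

lemma mu_bilinear: assumes y: "y \<in> U" shows "bilinear (mu y)"
proof -
  note s = linear_add[OF \<rho>_linear[OF y]] linear_cmul[OF \<rho>_linear[OF y]] linear_add[OF p_linear[OF y]]
    linear_cmul[OF p_linear[OF y]]
  have r: "linear (mu y a)" for a
    by (rule linearI) (simp_all add: mu_def s HK_simps[OF y] algebra_simps)
  have "(\<lambda>a. mu y a b) = mu y b" for b by (rule ext) (rule mu_comm[OF y])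
  then show ?thesis using r by (simp add: bilinear_def)
qed

lemma muR: "y \<in> U \<Longrightarrow> linear (mu y a)" and muL: "y \<in> U \<Longrightarrow> linear (\<lambda>a. mu y a b)"
  using mu_bilinear[of y] by (auto simp: bilinear_def)

lemma mu_eq:
  assumes y: "y \<in> U"
  shows "mu y a b = dd (K y (\<rho> y a) (\<rho> y b) + p y a *\<^sub>R \<rho> y b + p y b *\<^sub>R \<rho> y a) g y
      + (- l * h y (\<rho> y a) (\<rho> y b) + p y a * p y b) *\<^sub>R G y"
proof -
  let ?b = "dd (\<rho> y b) g y + p y b *\<^sub>R G y" and ?a = "dd (\<rho> y a) g y + p y a *\<^sub>R G y"
  have "mu y a b = H y (\<rho> y a) (\<rho> y b) + p y a *\<^sub>R ?b + p y b *\<^sub>R ?a - (p y a * p y b) *\<^sub>R G y"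
    unfolding G_decomposition[OF y, of a, symmetric] G_decomposition[OF y, of b, symmetric] mu_def ..
  also have "H y (\<rho> y a) (\<rho> y b) = dd (K y (\<rho> y a) (\<rho> y b)) g y + h y (\<rho> y a) (\<rho> y b) *\<^sub>R (- l *\<^sub>R G y)"
    unfolding H_eq[OF y] c_eq[of y] ..
  finally have *: "mu y a b = dd (K y (\<rho> y a) (\<rho> y b)) g y + h y (\<rho> y a) (\<rho> y b) *\<^sub>R (- l *\<^sub>R G y)
    + p y a *\<^sub>R ?b + p y b *\<^sub>R ?a - (p y a * p y b) *\<^sub>R G y" .
  show ?thesis
    unfolding * linear_add[OF dg_linear[OF y]] linear_cmul[OF dg_linear[OF y]]
    by (simp only: scaleR_add_right scaleR_add_left scaleR_scaleR) (simp add: mult.commute)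
qed

lemma mu_components:
  assumes y: "y \<in> U"
  shows "\<rho> y (mu y a b) = K y (\<rho> y a) (\<rho> y b) + p y a *\<^sub>R \<rho> y b + p y b *\<^sub>R \<rho> y a"
    and "p y (mu y a b) = - l * h y (\<rho> y a) (\<rho> y b) + p y a * p y b"
  by (rule G_components_eqI[OF y mu_eq[OF y]])+

text \<open>The tangential component is the identity \<open>gauss\<close>, which is where flatness
  enters; the component along \<open>G\<close> is the total symmetry of the cubic form.\<close>

lemma mu_assoc: assumes y: "y \<in> U" shows "mu y (mu y a b) d = mu y a (mu y b d)"
proof (rule vector_eqI[OF y])
  let ?a = "\<rho> y a" and ?b = "\<rho> y b" and ?d = "\<rho> y d"
  have "K y (K y ?a ?b) ?d - (l * h y ?a ?b) *\<^sub>R ?d = K y ?a (K y ?b ?d) - (l * h y ?b ?d) *\<^sub>R ?a"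
    using gauss[OF y, of ?d ?a ?b] K_sym[OF y, of ?d "K y ?a ?b"] K_sym[OF y, of ?d ?b] h_sym[OF y, of ?d ?b]
    by simp
  then show "\<rho> y (mu y (mu y a b) d) = \<rho> y (mu y a (mu y b d))"
    by (simp add: mu_components[OF y] HK_simps[OF y] algebra_simps)
  show "p y (mu y (mu y a b) d) = p y (mu y a (mu y b d))"
    using \<kappa>_sym'[OF y, of ?b ?a ?d] K_sym[OF y, of ?a ?b] h_sym[OF y, of "K y ?b ?d" ?a]
    by (simp add: mu_components[OF y] h_simps[OF y] algebra_simps)
qed

lemma sm_mu: "smooth_on U (\<lambda>y. mu y a b)"
proof -
  have "smooth_on U (\<lambda>y. H y (\<rho> y a) (\<rho> y b))"
    by (rule smooth_on_bilinear_family[OF U H_bilinear sm_H sm_\<rho>[of a] sm_\<rho>[of b]])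
  moreover have "smooth_on U (\<lambda>y. p y a *\<^sub>R b)" "smooth_on U (\<lambda>y. p y b *\<^sub>R a)"
    by (rule smooth_on_scaleR[OF U sm_p smooth_on_const])+
  moreover have "smooth_on U (\<lambda>y. (p y a * p y b) *\<^sub>R G y)"
    by (rule smooth_on_scaleR[OF U smooth_on_mult[OF U sm_p sm_p] sm_G])
  ultimately show ?thesis unfolding mu_def
    by (rule smooth_on_diff[OF U smooth_on_add[OF U smooth_on_add[OF U]]])
qed

lemmas dd_mu' = dd_bilinear_family[OF U mu_bilinear sm_mu]

end

context flat_hypersphere_chart
begin

lemma G_tangent_cases:
  assumes y: "y \<in> U" and f: "linear f" "linear f'"
    and "f (G y) = f' (G y)" "\<And>u. f (dd u g y) = f' (dd u g y)"
  shows "f a = f' (a :: real^'b)"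
proof -
  have "f (dd (\<rho> y a) g y + p y a *\<^sub>R G y) = f' (dd (\<rho> y a) g y + p y a *\<^sub>R G y)"
    using assms(4,5) by (simp add: linear_add[OF f(1)] linear_add[OF f(2)] linear_cmul[OF f(1)] linear_cmul[OF f(2)])
  then show ?thesis unfolding G_decomposition[OF y, of a, symmetric] .
qed

section \<open>Apolarity and the trace form\<close>

definition trace\<Gamma> :: "real^'a \<Rightarrow> real^'a \<Rightarrow> real" where
  "trace\<Gamma> y u = (\<Sum>a\<in>UNIV. \<Gamma> y u (axis a 1) $ a)"

lemma dd_det_hm: assumes y: "y \<in> U" shows "dd u (\<lambda>x. det (hm x)) y = 2 * trace\<Gamma> y u * det (hm y)"
proof -
  obtain B where B: "hm y ** B = mat 1" "B ** hm y = mat 1"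
    using hm_invertible[OF y] unfolding invertible_def by blast
  define M where "M = matrix (\<Gamma> y u)"
  have Mij: "M $ i $ j = \<Gamma> y u (axis j 1) $ i" for i j by (simp add: M_def matrix_def)
  have trM: "trace M = trace\<Gamma> y u" by (simp add: trace_def Mij trace\<Gamma>_def)
  \<comment> \<open>By metric compatibility the derivative of the Gram matrix is
    \<open>transpose M ** hm y + hm y ** M\<close>; inserting the inverse \<open>B\<close> in the
    first summand brings the whole to the form \<open>hm y ** A\<close> that
    \<open>dd_det_right\<close> expects.\<close>
  define A where "A = B ** (transpose M ** hm y) + M"
  have "hm y ** A = transpose M ** hm y + hm y ** M"
    by (simp add: A_def matrix_add_ldistrib matrix_mul_assoc B)
  moreover have "(hm y ** M) $ i $ j = h y (axis i 1) (\<Gamma> y u (axis j 1))" for i j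
  proof -
    have "(hm y ** M) $ i $ j = (hm y *v \<Gamma> y u (axis j 1)) $ i"
      by (simp add: matrix_matrix_mult_def matrix_vector_mult_def Mij)
    then show ?thesis using hm_mult[OF y] h_sym[OF y] by metis
  qed
  moreover have "(transpose M ** hm y) $ i $ j = h y (\<Gamma> y u (axis i 1)) (axis j 1)" for i j
  proof -
    have "(transpose M ** hm y) $ i $ j = (hm y *v \<Gamma> y u (axis i 1)) $ j"
      using h_sym[OF y] by (simp add: matrix_matrix_mult_def matrix_vector_mult_def Mij transpose_def hm_def mult.commute)
    then show ?thesis using hm_mult[OF y] by simp
  qed
  ultimately have "dd u (\<lambda>x. hm x $ i $ j) y = (hm y ** A) $ i $ j" for i j
    by (simp add: hm_def metric_compat[OF y])
  then have "dd u (\<lambda>x. det (hm x)) y = trace A * det (hm y)"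
    by (rule dd_det_right[rotated]) (simp add: hm_def smooth_on_differentiable[OF sm_h y])
  moreover have "trace A = 2 * trace\<Gamma> y u"
  proof -
    have "trace (B ** (transpose M ** hm y)) = trace ((transpose M ** hm y) ** B)"
      by (rule trace_mul_sym)
    also have "(transpose M ** hm y) ** B = transpose M"
      by (simp add: B flip: matrix_mul_assoc)
    finally show ?thesis by (simp add: A_def trace_add trace_transpose trM)
  qed
  ultimately show ?thesis by simp
qed

lemma mu_c: assumes y: "y \<in> U" shows "mu y a (c y) = - l *\<^sub>R a"
  unfolding c_eq[of y] using mu_G[OF y, of a] mu_comm[OF y, of a "G y"] by (simp add: linear_cmul[OF muR[OF y]] linear_neg[OF muR[OF y]])

text \<open>Along \<open>u\<close> the tangent columns of \<open>P\<close> change by multiplication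
  with \<open>dd u g y\<close> and by the Levi-Civita connection. The column \<open>c\<close> fits
  in with no connection term: it is a multiple of the identity \<open>G\<close>, and its derivative
  is its product with \<open>dd u g y\<close>.\<close>

lemma dd_det_P:
  assumes y: "y \<in> U"
  shows "dd u (\<lambda>x. det (P x)) y = (tr (mu y (dd u g y)) + trace\<Gamma> y u) * det (P y)"
proof -
  obtain B where B: "P y ** B = mat 1" "B ** P y = mat 1"
    using det_P[OF y] invertible_det_nz[of "P y"] unfolding invertible_def by blast
  let ?L = "matrix (mu y (dd u g y))"
  define C where "C = (\<chi> j k. case \<sigma> k of None \<Rightarrow> 0 | Some b \<Rightarrow>
      (case \<sigma> j of None \<Rightarrow> 0 | Some a \<Rightarrow> \<Gamma> y u (axis b 1) $ a))"
  have trC: "trace C = trace\<Gamma> y u"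
  proof -
    have "trace C = (\<Sum>j\<in>UNIV. (\<lambda>s. case s of None \<Rightarrow> 0 | Some b \<Rightarrow> \<Gamma> y u (axis b 1) $ b) (\<sigma> j))"
      unfolding trace_def C_def by (intro sum.cong refl) (simp split: option.split)
    then show ?thesis unfolding sum_\<sigma> by (simp add: trace\<Gamma>_def)
  qed
  define A where "A = B ** (?L ** P y) + C"
  have PA: "P y ** A = ?L ** P y + P y ** C"
    by (simp add: A_def matrix_add_ldistrib matrix_mul_assoc B)
  have LP: "(?L ** P y) $ i $ j = mu y (dd u g y) (case \<sigma> j of Some a \<Rightarrow> dd (axis a 1) g y | None \<Rightarrow> c y) $ i" for i j
  proof -
    let ?v = "case \<sigma> j of Some a \<Rightarrow> dd (axis a 1) g y | None \<Rightarrow> c y"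
    have "(?L ** P y) $ i $ j = (?L *v ?v) $ i"
      by (simp add: matrix_matrix_mult_def matrix_vector_mult_def P_def)
    then show ?thesis using fun_cong[OF matrix_vector_mul(2)[OF muR[OF y]]] by simp
  qed
  have PC: "(P y ** C) $ i $ j = (case \<sigma> j of Some a \<Rightarrow> dd (\<Gamma> y u (axis a 1)) g y | None \<Rightarrow> 0) $ i" for i j
  proof -
    have "(P y ** C) $ i $ j = (P y *v (\<chi> k. C $ k $ j)) $ i"
      by (simp add: matrix_matrix_mult_def matrix_vector_mult_def)
    then show ?thesis
      unfolding P_mult[OF y] by (simp add: C_def linear_0[OF dg_linear[OF y]] vec_lambda_eta zero_vec_def[symmetric] split: option.split)
  qed
  have "dd u (\<lambda>x. P x $ i $ j) y = (P y ** A) $ i $ j" for i j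
  proof (cases "\<sigma> j")
    case None
    then have "dd u (\<lambda>x. P x $ i $ j) y = dd u c y $ i"
      by (simp add: P_def dd_nth smooth_on_differentiable[OF c y])
    then show ?thesis
      unfolding PA using LP[of i j] PC[of i j] None by (simp add: shape[OF y] mu_c[OF y])
  next
    case (Some a)
    then have "dd u (\<lambda>x. P x $ i $ j) y = d2 y u (axis a 1) $ i"
      by (simp add: P_def dd_nth smooth_on_differentiable[OF sm_g y] d2_def)
    then show ?thesis
      unfolding PA using LP[of i j] PC[of i j] Some by (simp add: d2_eq[OF y] mu_tangent[OF y])
  qed
  then have "dd u (\<lambda>x. det (P x)) y = trace A * det (P y)"
    by (rule dd_det_right[rotated]) (rule smooth_on_differentiable[OF sm_P y])
  moreover have "trace A = tr (mu y (dd u g y)) + trace\<Gamma> y u"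
  proof -
    have "trace (B ** (?L ** P y)) = trace ((?L ** P y) ** B)" by (rule trace_mul_sym)
    also have "(?L ** P y) ** B = ?L" by (simp add: B flip: matrix_mul_assoc)
    finally show ?thesis by (simp add: A_def trace_add trC)
  qed
  ultimately show ?thesis by simp
qed

text \<open>The logarithmic derivatives of the two sides of \<open>vol\<close> both contain
  \<open>4 * trace\<Gamma> y u\<close>; the remaining term is four times the trace of the
  multiplication.\<close>

lemma apolar: assumes y: "y \<in> U" shows "tr (mu y (dd u g y)) = 0"
proof -
  note d = smooth_on_differentiable[OF smooth_on_det[OF U] y]
  have dP: "(\<lambda>x. det (P x)) differentiable (at y)" by (rule d[OF sm_P])
  have dh: "(\<lambda>x. det (hm x)) differentiable (at y)" by (rule d) (simp add: hm_def sm_h)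
  have "dd u (\<lambda>x. det (P x) ^ 4) y = dd u (\<lambda>x. det (hm x) ^ 2) y"
    by (rule dd_cong[OF U y]) (simp add: vol hm_def)
  then have "4 * det (P y) ^ 3 * ((tr (mu y (dd u g y)) + trace\<Gamma> y u) * det (P y))
      = 2 * det (hm y) * (2 * trace\<Gamma> y u * det (hm y))"
    by (simp add: dd_power[OF dP] dd_power[OF dh] dd_det_P[OF y] dd_det_hm[OF y])
  then have "4 * (tr (mu y (dd u g y)) + trace\<Gamma> y u) * det (P y) ^ 4 = 4 * trace\<Gamma> y u * det (hm y) ^ 2"
  proof -
    have "4 * r ^ 3 * (s * r) = 4 * s * r ^ 4" "2 * r * (2 * s * r) = 4 * s * r ^ 2" for r s :: real
      by (simp_all add: power4_eq_xxxx power3_eq_cube power2_eq_square)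
    then show "4 * det (P y) ^ 3 * ((tr (mu y (dd u g y)) + trace\<Gamma> y u) * det (P y))
      = 2 * det (hm y) * (2 * trace\<Gamma> y u * det (hm y)) \<Longrightarrow> ?thesis" by (simp only:)
  qed
  then have "(tr (mu y (dd u g y)) + trace\<Gamma> y u) * det (P y) ^ 4 = trace\<Gamma> y u * det (P y) ^ 4"
    using vol[OF y] by (simp add: hm_def)
  then show ?thesis using det_P[OF y] by simp
qed

lemma tr_mu: assumes y: "y \<in> U" shows "tr (mu y a) = real CARD('b) * p y a"
proof (rule G_tangent_cases[OF y, of "\<lambda>a. tr (mu y a)" "\<lambda>a. real CARD('b) * p y a"])
  show "linear (\<lambda>a. tr (mu y a))"
    by (intro linearI)
      (simp_all add: tr_alt linear_add[OF muL[OF y]] linear_cmul[OF muL[OF y]] sum.distrib sum_distrib_left)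
  show "linear (\<lambda>a. real CARD('b) * p y a)"
    by (intro linearI) (simp_all add: linear_add[OF p_linear[OF y]] linear_cmul[OF p_linear[OF y]] algebra_simps)
  show "tr (mu y (G y)) = real CARD('b) * p y (G y)"
    by (simp add: tr_alt mu_G[OF y] y)
  show "tr (mu y (dd u g y)) = real CARD('b) * p y (dd u g y)" for u
    by (simp add: apolar[OF y] y)
qed

text \<open>By \<open>tr_mu\<close> the trace form is a positive multiple of
  \<open>p y (mu y a b)\<close>. This form is \<open>- l * h\<close> on tangent vectors,
  \<open>1\<close> on \<open>G\<close>, and makes the two orthogonal, so it inherits nondegeneracy
  from \<open>h\<close>.\<close>

lemma comm_algebra: assumes y: "y \<in> U" shows "comm_algebra (mu y) (G y)"
proof
  show "bilinear (mu y)" by (rule mu_bilinear[OF y])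
  show "mu y a b = mu y b a" for a b by (rule mu_comm[OF y])
  show "mu y (mu y a b) d = mu y a (mu y b d)" for a b d by (rule mu_assoc[OF y])
  show "mu y (G y) a = a" for a by (rule mu_G[OF y])
  fix a assume "\<And>b. tr (mu y (mu y a b)) = 0"
  then have z: "p y (mu y a b) = 0" for b by (simp add: tr_mu[OF y])
  have "h y (\<rho> y a) v = 0" for v
    using z[of "dd v g y"] l by (simp add: mu_components[OF y] y)
  then have "\<rho> y a = 0" by (rule nondeg[OF y])
  moreover have "p y a = 0"
    using z[of "G y"] mu_comm[OF y, of a "G y"] by (simp add: mu_G[OF y])
  ultimately show "a = 0"
    using G_decomposition[OF y, of a] by (simp add: linear_0[OF dg_linear[OF y]])
qed

section \<open>The derivative of the product\<close>

definition W :: "real^'a \<Rightarrow> real^'a \<Rightarrow> real^'b \<Rightarrow> real^'b \<Rightarrow> real^'b" where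
  "W y w a b = dd w (\<lambda>x. mu x a b) y"

lemma W_sym: "y \<in> U \<Longrightarrow> W y w a b = W y w b a"
  unfolding W_def by (rule dd_cong[OF U]) (auto intro: mu_comm)

lemma WR: assumes y: "y \<in> U" shows "linear (W y w a)"
proof (rule linearI)
  note d = smooth_on_differentiable[OF sm_mu y]
  show "W y w a (b + b') = W y w a b + W y w a b'" for b b'
    unfolding W_def
    by (subst dd_add[OF d d, symmetric]) (rule dd_cong[OF U y], simp add: linear_add[OF muR])
  show "W y w a (r *\<^sub>R b) = r *\<^sub>R W y w a b" for r b
    unfolding W_def
    by (subst dd_bounded_linear[OF bounded_linear_scaleR_right d, symmetric])
      (rule dd_cong[OF U y], simp add: linear_cmul[OF muR])
qed

lemma WL: assumes y: "y \<in> U" shows "linear (\<lambda>a. W y w a b)"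
proof -
  have "(\<lambda>a. W y w a b) = W y w b" by (rule ext) (rule W_sym[OF y])
  then show ?thesis using WR[OF y] by simp
qed

lemma dd_mu:
  assumes "smooth_on U a" "smooth_on U b" "y \<in> U"
  shows "dd w (\<lambda>x. mu x (a x) (b x)) y =
    W y w (a y) (b y) + mu y (dd w a y) (b y) + mu y (a y) (dd w b y)"
  unfolding W_def by (rule dd_mu'[OF _ assms])

lemma W_G: assumes y: "y \<in> U" shows "W y w (G y) b = - mu y (dd w g y) b"
proof -
  have "dd w (\<lambda>x. mu x (G x) b) y = dd w (\<lambda>x. b) y"
    by (rule dd_cong[OF U y]) (rule mu_G)
  then show ?thesis
    using dd_mu[OF sm_G smooth_on_const[of U b] y, of w]
    by (simp add: linear_0[OF muR[OF y]] dd_G[OF y] eq_neg_iff_add_eq_0)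
qed

lemma VL: assumes y: "y \<in> U" shows "linear (\<lambda>w. V y w u v)"
proof -
  have "linear (\<lambda>w. dd w (\<lambda>x. K x u v) y)" by (rule linear_dd[OF smooth_on_differentiable[OF sm_K y]])
  then show ?thesis
    by (intro linearI)
     (simp_all add: V_def N_def \<Gamma>_simps[OF y] HK_simps[OF y] linear_add linear_cmul algebra_simps)
qed

lemma VM: assumes y: "y \<in> U" shows "linear (\<lambda>u. V y w u v)"
proof -
  have "(\<lambda>u. V y w u v) = (\<lambda>u. V y u w v)" by (rule ext) (rule codazzi[OF y])
  then show ?thesis using VL[OF y] by simp
qed

lemma VR: assumes y: "y \<in> U" shows "linear (V y w u)"
proof -
  have "V y w u = (\<lambda>v. V y w v u)" by (rule ext) (rule V_sym[OF y])
  then show ?thesis using VM[OF y] by simp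
qed

lemma T_mu:
  assumes y: "y \<in> U"
  shows "T y w u v = dd (V y w u v) g y + mu y (dd w g y) (mu y (dd u g y) (dd v g y))"
  unfolding mu_tangent[OF y] T_eq[OF y] H_eq[OF y, of u v]
  by (simp add: linear_add[OF muR[OF y]] linear_cmul[OF muR[OF y]] mu_c[OF y] mu_tangent[OF y] mult.commute)

text \<open>Differentiating the product of two tangent vectors by the product rule yields the triple
  product twice, while \<open>T_mu\<close> contains it once; the difference is the minus sign
  here.\<close>

lemma W_tangent:
  assumes y: "y \<in> U"
  shows "W y w (dd u g y) (dd v g y) =
     dd (V y w u v) g y - mu y (dd w g y) (mu y (dd u g y) (dd v g y))"
proof -
  let ?w = "dd w g y" and ?u = "dd u g y" and ?v = "dd v g y"
  have d2: "dd w (\<lambda>x. dd u g x) y = mu y ?w (dd u g y) + dd (\<Gamma> y w u) g y" for u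
    using d2_eq[OF y, of w u] by (simp add: d2_def mu_tangent[OF y])
  have "dd w (\<lambda>x. H x u v) y = dd w (\<lambda>x. mu x (dd u g x) (dd v g x)) y"
    by (rule dd_cong[OF U y]) (simp add: mu_tangent)
  also have "\<dots> = W y w ?u ?v + mu y (mu y ?w ?u) ?v + H y (\<Gamma> y w u) v + mu y ?u (mu y ?w ?v) + H y u (\<Gamma> y w v)"
    unfolding dd_mu[OF sm_g sm_g y] d2
    by (simp add: linear_add[OF muR[OF y]] linear_add[OF muL[OF y]] mu_tangent[OF y])
  finally have "T y w u v = W y w ?u ?v + mu y (mu y ?w ?u) ?v + mu y ?u (mu y ?w ?v)"
    by (simp add: T_def)
  moreover have "mu y (mu y ?w ?u) ?v = mu y ?w (mu y ?u ?v)" by (rule mu_assoc[OF y])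
  moreover have "mu y ?u (mu y ?w ?v) = mu y ?w (mu y ?u ?v)"
    using mu_assoc[OF y, of ?u ?w ?v] mu_assoc[OF y, of ?w ?u ?v] mu_comm[OF y, of ?u ?w] by simp
  ultimately show ?thesis unfolding T_mu[OF y] by (simp add: algebra_simps)
qed

lemma W_eq:
  assumes y: "y \<in> U"
  shows "W y w a b = dd (V y w (\<rho> y a) (\<rho> y b)) g y - mu y (dd w g y) (mu y a b)"
proof -
  note lc = linear_compose[unfolded o_def]
  have lV1: "linear (\<lambda>b. dd (V y w u (\<rho> y b)) g y)" for u
    by (rule lc[OF lc[OF \<rho>_linear[OF y] VR[OF y]] dg_linear[OF y]])
  have lV2: "linear (\<lambda>a. dd (V y w (\<rho> y a) v) g y)" for v
    by (rule lc[OF lc[OF \<rho>_linear[OF y] VM[OF y]] dg_linear[OF y]])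
  have lr: "linear (\<lambda>b. dd (V y w (\<rho> y a) (\<rho> y b)) g y - mu y (dd w g y) (mu y a b))" for a
    by (intro linear_compose_sub lV1 lc[OF muR[OF y] muR[OF y]])
  have ll: "linear (\<lambda>a. dd (V y w (\<rho> y a) (\<rho> y b)) g y - mu y (dd w g y) (mu y a b))" for b
    by (intro linear_compose_sub lV2 lc[OF muL[OF y] muR[OF y]])
  have G1: "W y w (G y) b = dd (V y w (\<rho> y (G y)) (\<rho> y b)) g y - mu y (dd w g y) (mu y (G y) b)" for b
    using y by (simp add: W_G[OF y] mu_G[OF y] linear_0[OF VM[OF y]] linear_0[OF dg_linear[OF y]])
  have G2: "W y w a (G y) = dd (V y w (\<rho> y a) (\<rho> y (G y))) g y - mu y (dd w g y) (mu y a (G y))" for a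
    using G1[of a] W_sym[OF y, of w a "G y"] V_sym[OF y, of w "\<rho> y a" "\<rho> y (G y)"] mu_comm[OF y, of a "G y"] by simp
  show ?thesis
  proof (rule G_tangent_cases[OF y WL[OF y] ll])
    show "W y w (G y) b = dd (V y w (\<rho> y (G y)) (\<rho> y b)) g y - mu y (dd w g y) (mu y (G y) b)" by (rule G1)
    fix u
    show "W y w (dd u g y) b = dd (V y w (\<rho> y (dd u g y)) (\<rho> y b)) g y - mu y (dd w g y) (mu y (dd u g y) b)"
    proof (rule G_tangent_cases[OF y WR[OF y] lr G2])
      show "W y w (dd u g y) (dd v g y) = dd (V y w (\<rho> y (dd u g y)) (\<rho> y (dd v g y))) g y
          - mu y (dd w g y) (mu y (dd u g y) (dd v g y))" for v
        using y by (simp add: W_tangent[OF y])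
    qed
  qed
qed

text \<open>On \<open>G\<close> this comes from differentiating \<open>p y (G y) = 1\<close>, on
  tangent vectors from \<open>dd_\<pi>_tangent\<close>. Through \<open>tr_mu\<close> it tells how
  the trace of a multiplication varies with the point.\<close>

lemma dd_p_eq: assumes y: "y \<in> U" shows "dd w (\<lambda>x. p x a) y = - p y (mu y (dd w g y) a)"
proof -
  have l1: "linear (\<lambda>a. dd w (\<lambda>x. p x a) y)"
  proof (rule linearI)
    note d = smooth_on_differentiable[OF sm_p y]
    show "dd w (\<lambda>x. p x (a + b)) y = dd w (\<lambda>x. p x a) y + dd w (\<lambda>x. p x b) y" for a b
      by (subst dd_add[OF d d, symmetric]) (rule dd_cong[OF U y], simp add: linear_add[OF p_linear])
    show "dd w (\<lambda>x. p x (r *\<^sub>R a)) y = r *\<^sub>R dd w (\<lambda>x. p x a) y" for r a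
      by (subst dd_bounded_linear[OF bounded_linear_scaleR_right d, symmetric])
        (rule dd_cong[OF U y], simp add: linear_cmul[OF p_linear])
  qed
  have l2: "linear (\<lambda>a. - p y (mu y (dd w g y) a))"
    by (rule linearI) (simp_all add: linear_add[OF muR[OF y]] linear_cmul[OF muR[OF y]]
      linear_add[OF p_linear[OF y]] linear_cmul[OF p_linear[OF y]])
  show ?thesis
  proof (rule G_tangent_cases[OF y l1 l2])
    have "dd w (\<lambda>x. p x (G x)) y = dd w (\<lambda>x. 1) y"
      by (rule dd_cong[OF U y]) simp
    then show "dd w (\<lambda>x. p x (G y)) y = - p y (mu y (dd w g y) (G y))"
      using dd_p[OF _ sm_G y, of w] mu_G[OF y] mu_comm[OF y, of "dd w g y"] y by (simp add: dd_G)
    show "dd w (\<lambda>x. p x (dd v g y)) y = - p y (mu y (dd w g y) (dd v g y))" for v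
    proof -
      have "dd w (\<lambda>x. p x (dd v g y)) y = - l * dd w (\<lambda>x. \<pi> x (dd v g y)) y"
        unfolding p_def using dd_bounded_linear[OF bounded_linear_mult_right smooth_on_differentiable[OF sm_\<pi> y]] .
      then show ?thesis using y by (simp add: dd_\<pi>_tangent[OF y] mu_components[OF y])
    qed
  qed
qed

text \<open>The covariant derivative of \<open>K\<close> is a symmetric Hochschild cocycle of the algebra and vanishes.\<close>

theorem structure_equation:
  assumes y: "y \<in> U"
  shows "dd w (\<lambda>x. mu x a b) y = - mu y (dd w g y) (mu y a b)"
proof -
  interpret comm_algebra "mu y" "G y" by (rule comm_algebra[OF y])
  \<comment> \<open>\<open>V\<close> is extended to the ambient algebra by zero on \<open>G\<close>,
    so that the rigidity lemma applies.\<close>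
  define Q where "Q x a b = dd (V y (\<rho> y x) (\<rho> y a) (\<rho> y b)) g y" for x a b
  have WQ: "W y (\<rho> y x) a b = Q x a b - mu y (dd (\<rho> y x) g y) (mu y a b)" for x a b
    unfolding Q_def by (rule W_eq[OF y])
  have lQ: "linear (Q a b)" for a b
    unfolding Q_def
    by (rule linear_compose[unfolded o_def, OF linear_compose[unfolded o_def, OF \<rho>_linear[OF y] VR[OF y]] dg_linear[OF y]])
  have "Q x a b = 0" for x a b
  proof (rule symmetric_cocycle_zero[of Q])
    show "linear (Q a b)" for a b by (rule lQ)
    show "Q a b d = Q b a d" for a b d by (simp add: Q_def codazzi[OF y, of "\<rho> y a"])
    show "Q a b d = Q a d b" for a b d by (simp add: Q_def V_sym[OF y, of _ "\<rho> y b"])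
    show "Q x (mu y a b) d + mu y (Q x a b) d = Q x a (mu y b d) + mu y a (Q x b d)" for x a b d
    proof -
      let ?w = "\<rho> y x" and ?z = "dd (\<rho> y x) g y"
      note d = dd_mu[OF _ _ y, of _ _ ?w]
      \<comment> \<open>The derivative of associativity. The iterated products contributed by
        \<open>WQ\<close> are the same on both sides and cancel, leaving the cocycle identity for
        \<open>Q\<close>.\<close>
      have "dd ?w (\<lambda>x. mu x (mu x a b) d) y = dd ?w (\<lambda>x. mu x a (mu x b d)) y"
        by (rule dd_cong[OF U y]) (rule mu_assoc)
      then have "W y ?w (mu y a b) d + mu y (W y ?w a b) d = W y ?w a (mu y b d) + mu y a (W y ?w b d)"
        using d[OF sm_mu smooth_on_const, of a b d] d[OF smooth_on_const sm_mu, of a b d]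
        by (simp add: mu_simps flip: W_def)
      then have e: "Q x (mu y a b) d - mu y ?z (mu y (mu y a b) d) + (mu y (Q x a b) d - mu y (mu y ?z (mu y a b)) d)
         = Q x a (mu y b d) - mu y ?z (mu y a (mu y b d)) + (mu y a (Q x b d) - mu y a (mu y ?z (mu y b d)))"
        unfolding WQ mu_simps .
      have "mu y ?z (mu y (mu y a b) d) = mu y ?z (mu y a (mu y b d))"
        "mu y (mu y ?z (mu y a b)) d = mu y ?z (mu y a (mu y b d))"
        "mu y a (mu y ?z (mu y b d)) = mu y ?z (mu y a (mu y b d))"
        by (simp_all add: mu_ac)
      then show ?thesis using e by (simp add: algebra_simps)
    qed
    show "t (Q a b d) = 0" for a b d
      unfolding t_def Q_def by (rule apolar[OF y])
    show "tr (Q x a) = 0" for x a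
    proof -
      let ?w = "\<rho> y x" and ?z = "dd (\<rho> y x) g y"
      \<comment> \<open>The trace of \<open>W\<close> follows from \<open>tr_mu\<close> and
        \<open>dd_p_eq\<close>. It already equals the contribution of the triple product in
        \<open>WQ\<close>, which leaves nothing for \<open>Q\<close>.\<close>
      have tW: "tr (W y ?w a) = dd ?w (\<lambda>x. tr (mu x a)) y"
        unfolding tr_alt W_def
        by (subst dd_sum) (simp_all add: dd_nth smooth_on_differentiable[OF sm_mu y]
            smooth_on_differentiable[OF smooth_on_nth[OF U sm_mu] y])
      also have "\<dots> = dd ?w (\<lambda>x. real CARD('b) * p x a) y"
        by (rule dd_cong[OF U y]) (rule tr_mu)
      also have "\<dots> = real CARD('b) * dd ?w (\<lambda>x. p x a) y"
        by (rule dd_bounded_linear[OF bounded_linear_mult_right smooth_on_differentiable[OF sm_p y]])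
      also have "\<dots> = - tr (mu y (mu y ?z a))"
        unfolding dd_p_eq[OF y] tr_mu[OF y] by simp
      finally have 1: "tr (W y ?w a) = - tr (mu y (mu y ?z a))" .
      have "tr (W y ?w a) = tr (Q x a) - tr (mu y (mu y ?z a))"
        unfolding tr_alt WQ by (simp add: sum_subtractf assoc)
      then show ?thesis using 1 by simp
    qed
  qed
  from this[of "dd w g y" a b] show ?thesis
    using WQ[of "dd w g y" a b] y by (simp add: W_def)
qed

end

section \<open>The derivative of the norm form and the sign condition\<close>

lemma sum_signs_nonzero:
  fixes x :: "'k::finite \<Rightarrow> real"
  assumes "\<And>k. x k = 1 \<or> x k = -1" "odd (CARD('k))"
  shows "(\<Sum>k\<in>UNIV. x k) \<noteq> 0"
proof
  assume z: "(\<Sum>k\<in>UNIV. x k) = 0"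
  have "x k = 2 * (if x k = 1 then 1 else 0) - 1" for k using assms(1)[of k] by auto
  then have "(\<Sum>k\<in>UNIV. x k) = (\<Sum>k\<in>UNIV. 2 * (if x k = 1 then 1 else 0) - 1)" by (rule sum.cong[OF refl])
  also have "\<dots> = 2 * real (card {k. x k = 1}) - real CARD('k)"
    by (simp add: sum_subtractf sum.If_cases flip: sum_distrib_left)
  finally have "real CARD('k) = real (2 * card {k. x k = 1})" using z by simp
  then have "CARD('k) = 2 * card {k. x k = 1}" by (simp only: of_nat_eq_iff)
  then show False using assms(2) by simp
qed

lemma quad_norm_scale: "quad_norm \<epsilon> (s *\<^sub>R v) = (s ^ (2 * CARD('k))) * quad_norm \<epsilon> v"
  for v :: "real^('k::finite + 'k)"
proof -
  have "quad_norm \<epsilon> (s *\<^sub>R v) = (\<Prod>k\<in>UNIV. s\<^sup>2 * ((v $ Inl k)\<^sup>2 + \<epsilon> k * (v $ Inr k)\<^sup>2))"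
    unfolding quad_norm_def by (intro prod.cong refl) (simp add: power2_eq_square algebra_simps)
  then show ?thesis by (simp add: prod.distrib quad_norm_def power_mult)
qed

context comm_algebra
begin

text \<open>The norm is multiplicative with differential \<open>t\<close> at the identity, so its
  logarithmic derivative along \<open>F\<close> is the trace of the logarithmic derivative
  \<open>Z\<close>. In split coordinates this is checked factor by factor.\<close>

lemma dd_quad_norm:
  fixes F :: "'m::real_normed_vector \<Rightarrow> real^'e" and \<Phi> :: "real^'e \<Rightarrow> real^('k::finite + 'k)"
  assumes sc: "split_coordinates \<epsilon> \<Phi>" and F: "F differentiable (at y)" and Z: "dd w F y = F y \<star> Z"
  shows "dd w (\<lambda>x. quad_norm \<epsilon> (\<Phi> (F x))) y = quad_norm \<epsilon> (\<Phi> (F y)) * t Z"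
proof -
  have lin: "linear \<Phi>" using sc by (simp add: split_coordinates_def)
  let ?q = "\<lambda>k x. (\<Phi> (F x) $ Inl k)\<^sup>2 + \<epsilon> k * (\<Phi> (F x) $ Inr k)\<^sup>2"
  have \<Phi>F: "((\<lambda>x. \<Phi> (F x) $ i) has_derivative (\<lambda>w. \<Phi> (dd w F y) $ i)) (at y)" for i
  proof -
    have "bounded_linear (\<lambda>a. \<Phi> a $ i)"
      using bounded_linear_compose[OF bounded_linear_vec_nth] lin linear_conv_bounded_linear by blast
    from bounded_linear.has_derivative[OF this F[unfolded frechet_derivative_works]] show ?thesis .
  qed
  have q: "(?q k has_derivative (\<lambda>w. 2 * \<Phi> (F y) $ Inl k * \<Phi> (dd w F y) $ Inl k
        + \<epsilon> k * (2 * \<Phi> (F y) $ Inr k * \<Phi> (dd w F y) $ Inr k))) (at y)" for k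
    by (auto intro!: derivative_eq_intros \<Phi>F simp: algebra_simps)
  have "((\<lambda>x. quad_norm \<epsilon> (\<Phi> (F x))) has_derivative (\<lambda>w. \<Sum>k\<in>UNIV. (2 * \<Phi> (F y) $ Inl k * \<Phi> (dd w F y) $ Inl k
        + \<epsilon> k * (2 * \<Phi> (F y) $ Inr k * \<Phi> (dd w F y) $ Inr k)) * (\<Prod>j\<in>UNIV - {k}. ?q j y))) (at y)"
    unfolding quad_norm_def by (intro has_derivative_prod q)
  then have "dd w (\<lambda>x. quad_norm \<epsilon> (\<Phi> (F x))) y = (\<Sum>k\<in>UNIV. (2 * \<Phi> (F y) $ Inl k * \<Phi> (dd w F y) $ Inl k
        + \<epsilon> k * (2 * \<Phi> (F y) $ Inr k * \<Phi> (dd w F y) $ Inr k)) * (\<Prod>j\<in>UNIV - {k}. ?q j y))"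
    by (rule dd_eqI)
  also have "\<dots> = (\<Sum>k\<in>UNIV. 2 * \<Phi> Z $ Inl k * quad_norm \<epsilon> (\<Phi> (F y)))"
  proof (rule sum.cong[OF refl])
    fix k
    have "2 * \<Phi> (F y) $ Inl k * \<Phi> (dd w F y) $ Inl k + \<epsilon> k * (2 * \<Phi> (F y) $ Inr k * \<Phi> (dd w F y) $ Inr k)
       = 2 * \<Phi> Z $ Inl k * ?q k y"
    proof -
      have eqs: "\<Phi> (F y \<star> Z) $ Inl k = \<Phi> (F y) $ Inl k * \<Phi> Z $ Inl k - \<epsilon> k * (\<Phi> (F y) $ Inr k * \<Phi> Z $ Inr k)"
        "\<Phi> (F y \<star> Z) $ Inr k = \<Phi> (F y) $ Inl k * \<Phi> Z $ Inr k + \<Phi> (F y) $ Inr k * \<Phi> Z $ Inl k"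
        using sc by (simp_all add: split_coordinates_def)
      show ?thesis unfolding Z eqs by (simp add: power2_eq_square algebra_simps)
    qed
    moreover have "quad_norm \<epsilon> (\<Phi> (F y)) = ?q k y * (\<Prod>j\<in>UNIV - {k}. ?q j y)"
      unfolding quad_norm_def by (rule prod.remove) auto
    ultimately show "(2 * \<Phi> (F y) $ Inl k * \<Phi> (dd w F y) $ Inl k
        + \<epsilon> k * (2 * \<Phi> (F y) $ Inr k * \<Phi> (dd w F y) $ Inr k)) * (\<Prod>j\<in>UNIV - {k}. ?q j y)
      = 2 * \<Phi> Z $ Inl k * quad_norm \<epsilon> (\<Phi> (F y))" by simp
  qed
  also have "\<dots> = quad_norm \<epsilon> (\<Phi> (F y)) * t Z"
    using sc by (simp add: split_coordinates_def sum_distrib_left sum_distrib_right mult_ac)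
  finally show ?thesis .
qed

lemma quad_norm_unit: "split_coordinates \<epsilon> \<Phi> \<Longrightarrow> quad_norm \<epsilon> (\<Phi> e) = 1"
  by (simp add: split_coordinates_def quad_norm_def)

text \<open>In a complex factor, \<open>j\<close> squaring to the identity forces its first
  coefficient to be \<open>1\<close> or \<open>-1\<close>. If all factors were complex, the trace of
  \<open>j\<close> would be twice a sum of an odd number of signs, which cannot vanish.\<close>

lemma split_coordinates_negative_sign:
  fixes \<Phi> :: "real^'e \<Rightarrow> real^('k::finite + 'k)"
  assumes sc: "split_coordinates \<epsilon> \<Phi>" and odd: "odd (CARD('k))"
    and j: "j \<star> j = e" "t j = 0"
  shows "\<exists>k. \<epsilon> k = -1"
proof (rule ccontr)
  assume "\<nexists>k. \<epsilon> k = -1"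
  then have eps: "\<epsilon> k = 1" for k using sc by (auto simp: split_coordinates_def)
  have "\<Phi> j $ Inl k = 1 \<or> \<Phi> j $ Inl k = -1" for k
  proof -
    let ?x = "\<Phi> j $ Inl k" and ?y = "\<Phi> j $ Inr k"
    have 1: "\<Phi> (j \<star> j) $ Inl k = ?x * ?x - ?y * ?y" "\<Phi> (j \<star> j) $ Inr k = ?x * ?y + ?y * ?x"
      using sc by (simp_all add: split_coordinates_def eps)
    have 2: "\<Phi> e $ Inl k = 1" "\<Phi> e $ Inr k = 0" using sc by (simp_all add: split_coordinates_def)
    have "?x * ?x - ?y * ?y = 1" "?x * ?y = 0" using 1 2 unfolding j by simp_all
    moreover have "?x \<noteq> 0"
    proof
      assume "?x = 0"
      then have "- (?y * ?y) = 1" using \<open>?x * ?x - ?y * ?y = 1\<close> by simp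
      then show False using zero_le_square[of ?y] by linarith
    qed
    ultimately have "?x * ?x = 1" by simp
    then show ?thesis by (simp add: square_eq_1_iff)
  qed
  moreover have "(\<Sum>k\<in>UNIV. \<Phi> j $ Inl k) = 0" using sc j(2) by (simp add: split_coordinates_def)
  ultimately show False using sum_signs_nonzero[of "\<lambda>k. \<Phi> j $ Inl k", OF _ odd] by simp
qed

end

context flat_hypersphere_chart
begin

section \<open>The local norm equation\<close>

text \<open>By the structure equation, the quotient of multiplication by \<open>a\<close> and multiplication by the
  fixed vector \<open>G y0\<close> does not depend on the point.\<close>

lemma product_locally_determined:
  assumes y0: "y0 \<in> U"
  obtains r where "r > 0" "ball y0 r \<subseteq> U"
    "\<And>y. y \<in> ball y0 r \<Longrightarrow> inj (mu y (G y0))"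
    "\<And>y a b. y \<in> ball y0 r \<Longrightarrow> mu y a b = mu y (G y0) (mu y0 a b)"
proof -
  define M where "M y = matrix (mu y (G y0))" for y
  have Mv: "M y *v x = mu y (G y0) x" if "y \<in> U" for y x
    unfolding M_def using fun_cong[OF matrix_vector_mul(2)[OF muR[OF that]]] .
  have smM: "smooth_on U (\<lambda>y. M y $ i $ j)" for i j
    unfolding M_def matrix_def by (simp add: smooth_on_nth[OF U sm_mu])
  have "M y0 *v x = mat 1 *v x" for x using Mv[OF y0] mu_G[OF y0] by simp
  then have "M y0 = mat 1" using matrix_eq by blast
  then have "det (M y0) \<noteq> 0" by simp
  moreover have "continuous_on U (\<lambda>y. det (M y))"
    by (rule smooth_on_continuous[OF smooth_on_det[OF U smM]])
  then have "isCont (\<lambda>y. det (M y)) y0" using y0 by (simp add: continuous_on_eq_continuous_at[OF U])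
  \<comment> \<open>Multiplication by \<open>G y0\<close> is the identity at \<open>y0\<close>,
    hence invertible nearby.\<close>
  ultimately obtain r1 where r1: "r1 > 0" "\<And>y. dist y0 y < r1 \<Longrightarrow> det (M y) \<noteq> 0"
    using continuous_at_avoid[of y0 "\<lambda>y. det (M y)" 0] by blast
  obtain r2 where r2: "r2 > 0" "ball y0 r2 \<subseteq> U" using U y0 openE by blast
  define r where "r = min r1 r2"
  let ?B = "ball y0 r"
  have r: "r > 0" and BU: "?B \<subseteq> U" using r1 r2 by (auto simp: r_def)
  have det: "det (M y) \<noteq> 0" if "y \<in> ?B" for y using that r1(2) by (auto simp: r_def)
  have inj: "inj (mu y (G y0))" if y: "y \<in> ?B" for y
  proof -
    have "invertible (M y)" using det[OF y] invertible_det_nz by blast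
    then have "inj ((*v) (M y))"
      using invertible_left_inverse matrix_left_invertible_injective by blast
    moreover have "(*v) (M y) = mu y (G y0)" by (rule ext) (use Mv BU y in blast)
    ultimately show ?thesis by simp
  qed
  have main: "mu y a b = mu y (G y0) (mu y0 a b)" if y: "y \<in> ?B" for y a b
  proof -
    define X where "X y = (SOME x. M y *v x = mu y a b)" for y
    have MX: "M y *v X y = mu y a b" if y: "y \<in> ?B" for y
    proof -
      obtain A where A: "M y ** A = mat 1"
        using det[OF y] invertible_det_nz[of "M y"] unfolding invertible_def by blast
      have "M y *v (A *v mu y a b) = mu y a b" by (simp add: matrix_vector_mul_assoc A)
      then show ?thesis unfolding X_def by (rule someI)
    qed
    have smB: "smooth_on ?B F" if "smooth_on U F" for F :: "real^'a \<Rightarrow> 'z::real_normed_vector"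
      by (rule smooth_on_subset[OF that BU])
    have smX: "smooth_on ?B X"
      by (intro smooth_on_solution[OF open_ball, where M=M and b="\<lambda>y. mu y a b" and x=X]
          smB smM sm_mu det MX)
    have eq: "mu y (G y0) (X y) = mu y a b" if "y \<in> ?B" for y
      using MX[OF that] Mv BU that by auto
    have dX: "dd w X y = 0" if y: "y \<in> ?B" for y w
    proof -
      have yU: "y \<in> U" using y BU by blast
      have bil: "bilinear (mu x)" if "x \<in> ?B" for x using mu_bilinear BU that by blast
      \<comment> \<open>Both sides of \<open>eq\<close> are differentiated by the structure
        equation. The terms with the derivative of \<open>G\<close> agree, so the injective
        multiplication by \<open>G y0\<close> annihilates the derivative of
        \<open>X\<close>.\<close>
      have "dd w (\<lambda>x. mu x (G y0) (X x)) y = dd w (\<lambda>x. mu x a b) y"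
        by (rule dd_cong[OF open_ball y]) (rule eq)
      moreover have "dd w (\<lambda>x. mu x (G y0) (X x)) y =
        dd w (\<lambda>x. mu x (G y0) (X y)) y + mu y (dd w (\<lambda>x. G y0) y) (X y) + mu y (G y0) (dd w X y)"
        by (rule dd_bilinear_family[OF open_ball bil smB[OF sm_mu] smooth_on_const smX y])
      ultimately have "mu y (G y0) (dd w X y) = 0"
        by (simp add: structure_equation[OF yU] eq[OF y] linear_0[OF muL[OF yU]])
      then show ?thesis using inj[OF y] linear_injective_0[OF muR[OF yU]] by blast
    qed
    have "X y = X y0"
    proof -
      have "(X has_derivative (\<lambda>w. 0)) (at x within ?B)" if "x \<in> ?B" for x
        using has_derivative_at_withinI[OF smooth_on_has_derivative[OF smX that]] dX[OF that] by simp
      then show ?thesis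
        using has_derivative_zero_unique[OF convex_ball, of y0 r X y0 y] y r by fastforce
    qed
    moreover have "X y0 = mu y0 a b"
      using eq[of y0] r mu_G[OF y0] by simp
    ultimately show ?thesis using eq[OF y] by simp
  qed
  show thesis by (rule that[OF r BU inj main])
qed

text \<open>In the fixed algebra at \<open>y0\<close>, \<open>dd w G y\<close> is \<open>G y\<close>
  times an element \<open>Z\<close>, and multiplication by \<open>Z\<close> there is multiplication
  by \<open>dd w g y\<close> in the algebra at \<open>y\<close>, which is trace-free by
  \<open>apolar\<close>. Hence the norm is constant on the ball, with the value that it has at the
  identity \<open>G y0\<close>.\<close>

theorem norm_equation:
  fixes \<Phi> :: "real^'b \<Rightarrow> real^('k::finite + 'k)"
  assumes y0: "y0 \<in> U" and sc: "comm_algebra.split_coordinates (mu y0) (G y0) \<epsilon> \<Phi>"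
  obtains r where "r > 0" "ball y0 r \<subseteq> U" "\<And>y. y \<in> ball y0 r \<Longrightarrow> quad_norm \<epsilon> (\<Phi> (G y)) = 1"
proof -
  interpret A0: comm_algebra "mu y0" "G y0" by (rule comm_algebra[OF y0])
  obtain r where r: "r > 0" and BU: "ball y0 r \<subseteq> U"
    and inj: "\<And>y. y \<in> ball y0 r \<Longrightarrow> inj (mu y (G y0))"
    and main: "\<And>y a b. y \<in> ball y0 r \<Longrightarrow> mu y a b = mu y (G y0) (mu y0 a b)"
    using product_locally_determined[OF y0] by metis
  let ?f = "\<lambda>y. quad_norm \<epsilon> (\<Phi> (G y))"
  have "\<exists>Z. dd w G y = mu y0 (G y) Z \<and> A0.t Z = 0" if y: "y \<in> ball y0 r" for y w
  proof -
    have yU: "y \<in> U" using y BU by blast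
    define Z where "Z = mu y (G y0) (dd w g y)"
    \<comment> \<open>\<open>G y\<close> is the identity at \<open>y\<close>, so multiplication by
      \<open>G y0\<close> in the algebra at \<open>y\<close> inverts multiplication by
      \<open>G y\<close> in the algebra at \<open>y0\<close>.\<close>
    have left: "mu y (G y0) (mu y0 (G y) b) = b" for b
      using main[OF y, of "G y" b] mu_G[OF yU, of b] by simp
    have X: "mu y0 (G y) Z = dd w g y"
      by (rule injD[OF inj[OF y]]) (simp add: left Z_def)
    have "mu y0 Z b = mu y (dd w g y) b" for b
      using main[OF y, of "dd w g y" b] left[of "mu y0 Z b"] by (simp add: A0.assoc flip: X)
    then have "mu y0 Z = mu y (dd w g y)" by (rule ext)
    then have "A0.t Z = 0" using apolar[OF yU] by (simp add: A0.t_def)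
    then show ?thesis using X dd_G[OF yU, of w] by metis
  qed
  then have df: "dd w ?f y = 0" if "y \<in> ball y0 r" for y w
  proof -
    have yU: "y \<in> U" using that BU by blast
    from \<open>\<And>y w. y \<in> ball y0 r \<Longrightarrow> \<exists>Z. dd w G y = mu y0 (G y) Z \<and> A0.t Z = 0\<close>[OF that, of w]
    obtain Z where Z: "dd w G y = mu y0 (G y) Z" "A0.t Z = 0" by blast
    show ?thesis
      unfolding A0.dd_quad_norm[OF sc smooth_on_differentiable[OF sm_G yU] Z(1)] Z(2) by simp
  qed
  have "?f y = 1" if y: "y \<in> ball y0 r" for y
  proof -
    have lin: "linear \<Phi>" using sc by (simp add: A0.split_coordinates_def)
    have "smooth_on U (\<lambda>y. \<Phi> (G y) $ i)" for i
      by (rule smooth_on_nth[OF U smooth_on_linear[OF U lin sm_G]])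
    then have "smooth_on U ?f"
      unfolding quad_norm_def power2_eq_square
      by (intro smooth_on_prod[OF U] smooth_on_add[OF U] smooth_on_mult[OF U] smooth_on_const)
    then have "(?f has_derivative (\<lambda>w. 0)) (at x within ball y0 r)" if "x \<in> ball y0 r" for x
      using has_derivative_at_withinI[OF smooth_on_has_derivative[of U ?f x]] df[OF that] BU that by auto
    then have "?f y0 = ?f y"
      using has_derivative_zero_unique[OF convex_ball, of y0 r ?f y0 y] y r by fastforce
    then show ?thesis using A0.quad_norm_unit[OF sc] by simp
  qed
  then show thesis using that r BU by blast
qed

text \<open>The cone over an open part of the hypersurface is open in the ambient space.\<close>

theorem open_in_level_set:
  fixes F :: "real^'b \<Rightarrow> real"
  assumes B: "open B" "B \<subseteq> U" and F: "\<And>y. y \<in> B \<Longrightarrow> F (G y) = 1"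
    and hom: "\<And>s v. F (s *\<^sub>R v) = s ^ m * F v" and m: "m > 0"
  shows "\<exists>O'. open O' \<and> G ` B = O' \<inter> {v. F v = 1}"
proof -
  define \<Psi> where "\<Psi> z = snd z *\<^sub>R G (fst z)" for z :: "(real^'a) \<times> real"
  let ?S = "B \<times> {0::real<..}"
  have S: "open ?S" by (intro open_Times open_greaterThan B)
  have contG: "continuous_on B G" using smooth_on_continuous[OF sm_G] B continuous_on_subset by blast
  have cont: "continuous_on ?S \<Psi>"
    unfolding \<Psi>_def
    by (intro continuous_on_scaleR continuous_on_snd continuous_on_id continuous_on_compose2[OF contG] continuous_on_fst) auto
  have "open (\<Psi> ` ?S)"
  proof -
    have "\<Psi> z \<in> interior (\<Psi> ` ?S)" if z: "z \<in> ?S" for z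
    proof -
      obtain y s where ys: "z = (y, s)" "y \<in> B" "s > 0" using z by auto
      have yU: "y \<in> U" using ys B by blast
      have G': "((\<lambda>z. G (fst z)) has_derivative (\<lambda>d. dd (fst d) g y)) (at z)"
      proof -
        have "(fst has_derivative fst) (at z)" by (rule has_derivative_fst[OF has_derivative_ident])
        moreover have "(G has_derivative (\<lambda>w. dd w g y)) (at (fst z))"
          using smooth_on_has_derivative[OF sm_G yU] by (simp add: ys dd_G[OF yU])
        ultimately show ?thesis by (rule has_derivative_compose)
      qed
      have d: "(\<Psi> has_derivative (\<lambda>d. s *\<^sub>R dd (fst d) g y + snd d *\<^sub>R G y)) (at z)"
        unfolding \<Psi>_def
        using has_derivative_scaleR[OF has_derivative_snd[OF has_derivative_ident] G']
        by (simp add: ys)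
      \<comment> \<open>A bounded right inverse of the differential of \<open>\<Psi>\<close>, as the
        open mapping criterion below requires. It is read off from the decomposition along tangent
        vectors and \<open>G\<close>; the factor \<open>1/s\<close> undoes the scaling by
        \<open>s\<close>.\<close>
      let ?i = "\<lambda>v. ((1/s) *\<^sub>R \<rho> y v, p y v)"
      have "linear ?i"
        by (rule linearI) (simp_all add: linear_add[OF \<rho>_linear[OF yU]] linear_cmul[OF \<rho>_linear[OF yU]]
          linear_add[OF p_linear[OF yU]] linear_cmul[OF p_linear[OF yU]] scaleR_add_right)
      then have i: "bounded_linear ?i" using linear_conv_bounded_linear by blast
      have "(\<lambda>d. s *\<^sub>R dd (fst d) g y + snd d *\<^sub>R G y) \<circ> ?i = id"
      proof (rule ext)
        fix v
        have "s *\<^sub>R dd ((1 / s) *\<^sub>R \<rho> y v) g y = dd (\<rho> y v) g y"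
          using ys(3) by (simp add: linear_cmul[OF dg_linear[OF yU]])
        then show "((\<lambda>d. s *\<^sub>R dd (fst d) g y + snd d *\<^sub>R G y) \<circ> ?i) v = id v"
          using G_decomposition[OF yU, of v, symmetric] by (simp only: o_def fst_conv snd_conv id_apply)
      qed
      from sussmann_open_mapping[OF S cont z d i this subset_refl] show ?thesis
        using z S by (simp add: interior_open)
    qed
    then have "\<Psi> ` ?S \<subseteq> interior (\<Psi> ` ?S)" by blast
    then show ?thesis by (metis interior_subset open_interior subset_antisym)
  qed
  moreover have "G ` B = \<Psi> ` ?S \<inter> {v. F v = 1}"
  proof safe
    fix y assume y: "y \<in> B"
    then show "G y \<in> \<Psi> ` ?S" by (intro image_eqI[of _ _ "(y, 1)"]) (auto simp: \<Psi>_def)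
    show "F (G y) = 1" by (rule F[OF y])
  next
    fix y s assume y: "y \<in> B" and s: "(0::real) < s" and one: "F (\<Psi> (y, s)) = 1"
    then have "s ^ m = 1" using hom[of s "G y"] F[OF y] by (simp add: \<Psi>_def)
    then have "s = 1" using power_eq_iff_eq_base[of m s 1] s m by simp
    then show "\<Psi> (y, s) \<in> G ` B" using y by (simp add: \<Psi>_def)
  qed
  ultimately show ?thesis by blast
qed

end

section \<open>Tangent para-complex structures\<close>

locale tangent_involution = flat_hypersphere_chart U g c \<sigma> l
  for U :: "(real^'d) set" and g c :: "real^'d \<Rightarrow> real^'e" and \<sigma> l +
  fixes J :: "real^'e \<Rightarrow> real^'e"
  assumes J: "linear J" and JJ: "J (J v) = v"
    and tangent: "y \<in> U \<Longrightarrow> J (c y) \<in> tangent_image g y"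
begin

lemma \<pi>JG: "y \<in> U \<Longrightarrow> \<pi> y (J (G y)) = 0"
  using tangent tangent_iff by (simp add: G_def linear_cmul[OF J] linear_neg[OF J] linear_cmul[OF \<pi>_linear] linear_neg[OF \<pi>_linear])

definition \<xi> :: "real^'d \<Rightarrow> real^'d" where "\<xi> y = \<rho> y (J (G y))"

lemma sm_JG: "smooth_on U (\<lambda>y. J (G y))"
  by (rule smooth_on_linear[OF U J sm_G])

lemma sm_\<xi>: "smooth_on U \<xi>"
  unfolding \<xi>_def[abs_def] by (rule sm_\<rho>'[OF _ sm_JG])

lemma dg_\<xi>: "y \<in> U \<Longrightarrow> dd (\<xi> y) g y = J (G y)"
  using decomposition[of y "J (G y)"] by (simp add: \<xi>_def \<pi>JG)

lemma dd_JG: "y \<in> U \<Longrightarrow> dd w (\<lambda>x. J (G x)) y = J (dd w g y)"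
  using dd_linear[OF J smooth_on_differentiable[OF sm_G], of y w] by (simp add: dd_G)

lemma H_\<xi>: assumes y: "y \<in> U" shows "H y w (\<xi> y) = J (dd w g y) - dd (N y w \<xi>) g y"
proof -
  have "dd w (\<lambda>x. dd (\<xi> x) g x) y = dd w (\<lambda>x. J (G x)) y"
    by (rule dd_cong[OF U y]) (rule dg_\<xi>)
  then have "d2 y w (\<xi> y) + dd (dd w \<xi> y) g y = J (dd w g y)"
    unfolding dd_dg[OF y sm_\<xi>] dd_JG[OF y] .
  then have d: "J (dd w g y) = d2 y w (\<xi> y) + dd (dd w \<xi> y) g y" ..
  show ?thesis
    unfolding d by (simp add: H_def N_def linear_add[OF dg_linear[OF y]])
qed

text \<open>The vanishing of the right-hand side describes \<open>\<D>\<close>, so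
  \<open>\<D>\<close> is the \<open>h\<close>-orthogonal complement of \<open>\<xi>\<close>.\<close>

lemma h_\<xi>: assumes y: "y \<in> U" shows "h y w (\<xi> y) = \<pi> y (J (dd w g y))"
  using \<pi>_H[OF y, of w "\<xi> y"] y by (simp add: H_\<xi>[OF y] linear_diff[OF \<pi>_linear[OF y]])

lemma h_\<xi>_\<xi>: assumes y: "y \<in> U" shows "h y (\<xi> y) (\<xi> y) = - 1 / l"
proof -
  have "h y (\<xi> y) (\<xi> y) = \<pi> y (G y)" by (simp add: h_\<xi>[OF y] dg_\<xi>[OF y] JJ)
  then show ?thesis using y by (simp add: G_def linear_cmul[OF \<pi>_linear[OF y]] linear_neg[OF \<pi>_linear[OF y]])
qed

lemma h_N_\<xi>: assumes y: "y \<in> U" shows "h y (N y w \<xi>) (\<xi> y) = 0"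
proof -
  have "dd w (\<lambda>x. h x (\<xi> x) (\<xi> x)) y = dd w (\<lambda>x. - 1 / l) y"
    by (rule dd_cong[OF U y]) (rule h_\<xi>_\<xi>)
  then show ?thesis
    using dd_h[OF y sm_\<xi> sm_\<xi>, of w] h_sym[OF y, of "\<xi> y" "N y w \<xi>"] by (simp add: N_def add.commute)
qed

text \<open>By total symmetry \<open>h (K \<xi> \<xi>) w = h (K w \<xi>) \<xi>\<close>.
  \<open>H_\<xi>\<close> splits \<open>K w \<xi>\<close> into the tangential part of
  \<open>J (dd w g y)\<close> and a covariant derivative of \<open>\<xi>\<close>. The latter is
  orthogonal to \<open>\<xi>\<close> because \<open>h \<xi> \<xi>\<close> is constant, the former
  because \<open>J\<close> is an involution and maps \<open>c\<close> to a tangent vector. The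
  component along \<open>G\<close> is \<open>- l * h \<xi> \<xi> = 1\<close>.\<close>

lemma J_square: assumes y: "y \<in> U" shows "mu y (J (G y)) (J (G y)) = G y"
proof (rule vector_eqI[OF y])
  have "h y (K y (\<xi> y) (\<xi> y)) w = 0" for w
  proof -
    let ?v = "\<rho> y (J (dd w g y))"
    have "h y (K y (\<xi> y) (\<xi> y)) w = h y (K y w (\<xi> y)) (\<xi> y)" by (rule \<kappa>_sym[OF y])
    also have "K y w (\<xi> y) = ?v - N y w \<xi>"
      using y by (simp add: K_def H_\<xi>[OF y] linear_diff[OF \<rho>_linear[OF y]])
    also have "h y (?v - N y w \<xi>) (\<xi> y) = \<pi> y (J (dd ?v g y))"
      using h_N_\<xi>[OF y, of w] h_\<xi>[OF y, of ?v] by (simp add: h_simps[OF y])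
    also have "\<dots> = 0"
    proof -
      have "dd w g y = J (dd ?v g y + \<pi> y (J (dd w g y)) *\<^sub>R c y)"
        unfolding decomposition[OF y, of "J (dd w g y)", symmetric] by (simp add: JJ)
      from arg_cong[OF this, of "\<pi> y"] have "\<pi> y (dd w g y) = \<pi> y (J (dd ?v g y)) + \<pi> y (J (dd w g y)) * \<pi> y (J (c y))"
        by (simp only: linear_add[OF J] linear_cmul[OF J] linear_add[OF \<pi>_linear[OF y]]
          linear_cmul[OF \<pi>_linear[OF y]] real_scaleR_def)
      then show ?thesis using tangent[OF y] tangent_iff[OF y] y by simp
    qed
    finally show ?thesis .
  qed
  then have "K y (\<xi> y) (\<xi> y) = 0" by (rule nondeg[OF y])
  moreover have pJG: "p y (J (G y)) = 0" using \<pi>JG[OF y] by (simp add: p_def)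
  ultimately show "\<rho> y (mu y (J (G y)) (J (G y))) = \<rho> y (G y)"
    "p y (mu y (J (G y)) (J (G y))) = p y (G y)"
    using y l pJG h_\<xi>_\<xi>[OF y] by (simp_all add: mu_components[OF y] flip: \<xi>_def)
qed

text \<open>Write \<open>j\<close> for \<open>J (G y)\<close> and \<open>u\<close> for its image
  \<open>dd u g y\<close>. Differentiating \<open>j j = G\<close> by the structure equation gives
  \<open>2 j (J u) - u = u\<close>; multiplying \<open>j (J u) = u\<close> by \<open>j\<close>
  settles the tangent vectors, and \<open>G\<close> is the identity.\<close>

lemma mu_J: assumes y: "y \<in> U" shows "mu y (J (G y)) a = J a"
proof (rule G_tangent_cases[OF y muR[OF y] J])
  show "mu y (J (G y)) (G y) = J (G y)" using mu_comm[OF y, of "J (G y)" "G y"] mu_G[OF y] by simp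
  fix u
  let ?j = "J (G y)" and ?u = "dd u g y"
  have "dd u (\<lambda>x. mu x (J (G x)) (J (G x))) y = dd u G y"
    by (rule dd_cong[OF U y]) (rule J_square)
  then have "- mu y ?u (mu y ?j ?j) + mu y (J ?u) ?j + mu y ?j (J ?u) = ?u"
    unfolding dd_mu[OF sm_JG sm_JG y] W_def structure_equation[OF y] dd_JG[OF y] dd_G[OF y] .
  then have "2 *\<^sub>R mu y ?j (J ?u) = 2 *\<^sub>R ?u"
    using J_square[OF y] mu_comm[OF y, of "J ?u" ?j] mu_comm[OF y, of ?u "G y"] mu_G[OF y, of ?u]
    by (simp add: scaleR_2 algebra_simps)
  then have "mu y ?j (J ?u) = ?u" by simp
  then have "mu y ?j ?u = mu y (mu y ?j ?j) (J ?u)" by (simp add: mu_assoc[OF y])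
  then show "mu y ?j ?u = J ?u" by (simp add: J_square[OF y] mu_G[OF y])
qed

lemma tr_mu_J: "y \<in> U \<Longrightarrow> tr (mu y (J (G y))) = 0"
  using apolar[of y "\<xi> y"] by (simp add: dg_\<xi>)

lemma J_tangent_image_iff: "y \<in> U \<Longrightarrow> v \<in> J ` tangent_image g y \<longleftrightarrow> \<pi> y (J v) = 0"
  using tangent_iff JJ by (metis image_iff)

text \<open>Differentiating the membership condition for \<open>Y\<close> along \<open>X\<close>
  gives \<open>key\<close>: up to the factor \<open>- l\<close>, the condition evaluated on the
  derivative of \<open>Y\<close> plus \<open>d2\<close> is \<open>p\<close> of the product of
  \<open>X\<close>, \<open>j\<close> and \<open>Y\<close>, with \<open>j = J (G y)\<close>.
  Commutativity and associativity make this symmetric in \<open>X\<close> and \<open>Y\<close>, as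
  is \<open>d2\<close>; subtracting leaves the bracket.\<close>

theorem bracket_closed:
  assumes OB: "open B" "B \<subseteq> U" and X: "smooth_on B X" and Y: "smooth_on B Y"
    and DX: "\<And>y. y \<in> B \<Longrightarrow> \<pi> y (J (dd (X y) g y)) = 0" and DY: "\<And>y. y \<in> B \<Longrightarrow> \<pi> y (J (dd (Y y) g y)) = 0"
    and y: "y \<in> B"
  shows "\<pi> y (J (dd (lie_bracket X Y y) g y)) = 0"
proof -
  have yU: "y \<in> U" using y OB by blast
  have sW: "smooth_on B F" if "smooth_on U F" for F :: "real^'d \<Rightarrow> 'z::real_normed_vector"
    by (rule smooth_on_subset[OF that OB(2)])
  have key: "- l * \<pi> y (J (d2 y (X y) (Y y) + dd (dd (X y) Y y) g y)) = p y (mu y (dd (X y) g y) (mu y (J (G y)) (dd (Y y) g y)))"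
    if X: "smooth_on B X" and Y: "smooth_on B Y" and DY: "\<And>y. y \<in> B \<Longrightarrow> \<pi> y (J (dd (Y y) g y)) = 0" for X Y
  proof -
    let ?b = "\<lambda>x. J (dd (Y x) g x)"
    have sdg: "smooth_on B (\<lambda>x. dd (Y x) g x)"
      by (rule smooth_on_linear_family[OF OB(1) _ sW[OF sm_g] Y]) (use dg_linear OB in blast)
    have sb: "smooth_on B ?b" by (rule smooth_on_linear[OF OB(1) J sdg])
    have l\<pi>: "linear (\<pi> x)" if "x \<in> B" for x using \<pi>_linear OB that by blast
    have "dd (X y) (\<lambda>x. \<pi> x (?b x)) y = dd (X y) (\<lambda>x. 0) y"
      by (rule dd_cong[OF OB(1) y]) (rule DY)
    moreover have "dd (X y) (\<lambda>x. \<pi> x (?b x)) y = dd (X y) (\<lambda>x. \<pi> x (?b y)) y + \<pi> y (dd (X y) ?b y)"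
      by (rule dd_linear_family[OF OB(1) l\<pi> sW[OF sm_\<pi>] sb y])
    moreover have "dd (X y) ?b y = J (d2 y (X y) (Y y) + dd (dd (X y) Y y) g y)"
    proof -
      have "dd (X y) ?b y = J (dd (X y) (\<lambda>x. dd (Y x) g x) y)"
        by (rule dd_linear[OF J smooth_on_differentiable[OF sdg y]])
      also have "dd (X y) (\<lambda>x. dd (Y x) g x) y = d2 y (X y) (Y y) + dd (dd (X y) Y y) g y"
        unfolding d2_def
        by (rule dd_linear_family[OF OB(1) _ sW[OF sm_g] Y y]) (use dg_linear OB in blast)
      finally show ?thesis .
    qed
    moreover have "dd (X y) (\<lambda>x. \<pi> x (?b y)) y = - h y (X y) (\<rho> y (?b y))"
    proof -
      have "?b y = dd (\<rho> y (?b y)) g y" using decomposition[OF yU, of "?b y"] DY[OF y] by simp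
      then show ?thesis using dd_\<pi>_tangent[OF yU, where w="X y" and v="\<rho> y (?b y)"] by simp
    qed
    moreover have "- l * h y (X y) (\<rho> y (?b y)) = p y (mu y (dd (X y) g y) (?b y))"
      using yU by (simp add: mu_components[OF yU])
    ultimately show ?thesis by (simp add: mu_J[OF yU])
  qed
  interpret comm_algebra "mu y" "G y" by (rule comm_algebra[OF yU])
  have "- l * \<pi> y (J (d2 y (X y) (Y y) + dd (dd (X y) Y y) g y)) = - l * \<pi> y (J (d2 y (Y y) (X y) + dd (dd (Y y) X y) g y))"
    by (rule trans[OF key[OF X Y DY] trans[OF _ key[OF Y X DX, symmetric]]]) (simp_all only: mu_ac)
  then have "\<pi> y (J (d2 y (X y) (Y y) + dd (dd (X y) Y y) g y)) = \<pi> y (J (d2 y (Y y) (X y) + dd (dd (Y y) X y) g y))"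
    using l by simp
  then show ?thesis
    unfolding lie_bracket_def D_def d2_sym[OF yU, of "Y y" "X y"]
    by (simp add: linear_diff[OF dg_linear[OF yU]] linear_diff[OF J] linear_add[OF J]
      linear_add[OF \<pi>_linear[OF yU]] linear_diff[OF \<pi>_linear[OF yU]])
qed

end

section \<open>Affine hyperspheres in a chart\<close>

lemma position_bij: "bij_betw (position :: 'k::finite \<Rightarrow> nat) UNIV {1..CARD('k)}"
proof -
  obtain q where "bij_betw q {1..CARD('k)} (UNIV :: 'k set)"
    using ex_bij_betw_nat_finite_1[of "UNIV :: 'k set"] by auto
  then have "\<exists>q. bij_betw q (UNIV :: 'k set) {1..CARD('k)}" using bij_betw_inv by blast
  then show ?thesis unfolding position_def by (rule someI_ex)
qed

lemma position_range: "1 \<le> position (k :: 'k::finite)" "position (k :: 'k) \<le> CARD('k)"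
  using bij_betwE[OF position_bij[where 'k='k]] by auto

lemma position_inj: "position (k :: 'k::finite) = position k' \<longleftrightarrow> k = k'"
  using inj_on_eq_iff[OF bij_betw_imp_inj_on[OF position_bij], of k k'] by simp

lemma inv_position [simp]: "inv position (position (k :: 'k::finite)) = k"
  by (rule inv_f_f[OF bij_betw_imp_inj_on[OF position_bij]])

lemma position_inv: "1 \<le> i \<Longrightarrow> i \<le> CARD('k) \<Longrightarrow> position (inv position i :: 'k::finite) = i"
  using position_bij[where 'k='k] by (intro f_inv_into_f) (auto simp: bij_betw_def)

lemma coord_position_inj: "inj (coord_position :: 'k::finite + 'k \<Rightarrow> nat)"
proof (rule injI)
  fix a b :: "'k + 'k" assume "coord_position a = coord_position b"
  moreover have "position x \<noteq> CARD('k) + position y" for x y :: 'k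
    using position_range(2)[of x] position_range(1)[of y] by linarith
  moreover have "CARD('k) + position x \<noteq> position y" for x y :: 'k
    using position_range(2)[of y] position_range(1)[of x] by linarith
  ultimately show "a = b"
    by (cases a; cases b) (simp_all add: coord_position_def position_inj)
qed

lemma coord_position_range:
  "1 \<le> coord_position (a :: 'k::finite + 'k)" "coord_position (a :: 'k + 'k) \<le> 2 * CARD('k)"
proof -
  have "1 \<le> coord_position a \<and> coord_position a \<le> 2 * CARD('k)"
  proof (cases a)
    case (Inl b)
    then show ?thesis using position_range[of b] by (simp add: coord_position_def)
  next
    case (Inr b)
    then show ?thesis using position_range[of b] by (simp add: coord_position_def)
  qed
  then show "1 \<le> coord_position a" "coord_position a \<le> 2 * CARD('k)" by simp_all
qed

lemma coord_position_inv:
  assumes "1 \<le> i" "i \<le> 2 * CARD('k)"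
  shows "coord_position (inv coord_position i :: 'k::finite + 'k) = i"
proof (rule f_inv_into_f)
  show "i \<in> range (coord_position :: 'k + 'k \<Rightarrow> nat)"
  proof (cases "i \<le> CARD('k)")
    case True
    then show ?thesis using position_inv[of i, where 'k='k] assms
      by (intro image_eqI[of _ _ "Inl (inv position i)"]) (auto simp: coord_position_def)
  next
    case False
    then show ?thesis using position_inv[of "i - CARD('k)", where 'k='k] assms
      by (intro image_eqI[of _ _ "Inr (inv position (i - CARD('k)))"]) (auto simp: coord_position_def)
  qed
qed

lemma linear_J_tilde: "linear J_tilde"
  by (rule linearI) (auto simp: J_tilde_def vec_eq_iff split: sum.split)

lemma J_tilde_J_tilde: "J_tilde (J_tilde v) = v"
  by (auto simp: J_tilde_def vec_eq_iff split: sum.split)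

section \<open>The volume of frames along the immersion\<close>

context transversal_immersion
begin

definition coords :: "real^'d \<Rightarrow> real^'e \<Rightarrow> real^'e" where
  "coords y v = (\<chi> j. case \<sigma> j of Some a \<Rightarrow> \<rho> y v $ a | None \<Rightarrow> \<pi> y v)"

lemma P_coords: "y \<in> U \<Longrightarrow> P y *v coords y v = v"
  using decomposition[of y v] by (simp add: P_mult coords_def)

text \<open>The sum is the trace of the induced connection on the standard frame, and
  \<open>\<pi> y (dd u c y)\<close> is \<open>\<tau>(u)\<close>. Comparison with a parallel volume
  form therefore isolates \<open>\<tau>\<close>.\<close>

lemma dd_det_frame:
  assumes y: "y \<in> U"
  shows "dd u (\<lambda>x. det (P x)) y =
    ((\<Sum>a\<in>UNIV. \<rho> y (d2 y u (axis a 1)) $ a) + \<pi> y (dd u c y)) * det (P y)"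
proof -
  let ?col = "\<lambda>k. case \<sigma> k of Some a \<Rightarrow> d2 y u (axis a 1) | None \<Rightarrow> dd u c y"
  define B where "B = (\<chi> j k. coords y (?col k) $ j)"
  have "(P y ** B) $ i $ j = (P y *v coords y (?col j)) $ i" for i j
    by (simp add: matrix_matrix_mult_def matrix_vector_mult_def B_def)
  then have PB: "(P y ** B) $ i $ j = ?col j $ i" for i j by (simp add: P_coords[OF y])
  have "dd u (\<lambda>x. P x $ i $ j) y = (P y ** B) $ i $ j" for i j
    unfolding PB
    by (cases "\<sigma> j")
      (simp_all add: P_def dd_nth smooth_on_differentiable[OF c y] smooth_on_differentiable[OF sm_g y] d2_def)
  then have "dd u (\<lambda>x. det (P x)) y = trace B * det (P y)"
    by (rule dd_det_right[rotated]) (rule smooth_on_differentiable[OF sm_P y])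
  moreover have "trace B = (\<Sum>j\<in>UNIV. (\<lambda>s. case s of Some a \<Rightarrow> \<rho> y (d2 y u (axis a 1)) $ a | None \<Rightarrow> \<pi> y (dd u c y)) (\<sigma> j))"
    unfolding trace_def by (intro sum.cong refl) (simp add: B_def coords_def split: option.split)
  ultimately show ?thesis by (simp add: sum_\<sigma> add.commute)
qed

lemma det_replace_column:
  assumes y: "y \<in> U"
  shows "det (\<chi> i j. (if \<sigma> j = Some a then dd w g y else
      (case \<sigma> j of Some b \<Rightarrow> dd (axis b 1) g y | None \<Rightarrow> c y)) $ i) = w $ a * det (P y)"
proof -
  have "coords y (dd w g y) $ inv \<sigma> (Some a) = w $ a" using y by (simp add: coords_def)
  moreover have "(\<chi> i j. (if \<sigma> j = Some a then dd w g y else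
      (case \<sigma> j of Some b \<Rightarrow> dd (axis b 1) g y | None \<Rightarrow> c y)) $ i)
    = (\<chi> i j. if j = inv \<sigma> (Some a) then (P y *v coords y (dd w g y)) $ i else P y $ i $ j)"
  proof -
    have "\<sigma> j = Some a \<longleftrightarrow> j = inv \<sigma> (Some a)" for j using inv_\<sigma> by metis
    then show ?thesis by (simp add: vec_eq_iff P_coords[OF y]) (simp add: P_def)
  qed
  ultimately show ?thesis by (simp add: cramer_lemma)
qed

end

text \<open>The column convention of \<open>Theta\<close>: when the dimensions match as in
  \<open>frame_column_bij\<close>, exactly one position lies beyond the frame, and this
  \<open>None\<close> carries the transversal vector.\<close>

definition frame_column :: "'k::finite + 'k \<Rightarrow> 'd::finite option" where
  "frame_column j = (if coord_position j \<le> CARD('d) then Some (inv position (coord_position j)) else None)"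

lemma frame_column_bij:
  assumes "2 * CARD('k) = CARD('d) + 1"
  shows "bij (frame_column :: 'k::finite + 'k \<Rightarrow> 'd::finite option)"
proof (rule bijI)
  show "inj (frame_column :: 'k + 'k \<Rightarrow> 'd option)"
  proof (rule injI)
    fix a b :: "'k + 'k" assume eq: "(frame_column a :: 'd option) = frame_column b"
    have "coord_position a = coord_position b"
    proof (cases "coord_position a \<le> CARD('d)")
      case True
      then have b: "coord_position b \<le> CARD('d)"
        and "(inv position (coord_position a) :: 'd) = inv position (coord_position b)"
        using eq by (auto simp: frame_column_def split: if_splits)
      then show ?thesis
        using position_inv[OF coord_position_range(1) True] position_inv[OF coord_position_range(1) b] by metis
    next
      case False
      then have "\<not> coord_position b \<le> CARD('d)"
        using eq by (auto simp: frame_column_def split: if_splits)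
      then show ?thesis
        using False coord_position_range(2)[of a] coord_position_range(2)[of b] assms by linarith
    qed
    then show "a = b" by (rule injD[OF coord_position_inj])
  qed
  show "surj (frame_column :: 'k + 'k \<Rightarrow> 'd option)"
    unfolding surj_def
  proof
    fix s :: "'d option"
    show "\<exists>j :: 'k + 'k. s = frame_column j"
    proof (cases s)
      case None
      have "1 \<le> 2 * CARD('k)" using assms by simp
      then have "s = frame_column (inv coord_position (2 * CARD('k)) :: 'k + 'k)"
        using None assms coord_position_inv[of "2 * CARD('k)", where 'k='k]
        by (simp add: frame_column_def)
      then show ?thesis by blast
    next
      case (Some d)
      have "position d \<le> 2 * CARD('k)" using position_range(2)[of d] assms by simp
      then have "s = frame_column (inv coord_position (position d) :: 'k + 'k)"
        using Some position_range[of d] coord_position_inv[of "position d", where 'k='k]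
        by (simp add: frame_column_def)
      then show ?thesis by blast
    qed
  qed
qed

section \<open>The Blaschke conditions in a chart\<close>

locale hypersphere_chart = transversal_immersion U g c "frame_column"
  for U :: "(real^'d) set" and g c :: "real^'d \<Rightarrow> real^('k::finite + 'k)" +
  fixes l :: real
  assumes shape_op_eq: "y \<in> U \<Longrightarrow> shape_op g c y u = l *\<^sub>R u"
    and nondeg_h: "y \<in> U \<Longrightarrow> u \<noteq> 0 \<Longrightarrow> \<exists>v. h_form g c y u v \<noteq> 0"
    and omega_Theta: "y \<in> U \<Longrightarrow> omega_h g c y E = Theta g c y E"
    and parallel: "smooth_on U Z \<Longrightarrow> (\<And>i. smooth_on U (X i)) \<Longrightarrow> y \<in> U \<Longrightarrow>
        D Z (\<lambda>p. omega_h g c p (\<lambda>j. X j p)) y =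
        (\<Sum>i\<in>{1..CARD('d)}. omega_h g c y ((\<lambda>j. X j y)(i := nabla g c Z (X i) y)))"
    and flat_h: "y \<in> U \<Longrightarrow> plane_discriminant (h_form g c) y u v \<noteq> 0 \<Longrightarrow>
        sectional_curvature (h_form g c) y u v = 0"
    and J_tangent: "y \<in> U \<Longrightarrow> J_tilde (c y) \<in> tangent_image g y"
    and card_d: "CARD('d) \<ge> 2"
begin

definition std_frame :: "nat \<Rightarrow> real^'d" where "std_frame i = axis (inv position i) 1"

lemma Theta_eq: "Theta g c y X = det (\<chi> i j. (case frame_column j of
    Some (a :: 'd) \<Rightarrow> dd (X (position a)) g y | None \<Rightarrow> c y) $ i)"
proof -
  have "(if coord_position j \<le> CARD('d) then dd (X (coord_position j)) g y else c y) =
    (case frame_column j of Some (a :: 'd) \<Rightarrow> dd (X (position a)) g y | None \<Rightarrow> c y)" for j :: "'k + 'k"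
  proof (cases "coord_position j \<le> CARD('d)")
    case True
    then show ?thesis using position_inv[OF coord_position_range(1) True] by (simp add: frame_column_def)
  qed (simp add: frame_column_def)
  then show ?thesis unfolding Theta_def by (simp only:)
qed

lemma Theta_std: "Theta g c y std_frame = det (P y)"
  unfolding Theta_eq P_def std_frame_def inv_position ..

lemma Theta_std_update:
  assumes y: "y \<in> U" and i: "1 \<le> i" "i \<le> CARD('d)"
  shows "Theta g c y (std_frame(i := w)) = w $ inv position i * det (P y)"
proof -
  have "(case frame_column j of Some (a :: 'd) \<Rightarrow> dd ((std_frame(i := w)) (position a)) g y | None \<Rightarrow> c y)
    = (if frame_column j = Some (inv position i :: 'd) then dd w g y else
      (case frame_column j of Some b \<Rightarrow> dd (axis b 1) g y | None \<Rightarrow> c y))" for j :: "'k + 'k"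
  proof (cases "frame_column j :: 'd option")
    case (Some b)
    have "position b = i \<longleftrightarrow> b = inv position i" using position_inv[OF i] by auto
    then show ?thesis using Some by (simp add: std_frame_def)
  qed simp
  then show ?thesis unfolding Theta_eq det_replace_column[OF y, symmetric] by (simp only:)
qed

text \<open>\<open>parallel\<close> is applied to the constant standard frame, whose volume is
  \<open>det (P p)\<close>. It gives as derivative the trace of the induced connection times this
  determinant, whereas \<open>dd_det_frame\<close> has in addition \<open>\<tau>\<close> times the
  nonzero determinant.\<close>

lemma tau_zero: assumes y: "y \<in> U" shows "\<pi> y (dd u c y) = 0"
proof -
  have "dd u (\<lambda>p. det (P p)) y = dd u (\<lambda>p. omega_h g c p std_frame) y"
    by (rule dd_cong[OF U y]) (simp add: omega_Theta Theta_std)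
  also have "\<dots> = (\<Sum>i\<in>{1..CARD('d)}. omega_h g c y (std_frame(i := \<rho> y (d2 y u (std_frame i)))))"
    using parallel[of "\<lambda>_. u" "\<lambda>i _. std_frame i", OF smooth_on_const smooth_on_const y]
    by (simp add: D_def nabla_def push_def[abs_def] d2_def)
  also have "\<dots> = (\<Sum>i\<in>{1..CARD('d)}. \<rho> y (d2 y u (std_frame i)) $ inv position i * det (P y))"
    by (intro sum.cong refl) (simp add: omega_Theta[OF y] Theta_std_update[OF y])
  also have "\<dots> = (\<Sum>a\<in>UNIV. \<rho> y (d2 y u (axis a 1)) $ a * det (P y))"
    unfolding sum.reindex_bij_betw[OF position_bij, symmetric] by (simp add: std_frame_def)
  finally have "\<pi> y (dd u c y) * det (P y) = 0"
    unfolding dd_det_frame[OF y] sum_distrib_right[symmetric] by (simp add: algebra_simps)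
  then show ?thesis using det_P[OF y] by simp
qed

lemma dd_c: assumes y: "y \<in> U" shows "dd u c y = - l *\<^sub>R dd u g y"
proof -
  have "\<rho> y (dd u c y) = - l *\<^sub>R u"
    using shape_op_eq[OF y, of u] by (simp add: shape_op_def D_def minus_equation_iff[of "\<rho> y _"])
  then show ?thesis
    using decomposition[OF y, of "dd u c y"] tau_zero[OF y, of u]
    by (simp add: linear_neg[OF dg_linear[OF y]] linear_cmul[OF dg_linear[OF y]])
qed

lemma nondeg_h': assumes "y \<in> U" "\<And>v. h y u v = 0" shows "u = 0"
  using nondeg_h[OF assms(1), of u] assms(2) by (auto simp: h_form_eq)

lemma l_nonzero: assumes y: "y \<in> U" shows "l \<noteq> 0"
proof
  assume l: "l = 0"
  let ?J = "J_tilde :: real^('k + 'k) \<Rightarrow> real^('k + 'k)"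
  have sJ: "smooth_on U (\<lambda>x. ?J (c x))" by (rule smooth_on_linear[OF U linear_J_tilde c])
  have "\<pi> y (?J (c y)) = 0" using J_tangent tangent_iff y by blast
  then have d: "?J (c y) = dd (\<rho> y (?J (c y))) g y" using decomposition[OF y, of "?J (c y)"] by simp
  have "h y u (\<rho> y (?J (c y))) = 0" for u
  proof -
    have "dd u (\<lambda>x. \<pi> x (?J (c x))) y = dd u (\<lambda>x. 0) y"
      by (rule dd_cong[OF U y]) (use J_tangent tangent_iff in blast)
    moreover have "dd u (\<lambda>x. \<pi> x (?J (c x))) y = dd u (\<lambda>x. \<pi> x (?J (c y))) y + \<pi> y (dd u (\<lambda>x. ?J (c x)) y)"
      by (rule dd_\<pi>[OF _ sJ y])
    moreover have "dd u (\<lambda>x. ?J (c x)) y = 0"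
      using dd_linear[OF linear_J_tilde smooth_on_differentiable[OF c y], of u] dd_c[OF y, of u] l
      by (simp add: linear_0[OF linear_J_tilde])
    moreover have "dd u (\<lambda>x. \<pi> x (?J (c y))) y = - h y u (\<rho> y (?J (c y)))"
      using dd_\<pi>_tangent[OF y, where w=u and v="\<rho> y (?J (c y))"] d by simp
    ultimately show ?thesis by (simp add: linear_0[OF \<pi>_linear[OF y]])
  qed
  then have "\<rho> y (?J (c y)) = 0" using nondeg_h'[OF y] h_sym[OF y] by metis
  then have "?J (c y) = 0" using d by (simp add: linear_0[OF dg_linear[OF y]])
  then have "c y = 0" using J_tilde_J_tilde[of "c y"] by (simp add: linear_0[OF linear_J_tilde])
  then have "c y = dd 0 g y" by (simp add: linear_0[OF dg_linear[OF y]])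
  then show False using transv[OF y] by (simp add: tangent_image_def)
qed

lemma volume: assumes y: "y \<in> U"
  shows "det (P y) ^ 4 = (det (\<chi> i j. h y (axis i 1) (axis j 1))) ^ 2"
proof -
  let ?d = "det (\<chi> i j. h y (axis i 1) (axis j 1))"
  have "omega_h g c y std_frame = det (P y)" by (simp add: omega_Theta[OF y] Theta_std)
  then have "sgn (det (P y)) * sqrt \<bar>?d\<bar> = det (P y)"
    by (simp add: omega_h_def Theta_std h_form_eq std_frame_def)
  from arg_cong[OF this, of "\<lambda>x. x\<^sup>2"] have "(sgn (det (P y)))\<^sup>2 * \<bar>?d\<bar> = det (P y) ^ 2"
    by (simp add: power_mult_distrib)
  moreover have "(sgn (det (P y)))\<^sup>2 = 1" using det_P[OF y] by (simp add: sgn_if)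
  ultimately have "\<bar>?d\<bar> = det (P y) ^ 2" by simp
  then have "\<bar>?d\<bar>\<^sup>2 = (det (P y) ^ 2)\<^sup>2" by simp
  then show ?thesis by (simp flip: power_mult)
qed

theorem tangent_involution:
  assumes "U \<noteq> {}" shows "tangent_involution U g c frame_column l J_tilde"
proof (intro tangent_involution.intro tangent_involution_axioms.intro flat_hypersphere_chart.intro
    flat_hypersphere_chart_axioms.intro transversal_immersion_axioms)
  show "l \<noteq> 0" using l_nonzero assms by blast
  show "dd u c y = - l *\<^sub>R dd u g y" if "y \<in> U" for y u by (rule dd_c[OF that])
  show "2 \<le> CARD('d)" by (rule card_d)
  show "u = 0" if "y \<in> U" "\<And>v. h y u v = 0" for y u by (rule nondeg_h'[OF that])
  show "sectional_curvature h y u v = 0" if "y \<in> U" "plane_discriminant h y u v \<noteq> 0" for y u v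
    using flat_h[OF that(1), of u v] that(2) by (simp add: h_form_eq)
  show "det (P y) ^ 4 = (det (\<chi> i j. h y (axis i 1) (axis j 1)))\<^sup>2" if "y \<in> U" for y
    by (rule volume[OF that])
  show "linear (J_tilde :: real^('k + 'k) \<Rightarrow> real^('k + 'k))" by (rule linear_J_tilde)
  show "J_tilde (J_tilde v) = v" for v :: "real^('k + 'k)" by (rule J_tilde_J_tilde)
  show "J_tilde (c y) \<in> tangent_image g y" if "y \<in> U" for y by (rule J_tangent[OF that])
qed

end

section \<open>Level sets of products of quadratic forms\<close>

text \<open>Quantifying over all open \<open>V\<close> inside \<open>U\<close> lets the property
  pass to other points of \<open>U\<close> and to intersections of neighbourhoods, even where
  \<open>f\<close> identifies points.\<close>

definition level_chart :: "('m::topological_space \<Rightarrow> 'b::euclidean_space) \<Rightarrow> ('b \<Rightarrow> real) \<Rightarrow> 'm \<Rightarrow> bool" where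
  "level_chart f F p \<longleftrightarrow> (\<exists>U. open U \<and> p \<in> U \<and>
     (\<forall>V. open V \<and> V \<subseteq> U \<longrightarrow> (\<exists>B. open B \<and> f ` V = B \<inter> {v. F v = 1})))"

lemma quad_norm_along_line:
  fixes \<Phi> :: "'b::real_vector \<Rightarrow> real^('k::finite + 'k)"
  assumes "linear \<Phi>"
  shows "\<exists>q. \<forall>s. quad_norm \<epsilon> (\<Phi> (x + s *\<^sub>R v)) = poly q s"
proof (intro exI allI)
  show "quad_norm \<epsilon> (\<Phi> (x + s *\<^sub>R v)) =
    poly (\<Prod>k\<in>UNIV. [:\<Phi> x $ Inl k, \<Phi> v $ Inl k:]\<^sup>2 + [:\<epsilon> k:] * [:\<Phi> x $ Inr k, \<Phi> v $ Inr k:]\<^sup>2) s" for s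
    by (simp add: quad_norm_def poly_prod linear_add[OF assms] linear_cmul[OF assms])
qed

lemma continuous_quad_norm:
  fixes \<Phi> :: "'b::euclidean_space \<Rightarrow> real^('k::finite + 'k)"
  assumes "linear \<Phi>"
  shows "isCont (\<lambda>v. quad_norm \<epsilon> (\<Phi> v)) x"
proof -
  have c: "isCont (\<lambda>v. \<Phi> v $ i) x" for i
    using linear_continuous_at[of \<Phi>] assms linear_conv_bounded_linear[of \<Phi>] by (intro continuous_intros) blast
  show ?thesis unfolding quad_norm_def by (intro continuous_intros c)
qed

text \<open>By homogeneity, agreement of the unit levels near \<open>x0\<close> becomes equality of
  the forms on a neighbourhood of \<open>x0\<close>. On lines through \<open>x0\<close> the forms
  are polynomials, which an interval determines.\<close>

lemma level_chart_determines_form: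
  fixes f :: "'m::topological_space \<Rightarrow> 'b::euclidean_space" and \<Phi> \<Phi>' :: "'b \<Rightarrow> real^('k::finite + 'k)"
    and \<epsilon> \<epsilon>' :: "'k \<Rightarrow> real"
  defines "F \<equiv> \<lambda>v. quad_norm \<epsilon> (\<Phi> v)" and "F' \<equiv> \<lambda>v. quad_norm \<epsilon>' (\<Phi>' v)"
  assumes lin: "linear \<Phi>" "linear \<Phi>'" and lc: "level_chart f F p" "level_chart f F' p"
  shows "F = F'"
proof
  fix v
  define m where "m = 2 * CARD('k)"
  have m: "m > 0" by (simp add: m_def)
  have hom: "F (s *\<^sub>R v) = s ^ m * F v" "F' (s *\<^sub>R v) = s ^ m * F' v" for s v
    by (simp_all add: F_def F'_def m_def linear_cmul[OF lin(1)] linear_cmul[OF lin(2)] quad_norm_scale)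
  obtain U U' where U: "open U" "p \<in> U" "\<And>V. open V \<Longrightarrow> V \<subseteq> U \<Longrightarrow> \<exists>B. open B \<and> f ` V = B \<inter> {v. F v = 1}"
    and U': "open U'" "p \<in> U'" "\<And>V. open V \<Longrightarrow> V \<subseteq> U' \<Longrightarrow> \<exists>B. open B \<and> f ` V = B \<inter> {v. F' v = 1}"
    using lc unfolding level_chart_def by metis
  have V: "open (U \<inter> U')" "p \<in> U \<inter> U'" using U U' by auto
  obtain B where B: "open B" "f ` (U \<inter> U') = B \<inter> {v. F v = 1}" using U(3)[OF V(1)] by blast
  obtain B' where B': "open B'" "f ` (U \<inter> U') = B' \<inter> {v. F' v = 1}" using U'(3)[OF V(1)] by blast
  define x0 where "x0 = f p"
  have "x0 \<in> f ` (U \<inter> U')" using V(2) by (simp add: x0_def)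
  then have x0: "x0 \<in> B \<inter> B'" "F x0 = 1" using B(2) B'(2) by auto
  have FF': "F' x = 1" if "x \<in> B \<inter> B'" "F x = 1" for x
  proof -
    have "x \<in> f ` (U \<inter> U')" using that B(2) by auto
    then show ?thesis using B'(2) by auto
  qed
  have contF: "isCont F x0" unfolding F_def by (rule continuous_quad_norm[OF lin(1)])
  \<comment> \<open>By homogeneity of degree \<open>m\<close>, this factor scales \<open>x\<close>
    to the unit level wherever \<open>F x > 0\<close>.\<close>
  define r where "r x = 1 / root m (F x)" for x
  have "isCont (\<lambda>x. r x *\<^sub>R x) x0"
    unfolding r_def using contF m x0 by (intro continuous_intros isCont_o2[OF contF isCont_real_root]) auto
  moreover have "r x0 *\<^sub>R x0 \<in> B \<inter> B'" using x0 m by (simp add: r_def)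
  ultimately have e1: "\<forall>\<^sub>F x in nhds x0. r x *\<^sub>R x \<in> B \<inter> B'"
    using B(1) B'(1) unfolding continuous_at_open eventually_nhds by (metis open_Int)
  have e2: "\<forall>\<^sub>F x in nhds x0. F x > 0"
  proof -
    have "(F \<longlongrightarrow> F x0) (nhds x0)" using contF by (simp add: isCont_def tendsto_at_iff_tendsto_nhds)
    then show ?thesis by (rule order_tendstoD(1)) (simp add: x0)
  qed
  have "\<forall>\<^sub>F x in nhds x0. F x = F' x"
    using e1 e2
  proof eventually_elim
    case (elim x)
    have rm: "r x ^ m * F x = 1"
      using elim(2) m by (simp add: r_def power_divide real_root_pow_pos2)
    then have "F' (r x *\<^sub>R x) = 1" using FF'[OF elim(1)] by (simp add: hom)
    then have "r x ^ m * F' x = r x ^ m * F x" using rm by (simp add: hom)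
    moreover have "r x ^ m \<noteq> 0"
    proof
      assume "r x ^ m = 0"
      then show False using rm by (metis mult_zero_left zero_neq_one)
    qed
    ultimately show ?case by (metis mult_left_cancel)
  qed
  moreover have "((\<lambda>s. x0 + s *\<^sub>R (v - x0)) \<longlongrightarrow> x0) (at_right (0::real))"
    by (auto intro!: tendsto_eq_intros)
  ultimately have ev: "\<forall>\<^sub>F s in at_right 0. F (x0 + s *\<^sub>R (v - x0)) = F' (x0 + s *\<^sub>R (v - x0))"
    by (rule eventually_compose_filterlim)
  \<comment> \<open>Along the line both forms are polynomials in \<open>s\<close>, so agreement for
    small positive \<open>s\<close> extends to \<open>s = 1\<close>, which is the point
    \<open>v\<close>.\<close>
  obtain q q' where q: "\<And>s. F (x0 + s *\<^sub>R (v - x0)) = poly q s" "\<And>s. F' (x0 + s *\<^sub>R (v - x0)) = poly q' s"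
    using quad_norm_along_line[OF lin(1)] quad_norm_along_line[OF lin(2)] unfolding F_def F'_def by metis
  obtain d where d: "d > 0" "\<And>s. 0 < s \<Longrightarrow> s < d \<Longrightarrow> poly q s = poly q' s"
    using ev unfolding q eventually_at_right_field by blast
  have "q = q'"
  proof (rule ccontr)
    assume "q \<noteq> q'"
    then have "finite {s. poly (q - q') s = 0}" by (intro poly_roots_finite) simp
    moreover have "{0<..<d} \<subseteq> {s. poly (q - q') s = 0}" using d(2) by auto
    ultimately have "finite {0<..<d}" using finite_subset by blast
    then show False using infinite_Ioo[OF d(1)] by blast
  qed
  then have "F (x0 + 1 *\<^sub>R (v - x0)) = F' (x0 + 1 *\<^sub>R (v - x0))" unfolding q by simp
  then show "F v = F' v" by simp
qed

lemma affine_equivalentI: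
  fixes L :: "'b::euclidean_space \<Rightarrow> 'b"
  assumes L: "linear L" "bij L" and FL: "\<And>v. F v = 1 \<longleftrightarrow> L v \<in> \<Sigma>"
    and lc: "\<And>p. level_chart (\<lambda>q. f q - b) F p"
  shows "affine_equivalent f \<Sigma>"
  unfolding affine_equivalent_def
proof
  fix p
  obtain U B where U: "open U" "p \<in> U" and B: "open B" "(\<lambda>q. f q - b) ` U = B \<inter> {v. F v = 1}"
    using lc[of p] unfolding level_chart_def by (metis subset_refl)
  have "(\<lambda>v. L v + - L b) ` f ` U = L ` ((\<lambda>q. f q - b) ` U)"
    by (simp add: image_image linear_diff[OF L(1)])
  also have "\<dots> = L ` B \<inter> \<Sigma>"
    unfolding B(2) using FL bij_is_inj[OF L(2)] by auto
  finally have "(\<lambda>v. L v + - L b) ` f ` U = \<Sigma> \<inter> L ` B" by blast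
  moreover have "open (L ` B)"
    by (rule open_surjective_linear_image[OF B(1) L(1) bij_is_surj[OF L(2)]])
  ultimately have "openin (top_of_set \<Sigma>) ((\<lambda>v. L v + - L b) ` f ` U)"
    by (simp add: openin_open_Int)
  then show "\<exists>U L b. open U \<and> p \<in> U \<and> linear L \<and> bij L \<and> openin (top_of_set \<Sigma>) ((\<lambda>v. L v + b) ` f ` U)"
    using U L by blast
qed

section \<open>Linear coordinates for the normal forms\<close>

lemma exists_numbering:
  fixes k0 :: "'k::finite"
  obtains \<theta> :: "'k \<Rightarrow> nat" where "bij_betw \<theta> UNIV {1..CARD('k)}" "\<theta> k0 = CARD('k)"
proof -
  let ?N = "CARD('k)"
  \<comment> \<open>The canonical numbering with \<open>k0\<close> exchanged for the element in last
    place.\<close>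
  define \<theta> where "\<theta> k = (if k = k0 then ?N else if position k = ?N then position k0 else position k)" for k :: 'k
  have "inj \<theta>"
    by (rule injI) (auto simp: \<theta>_def position_inj split: if_splits dest: sym)
  moreover have "\<theta> k \<in> {1..?N}" for k
    using position_range[of k] position_range[of k0] by (auto simp: \<theta>_def)
  then have "\<theta> ` UNIV \<subseteq> {1..?N}" by blast
  ultimately have "\<theta> ` UNIV = {1..?N}" by (intro card_subset_eq) (simp_all add: card_image)
  then have "bij_betw \<theta> UNIV {1..?N}" using \<open>inj \<theta>\<close> by (simp add: bij_betw_def)
  then show thesis using that by (simp add: \<theta>_def)
qed

lemma numbered_coordinates_map:
  fixes \<Phi> :: "real^('k::finite + 'k) \<Rightarrow> real^('k + 'k)" and q :: "nat \<Rightarrow> real^('k + 'k) \<Rightarrow> real"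
  assumes \<Phi>: "linear \<Phi>" "bij \<Phi>" and lin: "\<And>m. linear (q m)"
    and inj: "\<And>w. (\<And>m. 1 \<le> m \<Longrightarrow> m \<le> 2 * CARD('k) \<Longrightarrow> q m w = 0) \<Longrightarrow> w = 0"
  obtains L :: "real^('k + 'k) \<Rightarrow> real^('k + 'k)" where "linear L" "bij L"
    "\<And>m v. 1 \<le> m \<Longrightarrow> m \<le> 2 * CARD('k) \<Longrightarrow> coord m (L v) = q m (\<Phi> v)"
proof -
  define L where "L v = (\<chi> j::'k + 'k. q (coord_position j) (\<Phi> v))" for v
  have L: "linear L"
    unfolding L_def
    by (intro linearI) (simp_all add: vec_eq_iff linear_add[OF \<Phi>(1)] linear_cmul[OF \<Phi>(1)]
      linear_add[OF lin] linear_cmul[OF lin])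
  have co: "coord m (L v) = q m (\<Phi> v)" if "1 \<le> m" "m \<le> 2 * CARD('k)" for m v
    by (simp only: coord_def L_def vec_lambda_beta coord_position_inv[where 'k='k, OF that])
  have "inj L"
  proof (subst linear_injective_0[OF L], safe)
    fix v assume Lv: "L v = 0"
    have "q m (\<Phi> v) = 0" if "1 \<le> m" "m \<le> 2 * CARD('k)" for m
      using co[OF that, of v] by (simp add: Lv coord_def)
    then have "\<Phi> v = 0" by (rule inj)
    then show "v = 0" using bij_is_inj[OF \<Phi>(2)] linear_injective_0[OF \<Phi>(1)] by blast
  qed
  moreover from this have "surj L" using linear_injective_imp_surjective[OF L] by simp
  ultimately have "bij L" by (simp add: bij_def)
  then show thesis using that L co by blast
qed

context
  fixes \<theta> :: "'k::finite \<Rightarrow> nat"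
  assumes \<theta>: "bij_betw \<theta> UNIV {1..CARD('k)}"
begin

lemma inv_numbering [simp]: "inv \<theta> (\<theta> k) = k"
  by (rule inv_f_f[OF bij_betw_imp_inj_on[OF \<theta>]])

lemma numbering_range: "1 \<le> \<theta> k" "\<theta> k \<le> CARD('k)"
  using bij_betwE[OF \<theta>] by auto

text \<open>\<open>coord\<close> numbers all \<open>Inl\<close> components before the
  \<open>Inr\<close> components, whereas the normal form pairs coordinates \<open>2 i - 1\<close>
  and \<open>2 i\<close>. Here the two components of factor \<open>i\<close> receive these
  consecutive numbers.\<close>

definition pair_coordinate :: "nat \<Rightarrow> real^('k + 'k) \<Rightarrow> real" where
  "pair_coordinate m w = (if odd m then w $ Inl (inv \<theta> ((m + 1) div 2)) else w $ Inr (inv \<theta> (m div 2)))"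

lemma linear_pair_coordinate: "linear (pair_coordinate m)"
  by (rule linearI) (simp_all add: pair_coordinate_def)

lemma pair_coordinate:
  "1 \<le> i \<Longrightarrow> pair_coordinate (2 * i - 1) w = w $ Inl (inv \<theta> i)" "pair_coordinate (2 * i) w = w $ Inr (inv \<theta> i)"
  by (simp_all add: pair_coordinate_def)

lemma quad_norm_numbered:
  "quad_norm \<epsilon> w = (\<Prod>i\<in>{1..CARD('k)}. (w $ Inl (inv \<theta> i))\<^sup>2 + \<epsilon> (inv \<theta> i) * (w $ Inr (inv \<theta> i))\<^sup>2)"
  unfolding quad_norm_def prod.reindex_bij_betw[OF \<theta>, symmetric] by simp

lemma coordinates_all_signs:
  fixes \<Phi> :: "real^('k + 'k) \<Rightarrow> real^('k + 'k)"
  assumes \<Phi>: "linear \<Phi>" "bij \<Phi>"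
  obtains L :: "real^('k + 'k) \<Rightarrow> real^('k + 'k)" where "linear L" "bij L"
    "\<And>v. quad_norm \<epsilon> (\<Phi> v) =
      (\<Prod>i\<in>{1..CARD('k)}. (coord (2*i-1) (L v))\<^sup>2 + \<epsilon> (inv \<theta> i) * (coord (2*i) (L v))\<^sup>2)"
proof -
  have inj: "w = 0" if z: "\<And>m. 1 \<le> m \<Longrightarrow> m \<le> 2 * CARD('k) \<Longrightarrow> pair_coordinate m w = 0" for w
  proof -
    have "w $ Inl k = 0" "w $ Inr k = 0" for k
      using z[of "2 * \<theta> k - 1"] z[of "2 * \<theta> k"] numbering_range[of k] pair_coordinate[of "\<theta> k" w] by auto
    then have "w $ j = 0" for j by (cases j) auto
    then show ?thesis by (simp add: vec_eq_iff)
  qed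
  obtain L :: "real^('k + 'k) \<Rightarrow> real^('k + 'k)" where L: "linear L" "bij L"
    "\<And>m v. 1 \<le> m \<Longrightarrow> m \<le> 2 * CARD('k) \<Longrightarrow> coord m (L v) = pair_coordinate m (\<Phi> v)"
    by (rule numbered_coordinates_map[OF \<Phi> linear_pair_coordinate inj]) (assumption, rule that)
  show thesis
  proof (rule that[OF L(1,2)])
    show "quad_norm \<epsilon> (\<Phi> v) =
      (\<Prod>i\<in>{1..CARD('k)}. (coord (2*i-1) (L v))\<^sup>2 + \<epsilon> (inv \<theta> i) * (coord (2*i) (L v))\<^sup>2)" for v
      unfolding quad_norm_numbered
    proof (intro prod.cong refl)
      fix i assume i: "i \<in> {1..CARD('k)}"
      then have i1: "1 \<le> i" and r: "1 \<le> 2*i-1" "2*i-1 \<le> 2 * CARD('k)" "1 \<le> 2*i" "2*i \<le> 2 * CARD('k)"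
        by auto
      show "(\<Phi> v $ Inl (inv \<theta> i))\<^sup>2 + \<epsilon> (inv \<theta> i) * (\<Phi> v $ Inr (inv \<theta> i))\<^sup>2
          = (coord (2*i-1) (L v))\<^sup>2 + \<epsilon> (inv \<theta> i) * (coord (2*i) (L v))\<^sup>2"
        unfolding L(3)[OF r(1,2)] L(3)[OF r(3,4)] pair_coordinate(1)[OF i1] pair_coordinate(2) ..
    qed
  qed
qed

lemma coordinates_last_factor_split:
  fixes \<Phi> :: "real^('k + 'k) \<Rightarrow> real^('k + 'k)"
  assumes \<Phi>: "linear \<Phi>" "bij \<Phi>" and n: "CARD('k) = n + 1" and neg: "\<epsilon> (inv \<theta> (n + 1)) = -1"
  obtains L :: "real^('k + 'k) \<Rightarrow> real^('k + 'k)" where "linear L" "bij L"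
    "\<And>v. quad_norm \<epsilon> (\<Phi> v) =
      (\<Prod>i\<in>{1..n}. (coord (2*i-1) (L v))\<^sup>2 + \<epsilon> (inv \<theta> i) * (coord (2*i) (L v))\<^sup>2)
        * coord (2*n+1) (L v) * coord (2*n+2) (L v)"
proof -
  define k0 where "k0 = inv \<theta> (n + 1)"
  \<comment> \<open>The last factor has negative sign, so \<open>x^2 - y^2\<close> is split by the
    new coordinates \<open>x - y\<close> and \<open>x + y\<close>.\<close>
  define q where "q m w = (if m = 2*n+1 then w $ Inl k0 - w $ Inr k0
     else if m = 2*n+2 then w $ Inl k0 + w $ Inr k0 else pair_coordinate m w)" for m w
  have lin: "linear (q m)" for m
    using linear_add[OF linear_pair_coordinate] linear_cmul[OF linear_pair_coordinate]
    by (intro linearI) (simp_all add: q_def algebra_simps)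
  have \<theta>k0: "\<theta> k = n + 1 \<longleftrightarrow> k = k0" for k
  proof -
    have "\<theta> k0 = n + 1"
      unfolding k0_def using \<theta> n by (intro f_inv_into_f) (auto simp: bij_betw_def)
    then show ?thesis using inj_eq[OF bij_betw_imp_inj_on[OF \<theta>]] by metis
  qed
  have inj: "w = 0" if z: "\<And>m. 1 \<le> m \<Longrightarrow> m \<le> 2 * CARD('k) \<Longrightarrow> q m w = 0" for w
  proof -
    have "w $ Inl k = 0 \<and> w $ Inr k = 0" for k
    proof (cases "k = k0")
      case True
      then show ?thesis using z[of "2*n+1"] z[of "2*n+2"] n by (simp add: q_def)
    next
      case False
      then have "\<theta> k \<noteq> n + 1" using \<theta>k0 by blast
      then have "2 * \<theta> k - 1 \<noteq> 2 * n + 1" "2 * \<theta> k - 1 \<noteq> 2 * n + 2" "2 * \<theta> k \<noteq> 2 * n + 1" "2 * \<theta> k \<noteq> 2 * n + 2"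
        using numbering_range[of k] by presburger+
      then show ?thesis
        using z[of "2 * \<theta> k - 1"] z[of "2 * \<theta> k"] numbering_range[of k] pair_coordinate[of "\<theta> k" w]
        by (auto simp: q_def)
    qed
    then have "w $ j = 0" for j by (cases j) auto
    then show ?thesis by (simp add: vec_eq_iff)
  qed
  obtain L :: "real^('k + 'k) \<Rightarrow> real^('k + 'k)" where L: "linear L" "bij L"
    "\<And>m v. 1 \<le> m \<Longrightarrow> m \<le> 2 * CARD('k) \<Longrightarrow> coord m (L v) = q m (\<Phi> v)"
    by (rule numbered_coordinates_map[OF \<Phi> lin inj]) (assumption, rule that)
  show thesis
  proof (rule that[OF L(1,2)])
    fix v
    let ?w = "\<Phi> v"
    let ?t = "\<lambda>i. (?w $ Inl (inv \<theta> i))\<^sup>2 + \<epsilon> (inv \<theta> i) * (?w $ Inr (inv \<theta> i))\<^sup>2"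
    have "quad_norm \<epsilon> ?w = ?t (n+1) * (\<Prod>i\<in>{1..n}. ?t i)"
      unfolding quad_norm_numbered n using prod.nat_ivl_Suc'[of 1 n ?t] by simp
    moreover have "?t (n+1) = coord (2*n+1) (L v) * coord (2*n+2) (L v)"
    proof -
      have c: "coord (2*n+1) (L v) = ?w $ Inl k0 - ?w $ Inr k0" "coord (2*n+2) (L v) = ?w $ Inl k0 + ?w $ Inr k0"
        using L(3)[of "2*n+1" v] L(3)[of "2*n+2" v] n by (simp_all add: q_def)
      show ?thesis unfolding c using neg by (simp add: k0_def power2_eq_square algebra_simps)
    qed
    moreover have "(\<Prod>i\<in>{1..n}. ?t i) =
      (\<Prod>i\<in>{1..n}. (coord (2*i-1) (L v))\<^sup>2 + \<epsilon> (inv \<theta> i) * (coord (2*i) (L v))\<^sup>2)"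
    proof (intro prod.cong refl)
      fix i assume i: "i \<in> {1..n}"
      then have i1: "1 \<le> i" and r: "1 \<le> 2*i-1" "2*i-1 \<le> 2 * CARD('k)" "1 \<le> 2*i" "2*i \<le> 2 * CARD('k)"
        using n by auto
      have ne: "2 * i - 1 \<noteq> 2 * n + 1" "2 * i - 1 \<noteq> 2 * n + 2" "2 * i \<noteq> 2 * n + 1" "2 * i \<noteq> 2 * n + 2"
        using i by auto
      have "q (2*i-1) ?w = pair_coordinate (2*i-1) ?w" "q (2*i) ?w = pair_coordinate (2*i) ?w"
        unfolding q_def using ne by (simp_all only: if_False)
      then show "?t i = (coord (2*i-1) (L v))\<^sup>2 + \<epsilon> (inv \<theta> i) * (coord (2*i) (L v))\<^sup>2"
        unfolding L(3)[OF r(1,2)] L(3)[OF r(3,4)] by (simp only: pair_coordinate(1)[OF i1] pair_coordinate(2))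
    qed
    ultimately show "quad_norm \<epsilon> ?w =
      (\<Prod>i\<in>{1..n}. (coord (2*i-1) (L v))\<^sup>2 + \<epsilon> (inv \<theta> i) * (coord (2*i) (L v))\<^sup>2)
        * coord (2*n+1) (L v) * coord (2*n+2) (L v)" by simp
  qed
qed

end

section \<open>The classification\<close>

locale flat_J_hypersphere =
  fixes A :: "('m::{t2_space, second_countable_topology}, 'd::finite) chart set"
    and f C :: "'m \<Rightarrow> real^('k::finite + 'k)" and l :: real
  assumes card: "2 * CARD('k) = CARD('d) + 1" "CARD('d) \<ge> 2"
    and atlas: "smooth_atlas A" and conn: "connected (UNIV :: 'm set)"
    and imm: "immersion A f" and blaschke: "blaschke_field A f C"
    and shape: "\<And>\<kappa> y u. \<kappa> \<in> A \<Longrightarrow> y \<in> chart_image \<kappa> \<Longrightarrow> shape_op (in_chart \<kappa> f) (in_chart \<kappa> C) y u = l *\<^sub>R u"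
    and J_tan: "\<And>\<kappa> y. \<kappa> \<in> A \<Longrightarrow> y \<in> chart_image \<kappa> \<Longrightarrow> J_tilde (in_chart \<kappa> C y) \<in> tangent_image (in_chart \<kappa> f) y"
    and flat_metric: "flat_affine_metric A f C"
begin

lemma chart_covers: obtains \<kappa> where "\<kappa> \<in> A" "p \<in> fst \<kappa>"
  using atlas unfolding smooth_atlas_def by force

lemma chart:
  assumes "\<kappa> \<in> A"
  shows "open (fst \<kappa>)" "open (chart_image \<kappa>)"
    "homeomorphism (fst \<kappa>) (chart_image \<kappa>) (snd \<kappa>) (inv_into (fst \<kappa>) (snd \<kappa>))"
proof -
  have "case \<kappa> of (U, \<phi>) \<Rightarrow> open U \<and> open (\<phi> ` U) \<and> homeomorphism U (\<phi> ` U) \<phi> (inv_into U \<phi>)"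
    using atlas assms unfolding smooth_atlas_def by blast
  then show "open (fst \<kappa>)" "open (chart_image \<kappa>)"
    "homeomorphism (fst \<kappa>) (chart_image \<kappa>) (snd \<kappa>) (inv_into (fst \<kappa>) (snd \<kappa>))"
    by (simp_all add: chart_image_def split_def)
qed

lemma in_chart_eq: "\<kappa> \<in> A \<Longrightarrow> p \<in> fst \<kappa> \<Longrightarrow> in_chart \<kappa> F (snd \<kappa> p) = F p"
  using homeomorphism_apply1[OF chart(3)] by (simp add: in_chart_def)

lemma chart_image_mem: "p \<in> fst \<kappa> \<Longrightarrow> snd \<kappa> p \<in> chart_image \<kappa>"
  by (simp add: chart_image_def)

lemma open_chart_preimage:
  assumes "\<kappa> \<in> A" "open B" shows "open (fst \<kappa> \<inter> snd \<kappa> -` B)"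
  using continuous_open_preimage[OF homeomorphism_cont1[OF chart(3)[OF assms(1)]] chart(1)[OF assms(1)] assms(2)] .

lemma open_chart_image:
  assumes \<kappa>: "\<kappa> \<in> A" and V: "open V" "V \<subseteq> fst \<kappa>" shows "open (snd \<kappa> ` V)"
proof -
  have "openin (top_of_set (fst \<kappa>)) V" using V chart(1)[OF \<kappa>] by (simp add: openin_open_eq)
  then have "openin (top_of_set (chart_image \<kappa>)) (snd \<kappa> ` V)"
    by (rule homeomorphism_imp_open_map[OF chart(3)[OF \<kappa>]])
  then show ?thesis using chart(2)[OF \<kappa>] by (simp add: openin_open_eq)
qed

lemma hypersphere_chart:
  assumes \<kappa>: "\<kappa> \<in> A"
  shows "hypersphere_chart (chart_image \<kappa>) (in_chart \<kappa> f) (in_chart \<kappa> C) l"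
proof (intro hypersphere_chart.intro transversal_immersion.intro hypersphere_chart_axioms.intro)
  note b = blaschke[unfolded blaschke_field_def]
  show "open (chart_image \<kappa>)" by (rule chart(2)[OF \<kappa>])
  show "smooth_on (chart_image \<kappa>) (in_chart \<kappa> f)"
    using imm \<kappa> unfolding immersion_def smooth_map_def by blast
  show "smooth_on (chart_image \<kappa>) (in_chart \<kappa> C)"
    using b \<kappa> unfolding transversal_field_def smooth_map_def by blast
  show "bij (frame_column :: 'k + 'k \<Rightarrow> 'd option)" by (rule frame_column_bij[OF card(1)])
  show "inj (frechet_derivative (in_chart \<kappa> f) (at y))" if "y \<in> chart_image \<kappa>" for y
    using imm \<kappa> that unfolding immersion_def by blast
  show "in_chart \<kappa> C y \<notin> tangent_image (in_chart \<kappa> f) y" if "y \<in> chart_image \<kappa>" for y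
    using b \<kappa> that unfolding transversal_field_def by blast
  show "shape_op (in_chart \<kappa> f) (in_chart \<kappa> C) y u = l *\<^sub>R u" if "y \<in> chart_image \<kappa>" for y u
    by (rule shape[OF \<kappa> that])
  show "\<exists>v. h_form (in_chart \<kappa> f) (in_chart \<kappa> C) y u v \<noteq> 0" if "y \<in> chart_image \<kappa>" "u \<noteq> 0" for y u
    using b \<kappa> that unfolding nondegenerate_def by blast
  show "omega_h (in_chart \<kappa> f) (in_chart \<kappa> C) y X = Theta (in_chart \<kappa> f) (in_chart \<kappa> C) y X"
    if "y \<in> chart_image \<kappa>" for y X
    using b \<kappa> that unfolding omega_h_eq_Theta_def by blast
  show "D Z (\<lambda>p. omega_h (in_chart \<kappa> f) (in_chart \<kappa> C) p (\<lambda>j. X j p)) y =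
      (\<Sum>i\<in>{1..CARD('d)}. omega_h (in_chart \<kappa> f) (in_chart \<kappa> C) y
        ((\<lambda>j. X j y)(i := nabla (in_chart \<kappa> f) (in_chart \<kappa> C) Z (X i) y)))"
    if "smooth_on (chart_image \<kappa>) Z" "\<And>i. smooth_on (chart_image \<kappa>) (X i)" "y \<in> chart_image \<kappa>" for Z X y
    using b \<kappa> that unfolding omega_h_parallel_def Let_def by blast
  show "sectional_curvature (h_form (in_chart \<kappa> f) (in_chart \<kappa> C)) y u v = 0"
    if "y \<in> chart_image \<kappa>" "plane_discriminant (h_form (in_chart \<kappa> f) (in_chart \<kappa> C)) y u v \<noteq> 0" for y u v
    using flat_metric \<kappa> that unfolding flat_affine_metric_def Let_def by blast
  show "J_tilde (in_chart \<kappa> C y) \<in> tangent_image (in_chart \<kappa> f) y" if "y \<in> chart_image \<kappa>" for y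
    by (rule J_tan[OF \<kappa> that])
  show "CARD('d) \<ge> 2" by (rule card(2))
qed

lemma chart_geometry:
  assumes \<kappa>: "\<kappa> \<in> A" and ne: "chart_image \<kappa> \<noteq> {}"
  shows "tangent_involution (chart_image \<kappa>) (in_chart \<kappa> f) (in_chart \<kappa> C) frame_column l J_tilde"
  by (rule hypersphere_chart.tangent_involution[OF hypersphere_chart[OF \<kappa>] ne])

theorem distribution_involutive: "distr_D_involutive A f"
  unfolding distr_D_involutive_def
proof (intro ballI allI impI)
  fix \<kappa> B y and X Y :: "'d vfield"
  assume \<kappa>: "\<kappa> \<in> A" and *: "open B \<and> B \<subseteq> chart_image \<kappa> \<and> smooth_on B X \<and> smooth_on B Y \<and>
        (\<forall>y\<in>B. X y \<in> distr_D (in_chart \<kappa> f) y \<and> Y y \<in> distr_D (in_chart \<kappa> f) y)" and y: "y \<in> B"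
  have "chart_image \<kappa> \<noteq> {}" using * y by blast
  from chart_geometry[OF \<kappa> this] interpret tangent_involution "chart_image \<kappa>" "in_chart \<kappa> f" "in_chart \<kappa> C"
    "frame_column" l J_tilde .
  \<comment> \<open>Since \<open>J_tilde\<close> is an involution, a tangent vector lies in the
    image of the tangent space exactly if its own image under \<open>J_tilde\<close> is
    tangent.\<close>
  have D: "w \<in> distr_D (in_chart \<kappa> f) y \<longleftrightarrow> \<pi> y (J_tilde (dd w (in_chart \<kappa> f) y)) = 0"
    if "y \<in> chart_image \<kappa>" for y w
    using J_tangent_image_iff[OF that] by (auto simp: distr_D_def tangent_image_def)
  have BU: "y \<in> chart_image \<kappa>" if "y \<in> B" for y using * that by blast
  have "\<pi> y (J_tilde (dd (lie_bracket X Y y) (in_chart \<kappa> f) y)) = 0"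
    by (rule bracket_closed[of B X Y]) (use * y D BU in auto)
  then show "lie_bracket X Y y \<in> distr_D (in_chart \<kappa> f) y" using D[OF BU[OF y]] by simp
qed

section \<open>From local to global statements\<close>

lemma center_constant: obtains b where "\<And>p. f p + (1 / l) *\<^sub>R C p = b"
proof -
  let ?F = "\<lambda>p. f p + (1 / l) *\<^sub>R C p"
  have "\<exists>T. openin (top_of_set UNIV) T \<and> p \<in> T \<and> (\<forall>q\<in>T. ?F q = ?F p)" for p
  proof -
    obtain \<kappa> where \<kappa>: "\<kappa> \<in> A" "p \<in> fst \<kappa>" by (rule chart_covers)
    have y0: "snd \<kappa> p \<in> chart_image \<kappa>" by (rule chart_image_mem[OF \<kappa>(2)])
    then have "chart_image \<kappa> \<noteq> {}" by blast
    from chart_geometry[OF \<kappa>(1) this] interpret tangent_involution "chart_image \<kappa>" "in_chart \<kappa> f" "in_chart \<kappa> C"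
      "frame_column" l J_tilde .
    obtain r where r: "r > 0" "ball (snd \<kappa> p) r \<subseteq> chart_image \<kappa>"
      using openE[OF chart(2)[OF \<kappa>(1)] y0] by blast
    \<comment> \<open>\<open>G\<close> is the local representative of \<open>- C / l\<close> and has
      the same differential as the immersion, so the centre \<open>f + C / l\<close> is locally
      constant.\<close>
    let ?E = "\<lambda>y. in_chart \<kappa> f y - G y"
    have "(?E has_derivative (\<lambda>w. 0)) (at y within ball (snd \<kappa> p) r)" if "y \<in> ball (snd \<kappa> p) r" for y
    proof -
      have y: "y \<in> chart_image \<kappa>" using that r by blast
      have "(?E has_derivative (\<lambda>w. dd w (in_chart \<kappa> f) y - dd w G y)) (at y)"
        by (intro has_derivative_diff smooth_on_has_derivative[OF g y] smooth_on_has_derivative[OF sm_G y])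
      then show ?thesis by (simp add: dd_G[OF y] has_derivative_at_withinI)
    qed
    then have c: "?E y = ?E (snd \<kappa> p)" if "y \<in> ball (snd \<kappa> p) r" for y
      using has_derivative_zero_unique[OF convex_ball, of "snd \<kappa> p" r ?E y "snd \<kappa> p"] that r by simp
    let ?T = "fst \<kappa> \<inter> snd \<kappa> -` ball (snd \<kappa> p) r"
    have E: "?E (snd \<kappa> q) = ?F q" if "q \<in> fst \<kappa>" for q
      using in_chart_eq[OF \<kappa>(1) that, of f] in_chart_eq[OF \<kappa>(1) that, of C] by (simp add: G_def)
    show ?thesis
    proof (intro exI conjI ballI)
      show "openin (top_of_set UNIV) ?T"
        using open_chart_preimage[OF \<kappa>(1) open_ball] by (simp only: subtopology_UNIV open_openin)
      show "p \<in> ?T" using \<kappa>(2) r(1) by simp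
      fix q assume q: "q \<in> ?T"
      then have "snd \<kappa> q \<in> ball (snd \<kappa> p) r" by blast
      from c[OF this] show "?F q = ?F p" using q E[of q] E[OF \<kappa>(2)] by simp
    qed
  qed
  then have "?F constant_on UNIV" by (rule locally_constant_imp_constant[OF conn])
  then obtain b where "\<forall>p\<in>UNIV. ?F p = b" unfolding constant_on_def ..
  then show thesis by (intro that[of b]) simp
qed

lemma local_form:
  assumes b: "\<And>p. f p + (1 / l) *\<^sub>R C p = b"
  shows "\<exists>(\<epsilon> :: 'k \<Rightarrow> real) \<Phi>. (\<forall>k. \<epsilon> k = 1 \<or> \<epsilon> k = -1) \<and> linear \<Phi> \<and> bij \<Phi> \<and>
    (odd (CARD('k)) \<longrightarrow> (\<exists>k. \<epsilon> k = -1)) \<and> level_chart (\<lambda>q. f q - b) (\<lambda>v. quad_norm \<epsilon> (\<Phi> v)) p"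
proof -
  obtain \<kappa> where \<kappa>: "\<kappa> \<in> A" "p \<in> fst \<kappa>" by (rule chart_covers)
  define y0 where "y0 = snd \<kappa> p"
  have y0: "y0 \<in> chart_image \<kappa>" unfolding y0_def by (rule chart_image_mem[OF \<kappa>(2)])
  then have "chart_image \<kappa> \<noteq> {}" by blast
  from chart_geometry[OF \<kappa>(1) this] interpret tangent_involution "chart_image \<kappa>" "in_chart \<kappa> f" "in_chart \<kappa> C"
    "frame_column" l J_tilde .
  interpret A0: comm_algebra "mu y0" "G y0" by (rule comm_algebra[OF y0])
  have "CARD('k + 'k) = 2 * CARD('k)" by (simp add: mult_2)
  then obtain \<epsilon> :: "'k \<Rightarrow> real" and \<Phi> where sc: "A0.split_coordinates \<epsilon> \<Phi>"
    by (rule A0.split_coordinates_exist) (rule that)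
  have sc': "\<And>k. \<epsilon> k = 1 \<or> \<epsilon> k = -1" "linear \<Phi>" "bij \<Phi>"
    using sc by (simp_all add: A0.split_coordinates_def)
  obtain r where r: "r > 0" "ball y0 r \<subseteq> chart_image \<kappa>" "\<And>y. y \<in> ball y0 r \<Longrightarrow> quad_norm \<epsilon> (\<Phi> (G y)) = 1"
    using norm_equation[OF y0 sc] by metis
  let ?T = "fst \<kappa> \<inter> snd \<kappa> -` ball y0 r"
  have neg: "odd (CARD('k)) \<longrightarrow> (\<exists>k. \<epsilon> k = -1)"
    using A0.split_coordinates_negative_sign[OF sc _ J_square[OF y0]] tr_mu_J[OF y0] by (simp add: A0.t_def)
  have fG: "f q - b = G (snd \<kappa> q)" if "q \<in> fst \<kappa>" for q
    using b[of q] in_chart_eq[OF \<kappa>(1) that, of C] by (simp add: G_def algebra_simps)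
  have "\<exists>B. open B \<and> (\<lambda>q. f q - b) ` V = B \<inter> {v. quad_norm \<epsilon> (\<Phi> v) = 1}"
    if V: "open V" "V \<subseteq> ?T" for V
  proof -
    have "open (snd \<kappa> ` V)" using V by (intro open_chart_image[OF \<kappa>(1)]) auto
    moreover have "snd \<kappa> ` V \<subseteq> ball y0 r" using V by auto
    ultimately have "\<exists>B. open B \<and> G ` (snd \<kappa> ` V) = B \<inter> {v. quad_norm \<epsilon> (\<Phi> v) = 1}"
      using r by (intro open_in_level_set[where m="2 * CARD('k)"]) (auto simp: linear_cmul[OF sc'(2)] quad_norm_scale)
    moreover have "(\<lambda>q. f q - b) ` V = G ` (snd \<kappa> ` V)"
      unfolding image_image using fG V by (intro image_cong) auto
    ultimately show ?thesis by simp
  qed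
  moreover have "open ?T" by (rule open_chart_preimage[OF \<kappa>(1) open_ball])
  moreover have "p \<in> ?T" using \<kappa>(2) r(1) by (simp add: y0_def)
  ultimately have "level_chart (\<lambda>q. f q - b) (\<lambda>v. quad_norm \<epsilon> (\<Phi> v)) p"
    unfolding level_chart_def by blast
  then show ?thesis using sc' neg by blast
qed

text \<open>\<open>local_form\<close> chooses signs and coordinates at each point independently.
  Only the resulting form, as a function on the ambient space, is compared: a level chart at
  \<open>p\<close> serves all points near \<open>p\<close>, so by
  \<open>level_chart_determines_form\<close> the form is locally constant and, by connectedness, the
  same everywhere.\<close>

theorem global_form:
  obtains \<epsilon> :: "'k \<Rightarrow> real" and \<Phi> b where "\<And>k. \<epsilon> k = 1 \<or> \<epsilon> k = -1" "linear \<Phi>" "bij \<Phi>"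
    "odd (CARD('k)) \<Longrightarrow> \<exists>k. \<epsilon> k = -1"
    "\<And>p. level_chart (\<lambda>q. f q - b) (\<lambda>v. quad_norm \<epsilon> (\<Phi> v)) p"
proof -
  obtain b where b: "\<And>p. f p + (1 / l) *\<^sub>R C p = b" using center_constant by metis
  have "\<forall>p. \<exists>z :: ('k \<Rightarrow> real) \<times> (real^('k + 'k) \<Rightarrow> real^('k + 'k)). (\<forall>k. fst z k = 1 \<or> fst z k = -1) \<and> linear (snd z) \<and> bij (snd z) \<and>
    (odd (CARD('k)) \<longrightarrow> (\<exists>k. fst z k = -1)) \<and> level_chart (\<lambda>q. f q - b) (\<lambda>v. quad_norm (fst z) (snd z v)) p"
  proof
    fix p
    obtain \<epsilon> :: "'k \<Rightarrow> real" and \<Phi> where "(\<forall>k. \<epsilon> k = 1 \<or> \<epsilon> k = -1) \<and> linear \<Phi> \<and> bij \<Phi> \<and>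
      (odd (CARD('k)) \<longrightarrow> (\<exists>k :: 'k. \<epsilon> k = -1)) \<and> level_chart (\<lambda>q. f q - b) (\<lambda>v. quad_norm \<epsilon> (\<Phi> v)) p"
      using local_form[OF b, of p] by (elim exE)
    then show "\<exists>z :: ('k \<Rightarrow> real) \<times> (real^('k + 'k) \<Rightarrow> real^('k + 'k)). (\<forall>k. fst z k = 1 \<or> fst z k = -1) \<and> linear (snd z) \<and> bij (snd z) \<and>
      (odd (CARD('k)) \<longrightarrow> (\<exists>k :: 'k. fst z k = -1)) \<and> level_chart (\<lambda>q. f q - b) (\<lambda>v. quad_norm (fst z) (snd z v)) p"
      by (intro exI[of _ "(\<epsilon>, \<Phi>)"]) simp
  qed
  then obtain z :: "'m \<Rightarrow> ('k \<Rightarrow> real) \<times> (real^('k + 'k) \<Rightarrow> real^('k + 'k))" where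
    z: "\<And>p k. fst (z p) k = 1 \<or> fst (z p) k = -1" "\<And>p. linear (snd (z p))" "\<And>p. bij (snd (z p))"
      "\<And>p. odd (CARD('k)) \<Longrightarrow> \<exists>k. fst (z p) k = -1"
      "\<And>p. level_chart (\<lambda>q. f q - b) (\<lambda>v. quad_norm (fst (z p)) (snd (z p) v)) p" by metis
  let ?F = "\<lambda>p v. quad_norm (fst (z p)) (snd (z p) v)"
  have "\<exists>T. openin (top_of_set UNIV) T \<and> p \<in> T \<and> (\<forall>q\<in>T. ?F q = ?F p)" for p
  proof -
    obtain T where T: "open T" "p \<in> T"
      "\<forall>V. open V \<and> V \<subseteq> T \<longrightarrow> (\<exists>B. open B \<and> (\<lambda>q. f q - b) ` V = B \<inter> {v. ?F p v = 1})"
      using z(5)[of p] unfolding level_chart_def by blast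
    have "?F q = ?F p" if "q \<in> T" for q
    proof -
      have "level_chart (\<lambda>q. f q - b) (?F p) q" unfolding level_chart_def using T that by blast
      then show ?thesis
        by (rule level_chart_determines_form[OF z(2)[of q] z(2)[of p] z(5)[of q]])
    qed
    moreover have "openin (top_of_set UNIV) T" using T(1) by (simp only: subtopology_UNIV open_openin)
    ultimately show ?thesis using T(2) by (intro exI[of _ T] conjI ballI)
  qed
  then have "?F constant_on UNIV" by (rule locally_constant_imp_constant[OF conn])
  then obtain F where "\<forall>p\<in>UNIV. ?F p = F" unfolding constant_on_def ..
  then have F: "?F p = F" for p by (rule bspec) simp
  show thesis
  \<comment> \<open>The signs and coordinates found at any single point represent the common form;
    \<open>undefined\<close> names such a point.\<close>
  proof (rule that[of "fst (z undefined)" "snd (z undefined)" b])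
    fix p
    have "level_chart (\<lambda>q. f q - b) F p" using z(5)[of p] unfolding F .
    then show "level_chart (\<lambda>q. f q - b) (?F undefined) p" unfolding F .
  qed (use z in blast)+
qed

end

theorem proposition5p7:
  fixes n :: nat
    and A :: "('m::{t2_space, second_countable_topology}, 'd::finite) chart set"
    and f C :: "'m \<Rightarrow> real^('k::finite + 'k)"
  assumes "n \<ge> 1"
    and "CARD('k) = n + 1"
    and "CARD('d) = 2 * n + 1"
    and "smooth_atlas A"
    and "connected (UNIV :: 'm set)"
    and "orientable_atlas A"
    and "J_tangent_affine_hypersphere A f C"
    and "flat_affine_metric A f C"
  shows "distr_D_involutive A f \<and>
    (odd n \<longrightarrow> (\<exists>\<epsilon> :: nat \<Rightarrow> real. (\<forall>i. \<epsilon> i \<in> {1, -1}) \<and>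
       affine_equivalent f
         {v. (\<Prod>i\<in>{1..n+1}. (coord (2*i-1) v)\<^sup>2 + \<epsilon> i * (coord (2*i) v)\<^sup>2) = 1})) \<and>
    (even n \<longrightarrow> (\<exists>\<epsilon> :: nat \<Rightarrow> real. (\<forall>i. \<epsilon> i \<in> {1, -1}) \<and>
       affine_equivalent f
         {v. (\<Prod>i\<in>{1..n}. (coord (2*i-1) v)\<^sup>2 + \<epsilon> i * (coord (2*i) v)\<^sup>2)
               * coord (2*n+1) v * coord (2*n+2) v = 1}))"
proof -
  from assms(7) obtain l where "immersion A f" "blaschke_field A f C"
    "\<forall>\<kappa>\<in>A. \<forall>y\<in>chart_image \<kappa>. \<forall>u. shape_op (in_chart \<kappa> f) (in_chart \<kappa> C) y u = l *\<^sub>R u"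
    "\<forall>\<kappa>\<in>A. \<forall>y\<in>chart_image \<kappa>. J_tilde (in_chart \<kappa> C y) \<in> tangent_image (in_chart \<kappa> f) y"
    unfolding J_tangent_affine_hypersphere_def affine_hypersphere_def by blast
  then interpret flat_J_hypersphere A f C l
    using assms(1-5,8) by unfold_locales auto
  obtain \<epsilon> :: "'k \<Rightarrow> real" and \<Phi> b where \<epsilon>: "\<And>k. \<epsilon> k = 1 \<or> \<epsilon> k = -1" and \<Phi>: "linear \<Phi>" "bij \<Phi>"
    and neg: "odd (CARD('k)) \<Longrightarrow> \<exists>k. \<epsilon> k = -1"
    and lc: "\<And>p. level_chart (\<lambda>q. f q - b) (\<lambda>v. quad_norm \<epsilon> (\<Phi> v)) p"
    by (rule global_form) (rule that)
  have "\<exists>\<epsilon> :: nat \<Rightarrow> real. (\<forall>i. \<epsilon> i \<in> {1, -1}) \<and>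
       affine_equivalent f
         {v. (\<Prod>i\<in>{1..n+1}. (coord (2*i-1) v)\<^sup>2 + \<epsilon> i * (coord (2*i) v)\<^sup>2) = 1}"
  proof -
    obtain \<theta> :: "'k \<Rightarrow> nat" where \<theta>: "bij_betw \<theta> UNIV {1..CARD('k)}"
      by (rule exists_numbering[of undefined]) (rule that)
    obtain L :: "real^('k + 'k) \<Rightarrow> real^('k + 'k)" where L: "linear L" "bij L" and eq:
      "\<And>v. quad_norm \<epsilon> (\<Phi> v) =
        (\<Prod>i\<in>{1..CARD('k)}. (coord (2*i-1) (L v))\<^sup>2 + \<epsilon> (inv \<theta> i) * (coord (2*i) (L v))\<^sup>2)"
      by (rule coordinates_all_signs[where \<epsilon>=\<epsilon>, OF \<theta> \<Phi>]) (rule that)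
    show ?thesis
    proof (intro exI conjI allI)
      show "\<epsilon> (inv \<theta> i) \<in> {1, -1}" for i using \<epsilon> by blast
      show "affine_equivalent f
         {v. (\<Prod>i\<in>{1..n+1}. (coord (2*i-1) v)\<^sup>2 + \<epsilon> (inv \<theta> i) * (coord (2*i) v)\<^sup>2) = 1}"
        by (rule affine_equivalentI[OF L _ lc]) (simp only: eq assms(2) mem_Collect_eq)
    qed
  qed
  moreover have "\<exists>\<epsilon> :: nat \<Rightarrow> real. (\<forall>i. \<epsilon> i \<in> {1, -1}) \<and>
       affine_equivalent f
         {v. (\<Prod>i\<in>{1..n}. (coord (2*i-1) v)\<^sup>2 + \<epsilon> i * (coord (2*i) v)\<^sup>2)
               * coord (2*n+1) v * coord (2*n+2) v = 1}" if "even n"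
  proof -
    \<comment> \<open>There are \<open>n + 1\<close> factors, an odd number, so some factor has sign
      \<open>-1\<close>; the numbering puts it last.\<close>
    have "odd (CARD('k))" using that assms(2) by simp
    then obtain k0 where k0: "\<epsilon> k0 = -1" using neg by blast
    obtain \<theta> :: "'k \<Rightarrow> nat" where \<theta>: "bij_betw \<theta> UNIV {1..CARD('k)}" "\<theta> k0 = CARD('k)"
      by (rule exists_numbering[of k0]) (rule that)
    have last: "\<epsilon> (inv \<theta> (n + 1)) = -1"
      using inv_numbering[OF \<theta>(1), of k0] \<theta>(2) k0 assms(2) by simp
    obtain L :: "real^('k + 'k) \<Rightarrow> real^('k + 'k)" where L: "linear L" "bij L" and eq:
      "\<And>v. quad_norm \<epsilon> (\<Phi> v) =
        (\<Prod>i\<in>{1..n}. (coord (2*i-1) (L v))\<^sup>2 + \<epsilon> (inv \<theta> i) * (coord (2*i) (L v))\<^sup>2)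
          * coord (2*n+1) (L v) * coord (2*n+2) (L v)"
      by (rule coordinates_last_factor_split[where \<epsilon>=\<epsilon>, OF \<theta>(1) \<Phi> assms(2) last]) (rule that)
    show ?thesis
    proof (intro exI conjI allI)
      show "\<epsilon> (inv \<theta> i) \<in> {1, -1}" for i using \<epsilon> by blast
      show "affine_equivalent f
         {v. (\<Prod>i\<in>{1..n}. (coord (2*i-1) v)\<^sup>2 + \<epsilon> (inv \<theta> i) * (coord (2*i) v)\<^sup>2)
               * coord (2*n+1) v * coord (2*n+2) v = 1}"
        by (rule affine_equivalentI[OF L _ lc]) (simp only: eq mem_Collect_eq)
    qed
  qed
  ultimately show ?thesis using distribution_involutive by blast
qed


end
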